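(* Let $s\ge 0$, let $x_1,\dots,x_s$ and $y_1,\dots,y_s$ be two sequences of nonnegative integers, and let $u,v,z$ be three nonnegative integers. Then the following four $\mathrm{SL}(2,\mathbb{C})$-modules are isomorphic, through the following $\mathrm{SL}(2,\mathbb{C})$-isomorphisms. First row: $$\langle x_1,\dots,x_s,u,y_1,\dots,y_s\,\|\,z,x_1,\dots,x_s,v,y_1,\dots,y_s\rangle\simeq\langle x_1,\dots,x_s,v,y_1,\dots,y_s\,\|\,z,x_1,\dots,x_s,u,y_1,\dots,y_s\rangle.$$ Second row: $$\langle y_s,\dots,y_1,u,x_s,\dots,x_1\,\|\,y_s,\dots,y_1,v,x_s,\dots,x_1,z\rangle\simeq\langle y_s,\dots,y_1,v,x_s,\dots,x_1\,\|\,y_s,\dots,y_1,u,x_s,\dots,x_1,z\rangle.$$ First column: $$\langle x_1,\dots,x_s,u,y_1,\dots,y_s\,\|\,z,x_1,\dots,x_s,v,y_1,\dots,y_s\rangle\simeq\langle y_s,\dots,y_1,u,x_s,\dots,x_1\,\|\,y_s,\dots,y_1,v,x_s,\dots,x_1,z\rangle.$$ Second column: $$\langle x_1,\dots,x_s,v,y_1,\dots,y_s\,\|\,z,x_1,\dots,x_s,u,y_1,\dots,y_s\rangle\simeq\langle y_s,\dots,y_1,v,x_s,\dots,x_1\,\|\,y_s,\dots,y_1,u,x_s,\dots,x_1,z\rangle.$$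
   Context: For a partition $\lambda$, $\mathbb{S}_\lambda$ denotes the Schur functor on complex vector spaces (image of $V^{\otimes|\lambda|}$ under the Young symmetrizer of $\lambda$), so that $\mathbb{S}_{(n)}(V)\simeq\mathrm{Sym}^n(V)$, $\mathbb{S}_{(1^n)}(V)\simeq\Lambda^n(V)$. $\mathbb{S}_{(d)}(\mathbb{C}^2)=\mathrm{Sym}^d(\mathbb{C}^2)$ has dimension $d+1$. Given nonnegative integers $h_1,\dots,h_r$ and $v_1,\dots,v_{r+1}$, the notation $\langle h_1,\dots,h_r\,\|\,v_1,\dots,v_r,v_{r+1}\rangle$ means the $\mathrm{SL}(2,\mathbb{C})$-module $\mathbb{S}_\lambda(\mathbb{S}_{(w)}(\mathbb{C}^2))$, where $w=v_1+\cdots+v_{r+1}-1$ and $$\lambda=\big((h_1+\cdots+h_r)^{v_1},(h_1+\cdots+h_{r-1})^{v_2},\dots,(h_1+h_2)^{v_{r-1}},h_1^{v_r}\big),$$ exponents denoting multiplicities of parts (parts with multiplicity $0$, and parts equal to $0$, are omitted). Convention for the degenerate case $v_1=\dots=v_{r+1}=0$: $\mathbb{S}_{(-1)}(\mathbb{C}^2)$ is the zero space, and $\mathbb{S}_\emptyset(W)=\mathbb{C}$ is the trivial module for every $W$, including $W=0$. *)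

theory Defs
  imports "HOL-Analysis.Determinants" "HOL-Library.Function_Algebras"
begin

section \<open>Subspaces of function spaces\<close>

text \<open>
  Complex vector spaces are taken as linear subspaces of function spaces over some index type.
  This makes tensor powers concrete: the canonical map from the \<open>n\<close>-fold tensor power of
  \<open>V\<close> to the functions on \<open>n\<close>-tuples of indices is injective, so the tensor power of \<open>V\<close> is
  the span of the products \<open>v\<^sub>1(i\<^sub>1) \<cdots> v\<^sub>n(i\<^sub>n)\<close>.
\<close>

definition fscale :: "complex \<Rightarrow> ('a \<Rightarrow> complex) \<Rightarrow> ('a \<Rightarrow> complex)" where
  "fscale c f = (\<lambda>i. c * f i)"

global_interpretation fun_vs: vector_space "fscale :: complex \<Rightarrow> ('a \<Rightarrow> complex) \<Rightarrow> _"
  by standard (auto simp: fscale_def fun_eq_iff algebra_simps)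

definition linear_on :: "('a \<Rightarrow> complex) set \<Rightarrow> (('a \<Rightarrow> complex) \<Rightarrow> ('b \<Rightarrow> complex)) \<Rightarrow> bool" where
  "linear_on V f \<longleftrightarrow>
     (\<forall>x\<in>V. \<forall>y\<in>V. f (x + y) = f x + f y) \<and> (\<forall>c. \<forall>x\<in>V. f (fscale c x) = fscale c (f x))"


section \<open>Modules over SL(2,C)\<close>

definition SL2 :: "(complex^2^2) set" where
  "SL2 = {g. det g = 1}"

text \<open>Only the values of \<open>act M g\<close> for \<open>g \<in> SL2\<close> on \<open>vecs M\<close> are relevant.\<close>

record 'a rep =
  vecs :: "('a \<Rightarrow> complex) set"
  act :: "complex^2^2 \<Rightarrow> ('a \<Rightarrow> complex) \<Rightarrow> ('a \<Rightarrow> complex)"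

locale sl2_module =
  fixes M :: "'a rep"
  assumes subspace: "fun_vs.subspace (vecs M)"
    and act_closed: "\<lbrakk>g \<in> SL2; x \<in> vecs M\<rbrakk> \<Longrightarrow> act M g x \<in> vecs M"
    and act_linear: "g \<in> SL2 \<Longrightarrow> linear_on (vecs M) (act M g)"
    and act_one: "x \<in> vecs M \<Longrightarrow> act M (mat 1) x = x"
    and act_mult: "\<lbrakk>g \<in> SL2; h \<in> SL2; x \<in> vecs M\<rbrakk> \<Longrightarrow> act M (g ** h) x = act M g (act M h x)"

definition sl2_iso :: "'a rep \<Rightarrow> 'b rep \<Rightarrow> bool" (infix "\<simeq>\<^sub>S\<^sub>L" 50) where
  "M \<simeq>\<^sub>S\<^sub>L N \<longleftrightarrow> sl2_module M \<and> sl2_module N \<and>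
     (\<exists>\<phi>. linear_on (vecs M) \<phi> \<and> bij_betw \<phi> (vecs M) (vecs N) \<and>
          (\<forall>g\<in>SL2. \<forall>x\<in>vecs M. \<phi> (act M g x) = act N g (\<phi> x)))"

definition std_rep :: "2 rep" where
  "std_rep = \<lparr>vecs = UNIV, act = (\<lambda>g x. \<lambda>i. \<Sum>j\<in>UNIV. g $ i $ j * x j)\<rparr>"

definition zero_rep :: "'a rep" where
  "zero_rep = \<lparr>vecs = {0}, act = (\<lambda>g x. x)\<rparr>"


section \<open>Tensor powers\<close>

definition pure_tensor :: "('a \<Rightarrow> complex) list \<Rightarrow> ('a list \<Rightarrow> complex)" where
  "pure_tensor vs =
     (\<lambda>l. if length l = length vs then \<Prod>i<length vs. (vs ! i) (l ! i) else 0)"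

definition tensor_power :: "nat \<Rightarrow> ('a \<Rightarrow> complex) set \<Rightarrow> ('a list \<Rightarrow> complex) set" where
  "tensor_power n V = fun_vs.span {pure_tensor vs | vs. length vs = n \<and> set vs \<subseteq> V}"

text \<open>
  \<open>tensor_map n f\<close> is the \<open>n\<close>-th tensor power of the linear map \<open>f\<close>: it applies \<open>f\<close> in each of
  the tensor slots \<open>0, \<dots>, n - 1\<close> in turn (see \<open>tensor_map_pure\<close> below).
\<close>

definition slot_map ::
  "(('a \<Rightarrow> complex) \<Rightarrow> ('a \<Rightarrow> complex)) \<Rightarrow> nat \<Rightarrow> ('a list \<Rightarrow> complex) \<Rightarrow> ('a list \<Rightarrow> complex)" where
  "slot_map f i t = (\<lambda>l. f (\<lambda>a. t (l[i := a])) (l ! i))"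

definition tensor_map ::
  "nat \<Rightarrow> (('a \<Rightarrow> complex) \<Rightarrow> ('a \<Rightarrow> complex)) \<Rightarrow> ('a list \<Rightarrow> complex) \<Rightarrow> ('a list \<Rightarrow> complex)" where
  "tensor_map n f = fold (slot_map f) [0..<n]"

text \<open>
  The right action of permutations on tensors,
  \<open>(v\<^sub>1 \<otimes> \<cdots> \<otimes> v\<^sub>n) \<cdot> \<sigma> = v\<^bsub>\<sigma>(1)\<^esub> \<otimes> \<cdots> \<otimes> v\<^bsub>\<sigma>(n)\<^esub>\<close> (see \<open>place_perm_pure\<close> below).
\<close>

definition place_perm :: "(nat \<Rightarrow> nat) \<Rightarrow> ('a list \<Rightarrow> complex) \<Rightarrow> ('a list \<Rightarrow> complex)" where
  "place_perm \<sigma> t = (\<lambda>l. t (permute_list (inv \<sigma>) l))"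


section \<open>Young symmetrizers and Schur functors\<close>

text \<open>
  Partitions are weakly decreasing lists of parts; zero parts contribute no boxes. The boxes
  (row, column) of the diagram are numbered \<open>0, 1, \<dots>\<close> along the first row, then along the second
  row, and so on.
\<close>

definition boxes :: "nat list \<Rightarrow> (nat \<times> nat) list" where
  "boxes lam = concat (map (\<lambda>i. map (\<lambda>j. (i, j)) [0..<lam ! i]) [0..<length lam])"

definition row_group :: "nat list \<Rightarrow> (nat \<Rightarrow> nat) set" where
  "row_group lam = {\<sigma>. \<sigma> permutes {..<sum_list lam} \<and>
     (\<forall>k<sum_list lam. fst (boxes lam ! \<sigma> k) = fst (boxes lam ! k))}"

definition col_group :: "nat list \<Rightarrow> (nat \<Rightarrow> nat) set" where
  "col_group lam = {\<sigma>. \<sigma> permutes {..<sum_list lam} \<and>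
     (\<forall>k<sum_list lam. snd (boxes lam ! \<sigma> k) = snd (boxes lam ! k))}"

definition row_symmetrizer :: "nat list \<Rightarrow> ('a list \<Rightarrow> complex) \<Rightarrow> ('a list \<Rightarrow> complex)" where
  "row_symmetrizer lam t = (\<Sum>\<sigma>\<in>row_group lam. place_perm \<sigma> t)"

definition col_antisymmetrizer :: "nat list \<Rightarrow> ('a list \<Rightarrow> complex) \<Rightarrow> ('a list \<Rightarrow> complex)" where
  "col_antisymmetrizer lam t =
     (\<Sum>\<sigma>\<in>col_group lam. fscale (of_int (sign \<sigma>)) (place_perm \<sigma> t))"

text \<open>
  The action of the group algebra element \<open>c\<^sub>\<lambda> = a\<^sub>\<lambda> b\<^sub>\<lambda>\<close>; permutations act from the right, so
  \<open>a\<^sub>\<lambda>\<close> acts first.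
\<close>

definition young_symmetrizer :: "nat list \<Rightarrow> ('a list \<Rightarrow> complex) \<Rightarrow> ('a list \<Rightarrow> complex)" where
  "young_symmetrizer lam t = col_antisymmetrizer lam (row_symmetrizer lam t)"

definition schur :: "nat list \<Rightarrow> 'a rep \<Rightarrow> 'a list rep" where
  "schur lam M =
     \<lparr>vecs = young_symmetrizer lam ` tensor_power (sum_list lam) (vecs M),
      act = (\<lambda>g. tensor_map (sum_list lam) (act M g))\<rparr>"

text \<open>The module \<open>\<bbbS>\<^bsub>(w)\<^esub>(\<complex>\<^sup>2)\<close>, including the convention that it is zero for \<open>w = -1\<close>.\<close>

definition sym_C2 :: "int \<Rightarrow> 2 list rep" where
  "sym_C2 w = (if w < 0 then zero_rep else schur [nat w] std_rep)"

text \<open>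
  \<open>\<langle>h\<^sub>1, \<dots>, h\<^sub>r \<parallel> v\<^sub>1, \<dots>, v\<^bsub>r+1\<^esub>\<rangle>\<close>, for lists with \<open>length vs = length hs + 1\<close>; the last entry of
  \<open>vs\<close> enters only through \<open>w\<close>.
\<close>

definition bracket_partition :: "nat list \<Rightarrow> nat list \<Rightarrow> nat list" where
  "bracket_partition hs vs =
     filter (\<lambda>p. 0 < p)
       (concat (map (\<lambda>i. replicate (vs ! i) (sum_list (take (length hs - i) hs))) [0..<length hs]))"

definition bracket :: "nat list \<Rightarrow> nat list \<Rightarrow> 2 list list rep" ("\<langle>_ \<parallel> _\<rangle>") where
  "\<langle>hs \<parallel> vs\<rangle> = schur (bracket_partition hs vs) (sym_C2 (int (sum_list vs) - 1))"


section \<open>Well-definedness\<close>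

lemma linear_onD:
  assumes "linear_on V f"
  shows "x \<in> V \<Longrightarrow> y \<in> V \<Longrightarrow> f (x + y) = f x + f y"
    and "x \<in> V \<Longrightarrow> f (fscale c x) = fscale c (f x)"
  using assms by (auto simp: linear_on_def)

lemma linear_on_zero:
  assumes "linear_on V f" "fun_vs.subspace V"
  shows "f 0 = 0"
  using linear_onD(2)[OF assms(1) fun_vs.subspace_0[OF assms(2)], of 0] by simp

lemma pure_tensor_nonlength: "length l \<noteq> length vs \<Longrightarrow> pure_tensor vs l = 0"
  by (simp add: pure_tensor_def)

lemma pure_tensor_slice:
  assumes "i < length vs" "length l = length vs"
  shows "pure_tensor vs (l[i := a]) = (\<Prod>j\<in>{..<length vs} - {i}. (vs ! j) (l ! j)) * (vs ! i) a"
proof -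
  have "pure_tensor vs (l[i := a]) = (\<Prod>j<length vs. (vs ! j) (l[i := a] ! j))"
    using assms by (simp add: pure_tensor_def)
  also have "\<dots> = (vs ! i) (l[i := a] ! i) * (\<Prod>j\<in>{..<length vs} - {i}. (vs ! j) (l[i := a] ! j))"
    using assms by (subst prod.remove[of _ i]) auto
  also have "(\<Prod>j\<in>{..<length vs} - {i}. (vs ! j) (l[i := a] ! j))
      = (\<Prod>j\<in>{..<length vs} - {i}. (vs ! j) (l ! j))"
    by (intro prod.cong) auto
  finally show ?thesis
    using assms by simp
qed

lemma tensor_power_subspace: "fun_vs.subspace (tensor_power n V)"
  unfolding tensor_power_def by (rule fun_vs.subspace_span)

lemma pure_tensor_in: "length vs = n \<Longrightarrow> set vs \<subseteq> V \<Longrightarrow> pure_tensor vs \<in> tensor_power n V"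
  unfolding tensor_power_def by (rule fun_vs.span_base) auto

lemma tensor_power_induct [consumes 1, case_names zero add_pure]:
  assumes "t \<in> tensor_power n V" "P 0"
    and "\<And>c vs t. length vs = n \<Longrightarrow> set vs \<subseteq> V \<Longrightarrow> t \<in> tensor_power n V \<Longrightarrow> P t \<Longrightarrow>
           P (fscale c (pure_tensor vs) + t)"
  shows "P t"
proof -
  have "t \<in> tensor_power n V \<and> P t"
    using assms(1) unfolding tensor_power_def
  proof (induction rule: fun_vs.span_induct_alt)
    case base
    show "0 \<in> fun_vs.span {pure_tensor vs | vs. length vs = n \<and> set vs \<subseteq> V} \<and> P 0"
      using assms(2) by (simp add: fun_vs.span_zero)
  next
    case (step c x y)
    then obtain vs where vs: "x = pure_tensor vs" "length vs = n" "set vs \<subseteq> V" by auto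
    show "fscale c x + y \<in> fun_vs.span {pure_tensor vs | vs. length vs = n \<and> set vs \<subseteq> V}
        \<and> P (fscale c x + y)"
    proof
      show "fscale c x + y \<in> fun_vs.span {pure_tensor vs | vs. length vs = n \<and> set vs \<subseteq> V}"
        using step fun_vs.span_base[of x] by (intro fun_vs.span_add fun_vs.span_scale) auto
      show "P (fscale c x + y)"
        using step vs assms(3)[of vs y c] by (simp add: tensor_power_def)
    qed
  qed
  then show ?thesis by blast
qed

lemma tensor_power_eqI:
  assumes "linear_on (tensor_power n V) F" "linear_on (tensor_power n V) G"
    and "\<And>vs. length vs = n \<Longrightarrow> set vs \<subseteq> V \<Longrightarrow> F (pure_tensor vs) = G (pure_tensor vs)"
    and "t \<in> tensor_power n V"
  shows "F t = G t"
  using assms(4)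
proof (induction rule: tensor_power_induct)
  case zero
  show "F 0 = G 0"
    using linear_on_zero[OF assms(1) tensor_power_subspace]
      linear_on_zero[OF assms(2) tensor_power_subspace] by simp
next
  case (add_pure c vs t)
  have p: "pure_tensor vs \<in> tensor_power n V" "fscale c (pure_tensor vs) \<in> tensor_power n V"
    using add_pure pure_tensor_in[of vs n V] fun_vs.subspace_scale[OF tensor_power_subspace]
    by blast+
  show "F (fscale c (pure_tensor vs) + t) = G (fscale c (pure_tensor vs) + t)"
    using add_pure p assms(3)
    by (simp add: linear_onD[OF assms(1)] linear_onD[OF assms(2)])
qed

lemma tensor_power_closedI:
  assumes "linear_on (tensor_power n V) F"
    and "\<And>vs. length vs = n \<Longrightarrow> set vs \<subseteq> V \<Longrightarrow> F (pure_tensor vs) \<in> tensor_power n V"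
    and "t \<in> tensor_power n V"
  shows "F t \<in> tensor_power n V"
  using assms(3)
proof (induction rule: tensor_power_induct)
  case zero
  show "F 0 \<in> tensor_power n V"
    using linear_on_zero[OF assms(1) tensor_power_subspace]
      fun_vs.subspace_0[OF tensor_power_subspace] by metis
next
  case (add_pure c vs t)
  have p: "pure_tensor vs \<in> tensor_power n V" "fscale c (pure_tensor vs) \<in> tensor_power n V"
    using add_pure pure_tensor_in[of vs n V] fun_vs.subspace_scale[OF tensor_power_subspace]
    by blast+
  show "F (fscale c (pure_tensor vs) + t) \<in> tensor_power n V"
    using add_pure p assms(2)[of vs]
    by (auto simp: linear_onD[OF assms(1)]
        intro!: fun_vs.subspace_add[OF tensor_power_subspace]
          fun_vs.subspace_scale[OF tensor_power_subspace])
qed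

lemma tensor_power_slice:
  assumes V: "fun_vs.subspace V" and "t \<in> tensor_power n V" "i < n"
  shows "(\<lambda>a. t (l[i := a])) \<in> V"
  using assms(2)
proof (induction rule: tensor_power_induct)
  case zero
  then show ?case using fun_vs.subspace_0[OF V] by (simp add: zero_fun_def)
next
  case (add_pure c vs t)
  have "(\<lambda>a. pure_tensor vs (l[i := a])) \<in> V"
  proof (cases "length l = n")
    case True
    then have "(\<lambda>a. pure_tensor vs (l[i := a]))
        = fscale (\<Prod>j\<in>{..<length vs} - {i}. (vs ! j) (l ! j)) (vs ! i)"
      using add_pure assms(3) by (auto simp: fscale_def pure_tensor_slice)
    moreover have "vs ! i \<in> V" using add_pure assms(3) by auto
    ultimately show ?thesis using fun_vs.subspace_scale[OF V] by simp
  next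
    case False
    then show ?thesis
      using add_pure fun_vs.subspace_0[OF V] by (simp add: pure_tensor_nonlength flip: zero_fun_def)
  qed
  then have "fscale c (\<lambda>a. pure_tensor vs (l[i := a])) + (\<lambda>a. t (l[i := a])) \<in> V"
    using add_pure fun_vs.subspace_add[OF V] fun_vs.subspace_scale[OF V] by blast
  then show ?case by (simp add: fscale_def plus_fun_def)
qed

context
  fixes V :: "('a \<Rightarrow> complex) set" and f :: "('a \<Rightarrow> complex) \<Rightarrow> ('a \<Rightarrow> complex)"
  assumes V: "fun_vs.subspace V" and f: "linear_on V f" and fV: "\<And>x. x \<in> V \<Longrightarrow> f x \<in> V"
begin

lemma slot_map_linear: "i < n \<Longrightarrow> linear_on (tensor_power n V) (slot_map f i)"
  unfolding linear_on_def
proof (intro conjI ballI allI)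
  fix x y assume i: "i < n" and xy: "x \<in> tensor_power n V" "y \<in> tensor_power n V"
  show "slot_map f i (x + y) = slot_map f i x + slot_map f i y"
  proof
    fix l
    have "(\<lambda>a. (x + y) (l[i := a])) = (\<lambda>a. x (l[i := a])) + (\<lambda>a. y (l[i := a]))"
      by (simp add: plus_fun_def)
    then show "slot_map f i (x + y) l = (slot_map f i x + slot_map f i y) l"
      using linear_onD(1)[OF f tensor_power_slice[OF V xy(1) i] tensor_power_slice[OF V xy(2) i], of l l]
      by (simp add: slot_map_def)
  qed
next
  fix c x assume i: "i < n" and x: "x \<in> tensor_power n V"
  show "slot_map f i (fscale c x) = fscale c (slot_map f i x)"
  proof
    fix l
    have "(\<lambda>a. fscale c x (l[i := a])) = fscale c (\<lambda>a. x (l[i := a]))"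
      by (simp add: fscale_def)
    then show "slot_map f i (fscale c x) l = fscale c (slot_map f i x) l"
      using linear_onD(2)[OF f tensor_power_slice[OF V x i], of c l]
      by (simp add: slot_map_def fscale_def)
  qed
qed

lemma slot_map_pure:
  assumes "i < length vs" "set vs \<subseteq> V"
  shows "slot_map f i (pure_tensor vs) = pure_tensor (vs[i := f (vs ! i)])"
proof
  fix l
  show "slot_map f i (pure_tensor vs) l = pure_tensor (vs[i := f (vs ! i)]) l"
  proof (cases "length l = length vs")
    case True
    let ?c = "\<Prod>j\<in>{..<length vs} - {i}. (vs ! j) (l ! j)"
    have "(\<lambda>a. pure_tensor vs (l[i := a])) = fscale ?c (vs ! i)"
      using True assms by (auto simp: fscale_def pure_tensor_slice)
    moreover have "vs ! i \<in> V" using assms by auto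
    ultimately have "slot_map f i (pure_tensor vs) l = ?c * f (vs ! i) (l ! i)"
      using linear_onD(2)[OF f, of "vs ! i" ?c] by (simp add: slot_map_def fscale_def)
    also have "\<dots> = pure_tensor (vs[i := f (vs ! i)]) (l[i := l ! i])"
      using True assms by (subst pure_tensor_slice) (auto intro!: prod.cong)
    finally show ?thesis by simp
  next
    case False
    then have "(\<lambda>a. pure_tensor vs (l[i := a])) = 0"
      by (simp add: pure_tensor_nonlength zero_fun_def)
    then show ?thesis
      using False linear_on_zero[OF f V] by (simp add: slot_map_def pure_tensor_nonlength)
  qed
qed

lemma slot_map_closed:
  assumes "i < n" "t \<in> tensor_power n V"
  shows "slot_map f i t \<in> tensor_power n V"
proof (rule tensor_power_closedI[OF slot_map_linear[OF assms(1)] _ assms(2)])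
  fix vs :: "('a \<Rightarrow> complex) list" assume vs: "length vs = n" "set vs \<subseteq> V"
  then have "vs ! i \<in> V"
    using assms(1) by (auto simp: subset_iff)
  then have "set (vs[i := f (vs ! i)]) \<subseteq> V"
    using vs fV by (intro set_update_subsetI)
  then show "slot_map f i (pure_tensor vs) \<in> tensor_power n V"
    using vs assms(1) by (simp add: slot_map_pure pure_tensor_in)
qed

lemma fold_slot_map:
  assumes "m \<le> n"
  shows "linear_on (tensor_power n V) (fold (slot_map f) [0..<m])"
    and "t \<in> tensor_power n V \<Longrightarrow> fold (slot_map f) [0..<m] t \<in> tensor_power n V"
    and "length vs = n \<Longrightarrow> set vs \<subseteq> V \<Longrightarrow>
      fold (slot_map f) [0..<m] (pure_tensor vs) = pure_tensor (map f (take m vs) @ drop m vs)"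
proof -
  have "linear_on (tensor_power n V) (fold (slot_map f) [0..<m]) \<and>
    (\<forall>t. t \<in> tensor_power n V \<longrightarrow> fold (slot_map f) [0..<m] t \<in> tensor_power n V) \<and>
    (\<forall>vs. length vs = n \<longrightarrow> set vs \<subseteq> V \<longrightarrow>
      fold (slot_map f) [0..<m] (pure_tensor vs) = pure_tensor (map f (take m vs) @ drop m vs))"
    using assms
  proof (induction m)
    case 0
    then show ?case by (simp add: linear_on_def)
  next
    case (Suc m)
    then have IH: "linear_on (tensor_power n V) (fold (slot_map f) [0..<m])"
      "\<And>t. t \<in> tensor_power n V \<Longrightarrow> fold (slot_map f) [0..<m] t \<in> tensor_power n V"
      "\<And>vs. length vs = n \<Longrightarrow> set vs \<subseteq> V \<Longrightarrow>
      fold (slot_map f) [0..<m] (pure_tensor vs) = pure_tensor (map f (take m vs) @ drop m vs)"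
      and m: "m < n" by auto
    show ?case
    proof (intro conjI allI impI)
      show "linear_on (tensor_power n V) (fold (slot_map f) [0..<Suc m])"
        using IH(1,2) slot_map_linear[OF m] by (simp add: linear_on_def)
    next
      fix t assume "t \<in> tensor_power n V"
      then show "fold (slot_map f) [0..<Suc m] t \<in> tensor_power n V"
        using IH(2) slot_map_closed[OF m] by simp
    next
      fix vs :: "('a \<Rightarrow> complex) list" assume vs: "length vs = n" "set vs \<subseteq> V"
      let ?ws = "map f (take m vs) @ drop m vs"
      have sub: "set ?ws \<subseteq> V"
        using vs fV by (auto dest: in_set_takeD in_set_dropD)
      have nth: "?ws ! m = vs ! m" using vs m by (simp add: nth_append)
      have "?ws[m := f (?ws ! m)] = map f (take (Suc m) vs) @ drop (Suc m) vs"
        unfolding nth using vs m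
        by (intro nth_equalityI) (auto simp: nth_append nth_list_update less_Suc_eq)
      then show "fold (slot_map f) [0..<Suc m] (pure_tensor vs)
          = pure_tensor (map f (take (Suc m) vs) @ drop (Suc m) vs)"
        using IH(3)[OF vs] slot_map_pure[of m ?ws] sub vs m by simp
    qed
  qed
  then show "linear_on (tensor_power n V) (fold (slot_map f) [0..<m])"
    and "t \<in> tensor_power n V \<Longrightarrow> fold (slot_map f) [0..<m] t \<in> tensor_power n V"
    and "length vs = n \<Longrightarrow> set vs \<subseteq> V \<Longrightarrow>
      fold (slot_map f) [0..<m] (pure_tensor vs) = pure_tensor (map f (take m vs) @ drop m vs)"
    by blast+
qed

lemma tensor_map_linear: "linear_on (tensor_power n V) (tensor_map n f)"
  unfolding tensor_map_def by (rule fold_slot_map(1)) simp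

lemma tensor_map_closed: "t \<in> tensor_power n V \<Longrightarrow> tensor_map n f t \<in> tensor_power n V"
  unfolding tensor_map_def by (rule fold_slot_map(2)) simp

lemma tensor_map_pure:
  "length vs = n \<Longrightarrow> set vs \<subseteq> V \<Longrightarrow> tensor_map n f (pure_tensor vs) = pure_tensor (map f vs)"
  unfolding tensor_map_def using fold_slot_map(3)[of n n vs] by simp

end

lemma place_perm_add: "place_perm \<sigma> (s + t) = place_perm \<sigma> s + place_perm \<sigma> t"
  and place_perm_scale: "place_perm \<sigma> (fscale c t) = fscale c (place_perm \<sigma> t)"
  by (auto simp: place_perm_def fscale_def fun_eq_iff)

lemma place_perm_pure:
  assumes \<sigma>: "\<sigma> permutes {..<length vs}"
  shows "place_perm \<sigma> (pure_tensor vs) = pure_tensor (permute_list \<sigma> vs)"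
proof
  fix l :: "'a list"
  show "place_perm \<sigma> (pure_tensor vs) l = pure_tensor (permute_list \<sigma> vs) l"
  proof (cases "length l = length vs")
    case True
    have "place_perm \<sigma> (pure_tensor vs) l = (\<Prod>j<length vs. (vs ! j) (l ! inv \<sigma> j))"
      using True by (simp add: place_perm_def pure_tensor_def permute_list_def)
    also have "\<dots> = (\<Prod>k<length vs. (vs ! \<sigma> k) (l ! inv \<sigma> (\<sigma> k)))"
      using prod.permute[OF \<sigma>, of "\<lambda>j. (vs ! j) (l ! inv \<sigma> j)"] by simp
    also have "\<dots> = pure_tensor (permute_list \<sigma> vs) l"
      using True by (simp add: pure_tensor_def permute_list_def permutes_inverses(2)[OF \<sigma>])
    finally show ?thesis .
  qed (simp add: place_perm_def pure_tensor_def)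
qed

lemma place_perm_closed:
  assumes \<sigma>: "\<sigma> permutes {..<n}" and t: "t \<in> tensor_power n V"
  shows "place_perm \<sigma> t \<in> tensor_power n V"
proof (rule tensor_power_closedI[OF _ _ t])
  show "linear_on (tensor_power n V) (place_perm \<sigma>)"
    by (simp add: linear_on_def place_perm_add place_perm_scale)
qed (use \<sigma> in \<open>auto simp: place_perm_pure intro!: pure_tensor_in\<close>)

lemma place_perm_tensor_map:
  assumes V: "fun_vs.subspace V" and f: "linear_on V f" and fV: "\<And>x. x \<in> V \<Longrightarrow> f x \<in> V"
    and \<sigma>: "\<sigma> permutes {..<n}" and t: "t \<in> tensor_power n V"
  shows "tensor_map n f (place_perm \<sigma> t) = place_perm \<sigma> (tensor_map n f t)"
proof (rule tensor_power_eqI[OF _ _ _ t])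
  note lin = tensor_map_linear[OF V f fV, of n]
  show "linear_on (tensor_power n V) (\<lambda>t. tensor_map n f (place_perm \<sigma> t))"
    using place_perm_closed[OF \<sigma>, where V = V]
    by (simp add: linear_on_def place_perm_add place_perm_scale linear_onD[OF lin])
  show "linear_on (tensor_power n V) (\<lambda>t. place_perm \<sigma> (tensor_map n f t))"
    by (simp add: linear_on_def place_perm_add place_perm_scale linear_onD[OF lin])
  fix vs :: "('a \<Rightarrow> complex) list" assume vs: "length vs = n" "set vs \<subseteq> V"
  then show "tensor_map n f (place_perm \<sigma> (pure_tensor vs))
      = place_perm \<sigma> (tensor_map n f (pure_tensor vs))"
    using \<sigma> tensor_map_pure[OF V f fV, of vs n] tensor_map_pure[OF V f fV, of "permute_list \<sigma> vs" n]
    by (simp add: place_perm_pure permute_list_map)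
qed

lemma linear_on_sum:
  assumes f: "linear_on V f" and V: "fun_vs.subspace V" and "\<And>i. i \<in> I \<Longrightarrow> x i \<in> V"
  shows "f (\<Sum>i\<in>I. x i) = (\<Sum>i\<in>I. f (x i))"
  using assms(3)
proof (induction I rule: infinite_finite_induct)
  case (insert i I)
  have "f (x i + sum x I) = f (x i) + f (sum x I)"
    using insert.prems by (intro linear_onD(1)[OF f] fun_vs.subspace_sum[OF V]) auto
  then show "f (\<Sum>i\<in>insert i I. x i) = (\<Sum>i\<in>insert i I. f (x i))"
    using insert by simp
qed (use linear_on_zero[OF f V] in auto)

lemma row_symmetrizer_add:
    "row_symmetrizer lam (s + t) = row_symmetrizer lam s + row_symmetrizer lam t"
  and row_symmetrizer_scale:
    "row_symmetrizer lam (fscale c t) = fscale c (row_symmetrizer lam t)"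
  by (simp_all only: row_symmetrizer_def place_perm_add place_perm_scale sum.distrib
      fun_vs.scale_sum_right)

lemma col_antisymmetrizer_add:
    "col_antisymmetrizer lam (s + t) = col_antisymmetrizer lam s + col_antisymmetrizer lam t"
  and col_antisymmetrizer_scale:
    "col_antisymmetrizer lam (fscale c t) = fscale c (col_antisymmetrizer lam t)"
  by (simp_all only: col_antisymmetrizer_def place_perm_add place_perm_scale sum.distrib
      fun_vs.scale_right_distrib fun_vs.scale_sum_right fun_vs.scale_scale mult.commute)

lemma young_symmetrizer_add:
    "young_symmetrizer lam (s + t) = young_symmetrizer lam s + young_symmetrizer lam t"
  and young_symmetrizer_scale:
    "young_symmetrizer lam (fscale c t) = fscale c (young_symmetrizer lam t)"
  by (simp_all only: young_symmetrizer_def row_symmetrizer_add row_symmetrizer_scale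
      col_antisymmetrizer_add col_antisymmetrizer_scale)

lemma row_symmetrizer_closed:
  "t \<in> tensor_power (sum_list lam) V \<Longrightarrow> row_symmetrizer lam t \<in> tensor_power (sum_list lam) V"
  by (auto simp: row_symmetrizer_def row_group_def
      intro!: fun_vs.subspace_sum[OF tensor_power_subspace] place_perm_closed)

lemma col_antisymmetrizer_closed:
  "t \<in> tensor_power (sum_list lam) V \<Longrightarrow> col_antisymmetrizer lam t \<in> tensor_power (sum_list lam) V"
  by (auto simp: col_antisymmetrizer_def col_group_def
      intro!: fun_vs.subspace_sum[OF tensor_power_subspace]
        fun_vs.subspace_scale[OF tensor_power_subspace] place_perm_closed)

lemma young_symmetrizer_closed:
  "t \<in> tensor_power (sum_list lam) V \<Longrightarrow> young_symmetrizer lam t \<in> tensor_power (sum_list lam) V"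
  by (simp add: young_symmetrizer_def row_symmetrizer_closed col_antisymmetrizer_closed)

lemma young_symmetrizer_tensor_map:
  assumes V: "fun_vs.subspace V" and f: "linear_on V f" and fV: "\<And>x. x \<in> V \<Longrightarrow> f x \<in> V"
    and t: "t \<in> tensor_power (sum_list lam) V"
  shows "tensor_map (sum_list lam) f (young_symmetrizer lam t)
           = young_symmetrizer lam (tensor_map (sum_list lam) f t)"
proof -
  let ?n = "sum_list lam"
  note lin = tensor_map_linear[OF V f fV, of ?n]
  note sub = tensor_power_subspace[of ?n V]
  have row: "tensor_map ?n f (row_symmetrizer lam t) = row_symmetrizer lam (tensor_map ?n f t)"
    if t: "t \<in> tensor_power ?n V" for t
    unfolding row_symmetrizer_def using t
    by (subst linear_on_sum[OF lin sub])
      (auto simp: row_group_def place_perm_closed intro!: sum.cong place_perm_tensor_map[OF V f fV])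
  have col: "tensor_map ?n f (col_antisymmetrizer lam t) = col_antisymmetrizer lam (tensor_map ?n f t)"
    if t: "t \<in> tensor_power ?n V" for t
    unfolding col_antisymmetrizer_def using t
    by (subst linear_on_sum[OF lin sub])
      (auto simp: col_group_def place_perm_closed linear_onD[OF lin]
        place_perm_tensor_map[OF V f fV]
        intro!: sum.cong fun_vs.subspace_scale[OF sub])
  show ?thesis
    using t by (simp add: young_symmetrizer_def row col row_symmetrizer_closed)
qed

lemma mat_1_in_SL2: "mat 1 \<in> SL2"
  by (simp add: SL2_def)

lemma mult_in_SL2: "g \<in> SL2 \<Longrightarrow> h \<in> SL2 \<Longrightarrow> g ** h \<in> SL2"
  by (simp add: SL2_def det_mul)

lemma sl2_module_schur:
  assumes "sl2_module M"
  shows "sl2_module (schur lam M)"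
proof -
  interpret sl2_module M by fact
  let ?n = "sum_list lam"
  let ?T = "tensor_power ?n (vecs M)" and ?c = "young_symmetrizer lam"
  note sub = tensor_power_subspace[of ?n "vecs M"]
  have lin: "linear_on ?T (tensor_map ?n (act M g))" if "g \<in> SL2" for g
    by (rule tensor_map_linear[OF subspace act_linear[OF that] act_closed[OF that]])
  have closed: "tensor_map ?n (act M g) t \<in> ?T" if "g \<in> SL2" "t \<in> ?T" for g t
    by (rule tensor_map_closed[OF subspace act_linear[OF that(1)] act_closed[OF that(1)] that(2)])
  have pure: "tensor_map ?n (act M g) (pure_tensor vs) = pure_tensor (map (act M g) vs)"
    if "g \<in> SL2" "length vs = ?n" "set vs \<subseteq> vecs M" for g vs
    by (rule tensor_map_pure[OF subspace act_linear[OF that(1)] act_closed[OF that(1)] that(2,3)])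
  have comm: "tensor_map ?n (act M g) (?c t) = ?c (tensor_map ?n (act M g) t)"
    if "g \<in> SL2" "t \<in> ?T" for g t
    by (rule young_symmetrizer_tensor_map[OF subspace act_linear[OF that(1)] act_closed[OF that(1)] that(2)])
  have img: "?c ` ?T \<subseteq> ?T"
    using young_symmetrizer_closed by blast
  have one: "tensor_map ?n (act M (mat 1)) t = t" if t: "t \<in> ?T" for t
  proof (rule tensor_power_eqI[OF lin[OF mat_1_in_SL2] _ _ t])
    fix vs :: "('a \<Rightarrow> complex) list" assume vs: "length vs = ?n" "set vs \<subseteq> vecs M"
    then have "map (act M (mat 1)) vs = vs" by (intro map_idI act_one) auto
    then show "tensor_map ?n (act M (mat 1)) (pure_tensor vs) = pure_tensor vs"
      using pure[OF mat_1_in_SL2 vs] by simp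
  qed (simp add: linear_on_def)
  have mult: "tensor_map ?n (act M (g ** h)) t
      = tensor_map ?n (act M g) (tensor_map ?n (act M h) t)"
    if g: "g \<in> SL2" and h: "h \<in> SL2" and t: "t \<in> ?T" for g h t
  proof (rule tensor_power_eqI[OF lin[OF mult_in_SL2[OF g h]] _ _ t])
    show "linear_on ?T (\<lambda>t. tensor_map ?n (act M g) (tensor_map ?n (act M h) t))"
      using closed[OF h] by (simp add: linear_on_def linear_onD[OF lin[OF g]] linear_onD[OF lin[OF h]])
    fix vs :: "('a \<Rightarrow> complex) list" assume vs: "length vs = ?n" "set vs \<subseteq> vecs M"
    have "map (act M (g ** h)) vs = map (act M g) (map (act M h) vs)"
      using vs act_mult[OF g h] by auto
    moreover have "set (map (act M h) vs) \<subseteq> vecs M"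
      using vs act_closed[OF h] by auto
    ultimately show "tensor_map ?n (act M (g ** h)) (pure_tensor vs)
        = tensor_map ?n (act M g) (tensor_map ?n (act M h) (pure_tensor vs))"
      using vs by (simp add: pure[OF mult_in_SL2[OF g h]] pure[OF h] pure[OF g] del: map_map)
  qed
  show ?thesis
  proof
    show "fun_vs.subspace (vecs (schur lam M))"
      unfolding fun_vs.subspace_def schur_def
    proof (simp, intro conjI ballI allI impI)
      have "?c 0 = ?c (fscale 0 0)" by simp
      then have "?c 0 = 0" unfolding young_symmetrizer_scale by simp
      then show "0 \<in> ?c ` ?T"
        using fun_vs.subspace_0[OF sub] by (metis image_eqI)
    qed (auto simp flip: young_symmetrizer_add young_symmetrizer_scale
        intro!: imageI fun_vs.subspace_add[OF sub] fun_vs.subspace_scale[OF sub])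
  next
    fix g x assume "g \<in> SL2" "x \<in> vecs (schur lam M)"
    then show "act (schur lam M) g x \<in> vecs (schur lam M)"
      using comm closed by (auto simp: schur_def)
  next
    fix g assume "g \<in> SL2"
    from lin[OF this] show "linear_on (vecs (schur lam M)) (act (schur lam M) g)"
      using img unfolding linear_on_def schur_def by (simp add: subset_iff)
  next
    fix x assume "x \<in> vecs (schur lam M)"
    then show "act (schur lam M) (mat 1) x = x"
      using one img by (auto simp: schur_def)
  next
    fix g h x assume "g \<in> SL2" "h \<in> SL2" "x \<in> vecs (schur lam M)"
    then show "act (schur lam M) (g ** h) x = act (schur lam M) g (act (schur lam M) h x)"
      using mult img by (auto simp: schur_def)
  qed
qed

lemma sl2_module_std_rep: "sl2_module std_rep"
proof
  fix x :: "2 \<Rightarrow> complex"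
  show "act std_rep (mat 1) x = x"
    by (auto simp: std_rep_def mat_def fun_eq_iff if_distrib [where f = "\<lambda>u. u * _"] cong: if_cong)
next
  fix g h :: "complex^2^2" and x :: "2 \<Rightarrow> complex"
  show "act std_rep (g ** h) x = act std_rep g (act std_rep h x)"
    by (auto simp: std_rep_def fun_eq_iff matrix_matrix_mult_def UNIV_2 algebra_simps)
qed (auto simp: std_rep_def linear_on_def fscale_def fun_eq_iff UNIV_2 algebra_simps)

lemma sl2_module_zero_rep: "sl2_module zero_rep"
  by standard (auto simp: zero_rep_def linear_on_def)

lemma sl2_module_bracket: "sl2_module \<langle>hs \<parallel> vs\<rangle>"
  by (simp add: bracket_def sym_C2_def sl2_module_schur sl2_module_std_rep sl2_module_zero_rep)

end

theory Submission
  imports Defs "Jordan_Normal_Form.Determinant"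
begin

text \<open>
  A module \<open>\<bbbS>\<^sub>\<lambda>(Sym\<^sup>w \<complex>\<^sup>2)\<close> is determined up to isomorphism by the multiplicities of its torus weights, and
  its character is a quotient of products of quantum integers, on which the transformations of the
  statement can be followed explicitly.

  \<^bold>\<open>Characters determine modules.\<close> Inside tensor powers of \<open>\<complex>\<^sup>2\<close> the standard Hermitian form satisfies
  \<open>\<langle>g x, y\<rangle> = \<langle>x, g\<^sup>* y\<rangle>\<close>, and \<open>SL2\<close> is closed under \<open>g \<mapsto> g\<^sup>*\<close>; so orthogonal complements of submodules are
  submodules. For a unit vector \<open>x\<close> of highest weight \<open>k\<close> the factorization of \<open>g\<close> into triangular
  matrices gives \<open>\<langle>g x, x\<rangle> = g\<^sub>1\<^sub>1\<^sup>k\<close>. This depends only on \<open>k\<close>, and it determines the Gram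
  matrix of the orbit of \<open>x\<close>, hence the module spanned by the orbit (\<open>orbit_span_iso\<close>). Splitting off such
  modules one after the other proves \<open>equal_weights_imp_iso\<close>.

  \<^bold>\<open>The character.\<close> The image of the Young symmetrizer has a basis indexed by semistandard tableaux
  (\<open>young_image_span\<close>, \<open>ssyt_independent\<close>): Garnir relations straighten every filling, and a triangularity
  argument gives independence. So the character is a principal specialization of a Schur
  function. Deleting the largest letter of a tableau yields a recursion over interlacing shapes, and
  subtracting consecutive rows of a Vandermonde determinant yields the same recursion; therefore the
  specialization is a quotient of Vandermonde products (\<open>ssyt_gf_product\<close>). With \<open>[k] = t\<^sup>k - t\<^sup>-\<^sup>k\<close> the character
  becomes the product of \<open>[b - a]\<close> over all pairs \<open>a < b\<close> of beads of \<open>\<lambda>\<close> (its beta-numbers), divided by the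
  same product for the beads \<open>0, \<dots>, m - 1\<close> (\<open>ssyt_character\<close>).

  \<^bold>\<open>Beads.\<close> The beads of the bracket with data \<open>h\<close> and \<open>v\<close> are, from below, \<open>v\<^sub>r\<^sub>+\<^sub>1\<close> beads, \<open>h\<^sub>1\<close> gaps, \<open>v\<^sub>r\<close> beads,
  \<open>h\<^sub>2\<close> gaps, up to \<open>h\<^sub>r\<close> gaps and \<open>v\<^sub>1\<close> beads. The third and the fourth isomorphism compare brackets with mutually
  reversed words; reversal keeps the distances of beads (\<open>bracket_char_rev\<close>). The first isomorphism, from which
  the second one then follows, compares the words
  \<open>Y \<bullet>\<^sup>v \<circ>\<^sup>u Y* \<bullet>\<^sup>z\<close> and \<open>Y \<bullet>\<^sup>u \<circ>\<^sup>v Y* \<bullet>\<^sup>z\<close>, where \<open>Y*\<close> is the reversal of \<open>Y\<close> with beads and gaps exchanged. Apart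
  from the final \<open>z\<close> beads, the second word is the reversal of the first one with beads and gaps
  exchanged. The effect of this operation on the product is explicit
  (\<open>qvand_reflect_complement\<close>), and it matches the change of the denominator (\<open>qvand_middle_swap\<close>).
\<close>

(* Throughout, "$" denotes components of matrices over a finite index type, and "inv" the inverse of a function. *)
no_notation vec_index (infixl "$" 100)
no_notation m_inv (\<open>(\<open>open_block notation=\<open>prefix inv\<close>\<close>inv\<index> _)\<close> [81] 80)

section \<open>Dimensions of subspaces\<close>

lemma sum_apply_pointwise: "(\<Sum>i\<in>I. f i) x = (\<Sum>i\<in>I. f i x :: complex)"
  by (induction I rule: infinite_finite_induct) auto

lemma finite_independent_supported:
  assumes fin: "finite I" and B: "fun_vs.independent B" and supp: "\<And>x i. x \<in> B \<Longrightarrow> i \<notin> I \<Longrightarrow> x i = 0"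
  shows "finite B"
proof -
  let ?e = "\<lambda>i j. if j = i then 1 else 0 :: complex"
  have "x \<in> fun_vs.span (?e ` I)" if "x \<in> B" for x
  proof -
    have "x = (\<Sum>i\<in>I. fscale (x i) (?e i))"
    proof
      fix j
      have "(\<Sum>i\<in>I. fscale (x i) (?e i)) j = (\<Sum>i\<in>I. if j = i then x j else 0)"
        unfolding sum_apply_pointwise by (intro sum.cong) (auto simp: fscale_def)
      then show "x j = (\<Sum>i\<in>I. fscale (x i) (?e i)) j"
        using supp[OF that, of j] fin by auto
    qed
    moreover have "(\<Sum>i\<in>I. fscale (x i) (?e i)) \<in> fun_vs.span (?e ` I)"
      by (intro fun_vs.span_sum fun_vs.span_scale fun_vs.span_base) auto
    ultimately show ?thesis by simp
  qed
  then show ?thesis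
    using fun_vs.independent_span_bound[of "?e ` I" B] fin B by blast
qed

text \<open>
  Function spaces over an infinite index type have infinite dimension, where \<open>dim\<close> of a
  subspace without finite basis is a junk value; so finiteness of independent subsets is a premise
  here, supplied later by \<open>finite_independent_supported\<close>.
\<close>

lemma dim_direct_sum:
  assumes A: "fun_vs.subspace A" and C: "fun_vs.subspace C" and AC: "A \<inter> C = {0}"
    and S: "S = {a + c | a c. a \<in> A \<and> c \<in> C}"
    and fin: "\<And>B. fun_vs.independent B \<Longrightarrow> B \<subseteq> S \<Longrightarrow> finite B"
  shows "fun_vs.dim S = fun_vs.dim A + fun_vs.dim C"
proof -
  obtain BA where BA: "BA \<subseteq> A" "fun_vs.independent BA" "A \<subseteq> fun_vs.span BA" "card BA = fun_vs.dim A"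
    using fun_vs.basis_exists by blast
  obtain BC where BC: "BC \<subseteq> C" "fun_vs.independent BC" "C \<subseteq> fun_vs.span BC" "card BC = fun_vs.dim C"
    using fun_vs.basis_exists by blast
  have sA: "fun_vs.span X \<subseteq> A" if "X \<subseteq> A" for X using that A by (rule fun_vs.span_minimal)
  have sC: "fun_vs.span X \<subseteq> C" if "X \<subseteq> C" for X using that C by (rule fun_vs.span_minimal)
  have nz: "0 \<notin> BA" "0 \<notin> BC" using BA(2) BC(2) fun_vs.dependent_zero by blast+
  have AC0: "x = 0" if "x \<in> A" "x \<in> C" for x using AC IntI[OF that] by simp
  have disj: "BA \<inter> BC = {}" using AC0 BA(1) BC(1) nz by (metis disjoint_iff subsetD)
  have spans: "fun_vs.span (BA \<union> BC) = S"
  proof -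
    have "fun_vs.span BA = A" using BA(3) sA[OF BA(1)] by (rule equalityI[rotated])
    moreover have "fun_vs.span BC = C" using BC(3) sC[OF BC(1)] by (rule equalityI[rotated])
    ultimately show ?thesis unfolding S fun_vs.span_Un by blast
  qed
  have ind: "fun_vs.independent (BA \<union> BC)"
    unfolding fun_vs.dependent_def
  proof
    assume "\<exists>a\<in>BA \<union> BC. a \<in> fun_vs.span (BA \<union> BC - {a})"
    then obtain a where a: "a \<in> BA \<union> BC" "a \<in> fun_vs.span (BA \<union> BC - {a})" by blast
    show False
    proof (cases "a \<in> BA")
      case True
      then have "BA \<union> BC - {a} = (BA - {a}) \<union> BC" using disj by blast
      with a(2) have "a \<in> fun_vs.span ((BA - {a}) \<union> BC)" by (simp only:)
      then obtain x y where xy: "a = x + y" "x \<in> fun_vs.span (BA - {a})" "y \<in> fun_vs.span BC"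
        unfolding fun_vs.span_Un by blast
      have "y = a - x" using xy(1) by (metis add_diff_cancel_left')
      moreover have "a - x \<in> A" using True BA(1) sA[of "BA - {a}"] xy(2) by (intro fun_vs.subspace_diff[OF A]) auto
      moreover have "y \<in> C" using xy(3) sC[OF BC(1)] by blast
      ultimately have "y = 0" by (metis AC0)
      then have "a \<in> fun_vs.span (BA - {a})" using xy(1,2) by (metis add.right_neutral)
      then show False using BA(2) True unfolding fun_vs.dependent_def by blast
    next
      case False
      then have aC: "a \<in> BC" using a by blast
      then have "BA \<union> BC - {a} = BA \<union> (BC - {a})" using disj by blast
      with a(2) have "a \<in> fun_vs.span (BA \<union> (BC - {a}))" by (simp only:)
      then obtain x y where xy: "a = x + y" "x \<in> fun_vs.span BA" "y \<in> fun_vs.span (BC - {a})"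
        unfolding fun_vs.span_Un by blast
      have "x = a - y" using xy(1) by (metis add_diff_cancel_right')
      moreover have "a - y \<in> C" using aC BC(1) sC[of "BC - {a}"] xy(3) by (intro fun_vs.subspace_diff[OF C]) auto
      moreover have "x \<in> A" using xy(2) sA[OF BA(1)] by blast
      ultimately have "x = 0" by (metis AC0)
      then have "a \<in> fun_vs.span (BC - {a})" using xy(1,3) by (metis add.left_neutral)
      then show False using BC(2) aC unfolding fun_vs.dependent_def by blast
    qed
  qed
  have sub: "BA \<union> BC \<subseteq> S" using spans fun_vs.span_superset[of "BA \<union> BC"] by blast
  have "finite (BA \<union> BC)" by (rule fin[OF ind sub])
  moreover have "fun_vs.dim S = card (BA \<union> BC)"
    using fun_vs.basis_card_eq_dim[OF sub _ ind] spans by simp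
  ultimately show ?thesis using disj BA(4) BC(4) by (simp add: card_Un_disjoint)
qed

lemma linear_on_span_image:
  assumes f: "linear_on A f" and A: "fun_vs.subspace A" and B: "B \<subseteq> A" and x: "x \<in> fun_vs.span B"
  shows "f x \<in> fun_vs.span (f ` B)"
proof -
  have "x \<in> A \<and> f x \<in> fun_vs.span (f ` B)"
    using x
  proof (induction rule: fun_vs.span_induct_alt)
    case base
    show ?case
      by (intro conjI fun_vs.subspace_0[OF A], subst linear_on_zero[OF f A], rule fun_vs.span_zero)
  next
    case (step c x y)
    have xA: "x \<in> A" "fscale c x \<in> A" using B step fun_vs.subspace_scale[OF A] by auto
    have "f (fscale c x + y) = fscale c (f x) + f y"
      using step xA linear_onD[OF f] by metis
    moreover have "fscale c (f x) + f y \<in> fun_vs.span (f ` B)"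
      using step by (intro fun_vs.span_add[OF fun_vs.span_scale[OF fun_vs.span_base[OF imageI]]]) auto
    ultimately show ?case
      using step fun_vs.subspace_add[OF A xA(2)] by metis
  qed
  then show ?thesis by blast
qed

lemma dim_surj_le:
  assumes f: "linear_on A f" and A: "fun_vs.subspace A" and im: "f ` A = A'"
    and fin: "\<And>B. fun_vs.independent B \<Longrightarrow> B \<subseteq> A \<Longrightarrow> finite B"
  shows "fun_vs.dim A' \<le> fun_vs.dim A"
proof -
  obtain B where B: "B \<subseteq> A" "fun_vs.independent B" "A \<subseteq> fun_vs.span B" "card B = fun_vs.dim A"
    using fun_vs.basis_exists by blast
  have finB: "finite B" using fin B by blast
  have "A' \<subseteq> fun_vs.span (f ` B)"
    using linear_on_span_image[OF f A B(1)] B(3) im by blast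
  then have "fun_vs.dim A' \<le> card (f ` B)" using finB by (intro fun_vs.dim_le_card) auto
  also have "\<dots> \<le> card B" by (rule card_image_le[OF finB])
  finally show ?thesis using B(4) by simp
qed

section \<open>Modules with a compatible Hermitian form\<close>

definition upper_unip :: "complex \<Rightarrow> complex^2^2" where
  "upper_unip s = vector [vector [1, s], vector [0, 1]]"

definition lower_unip :: "complex \<Rightarrow> complex^2^2" where
  "lower_unip s = vector [vector [1, 0], vector [s, 1]]"

definition torus :: "complex \<Rightarrow> complex^2^2" where
  "torus a = vector [vector [a, 0], vector [0, inverse a]]"

text \<open>
  The conjugate transpose. It maps \<open>SL2\<close> into itself, interchanges the two unipotent
  subgroups, and will be the adjoint of \<open>g\<close> for the Hermitian form below.
\<close>

definition adj2 :: "complex^2^2 \<Rightarrow> complex^2^2" where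
  "adj2 g = (\<chi> i j. cnj (g $ j $ i))"

lemma unip_in_SL2 [simp]: "upper_unip s \<in> SL2" "lower_unip s \<in> SL2"
  by (auto simp: SL2_def upper_unip_def lower_unip_def det_2)

lemma torus_in_SL2 [simp]: "a \<noteq> 0 \<Longrightarrow> torus a \<in> SL2"
  by (auto simp: SL2_def torus_def det_2)

lemma adj2_in_SL2 [simp]: "g \<in> SL2 \<Longrightarrow> adj2 g \<in> SL2"
  unfolding SL2_def adj2_def det_2 mem_Collect_eq
  by (simp flip: complex_cnj_mult complex_cnj_diff) (simp add: mult.commute)

lemma adj2_lower_unip: "adj2 (lower_unip s) = upper_unip (cnj s)"
  by (simp add: adj2_def lower_unip_def upper_unip_def Finite_Cartesian_Product.vec_eq_iff forall_2)

text \<open>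
  The big cell of the Bruhat decomposition. On a highest weight vector the right factor acts
  trivially, the middle one by a scalar, and the left one can be moved to the other argument of the form.
\<close>

lemma LDU_decomposition:
  assumes g: "g \<in> SL2" and a: "g $ 1 $ 1 \<noteq> 0"
  shows "g = lower_unip (g $ 2 $ 1 / g $ 1 $ 1) ** (torus (g $ 1 $ 1) ** upper_unip (g $ 1 $ 2 / g $ 1 $ 1))"
proof -
  have "g $ 1 $ 1 * g $ 2 $ 2 = 1 + g $ 1 $ 2 * g $ 2 $ 1"
    using g by (simp add: SL2_def det_2 algebra_simps)
  then have "g $ 2 $ 2 = (1 + g $ 1 $ 2 * g $ 2 $ 1) / g $ 1 $ 1"
    using a by (simp add: field_simps)
  then show ?thesis
    using a by (simp add: Finite_Cartesian_Product.vec_eq_iff forall_2 matrix_matrix_mult_def UNIV_2 lower_unip_def upper_unip_def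
        torus_def field_simps)
qed

text \<open>
  A module of functions with finite support \<open>I\<close> on which \<open>g\<close> acts by a matrix \<open>R g\<close>, such that
  the standard Hermitian form satisfies \<open>\<langle>g x, y\<rangle> = \<langle>x, g\<^sup>* y\<rangle>\<close>, the coordinates are weight coordinates for
  the torus, and upper unipotent matrices change a vector only in coordinates of larger weight. Every submodule of
  a tensor power of the standard module has this shape; the matrix identities are only about \<open>R\<close>,
  so that they pass to all submodules at once.
\<close>

locale unitary_module =
  fixes M :: "'a rep" and I :: "'a set" and R :: "complex^2^2 \<Rightarrow> 'a \<Rightarrow> 'a \<Rightarrow> complex" and wt :: "'a \<Rightarrow> int"
  assumes sl2: "sl2_module M"
    and fin_I: "finite I"
    and supp: "\<lbrakk>x \<in> vecs M; i \<notin> I\<rbrakk> \<Longrightarrow> x i = 0"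
    and act_matrix: "\<lbrakk>g \<in> SL2; x \<in> vecs M; i \<in> I\<rbrakk> \<Longrightarrow> act M g x i = (\<Sum>j\<in>I. R g i j * x j)"
    and R_adj: "\<lbrakk>i \<in> I; j \<in> I\<rbrakk> \<Longrightarrow> R (adj2 g) i j = cnj (R g j i)"
    and R_torus: "\<lbrakk>a \<noteq> 0; i \<in> I; j \<in> I\<rbrakk> \<Longrightarrow> R (torus a) i j = (if i = j then a powi wt i else 0)"
    and R_upper_diag: "i \<in> I \<Longrightarrow> R (upper_unip s) i i = 1"
    and R_upper: "\<lbrakk>i \<in> I; j \<in> I; i \<noteq> j; R (upper_unip s) i j \<noteq> 0\<rbrakk> \<Longrightarrow> wt j < wt i"
    and R_cont: "\<lbrakk>i \<in> I; j \<in> I\<rbrakk> \<Longrightarrow> isCont (\<lambda>t. R (g ** lower_unip t) i j) 0"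
begin

sublocale sl2_module M by (rule sl2)

definition ip :: "('a \<Rightarrow> complex) \<Rightarrow> ('a \<Rightarrow> complex) \<Rightarrow> complex" where
  "ip x y = (\<Sum>i\<in>I. x i * cnj (y i))"

lemma ip_add_left: "ip (x + y) z = ip x z + ip y z"
  and ip_add_right: "ip z (x + y) = ip z x + ip z y"
  and ip_diff_left: "ip (x - y) z = ip x z - ip y z"
  and ip_scale_left: "ip (fscale c x) z = c * ip x z"
  and ip_scale_right: "ip z (fscale c x) = cnj c * ip z x"
  and ip_zero_left [simp]: "ip 0 z = 0"
  and ip_zero_right [simp]: "ip z 0 = 0"
  by (simp_all add: ip_def fscale_def sum.distrib sum_subtractf sum_distrib_left algebra_simps)

lemma ip_commute: "ip y x = cnj (ip x y)"
  by (simp add: ip_def mult.commute)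

lemma ip_self: "ip x x = of_real (\<Sum>i\<in>I. (cmod (x i))\<^sup>2)"
  by (simp add: ip_def flip: complex_norm_square)

lemma ip_self_eq_0: "x \<in> vecs M \<Longrightarrow> ip x x = 0 \<Longrightarrow> x = 0"
  unfolding ip_self of_real_eq_0_iff
  by (subst (asm) sum_nonneg_eq_0_iff) (use fin_I supp in \<open>auto simp: fun_eq_iff\<close>)

lemma ip_act:
  assumes g: "g \<in> SL2" and x: "x \<in> vecs M" and y: "y \<in> vecs M"
  shows "ip (act M g x) y = ip x (act M (adj2 g) y)"
proof -
  have "ip (act M g x) y = (\<Sum>i\<in>I. \<Sum>j\<in>I. R g i j * x j * cnj (y i))"
    by (simp add: ip_def act_matrix[OF g x] sum_distrib_right)
  also have "\<dots> = (\<Sum>j\<in>I. \<Sum>i\<in>I. R g i j * x j * cnj (y i))"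
    by (rule sum.swap)
  also have "\<dots> = ip x (act M (adj2 g) y)"
    by (simp add: ip_def act_matrix[OF adj2_in_SL2[OF g] y] R_adj sum_distrib_left mult_ac)
  finally show ?thesis .
qed

definition submodule :: "('a \<Rightarrow> complex) set \<Rightarrow> bool" where
  "submodule U \<longleftrightarrow> fun_vs.subspace U \<and> U \<subseteq> vecs M \<and> (\<forall>g\<in>SL2. \<forall>x\<in>U. act M g x \<in> U)"

lemma submoduleD:
  assumes "submodule U"
  shows "fun_vs.subspace U" "x \<in> U \<Longrightarrow> x \<in> vecs M" "g \<in> SL2 \<Longrightarrow> x \<in> U \<Longrightarrow> act M g x \<in> U"
  using assms by (auto simp: submodule_def)

lemma submodule_vecs: "submodule (vecs M)"
  using subspace act_closed by (simp add: submodule_def)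

lemma finite_independent: "fun_vs.independent B \<Longrightarrow> B \<subseteq> vecs M \<Longrightarrow> finite B"
  using finite_independent_supported[OF fin_I] supp by blast

definition wspace :: "int \<Rightarrow> ('a \<Rightarrow> complex) set \<Rightarrow> ('a \<Rightarrow> complex) set" where
  "wspace k U = {x \<in> U. \<forall>i\<in>I. x i \<noteq> 0 \<longrightarrow> wt i = k}"

lemma wspace_subspace: "fun_vs.subspace U \<Longrightarrow> fun_vs.subspace (wspace k U)"
  by (auto simp: wspace_def fun_vs.subspace_def fscale_def)

lemma act_torus:
  assumes a: "a \<noteq> 0" and x: "x \<in> vecs M"
  shows "act M (torus a) x = (\<lambda>i. a powi wt i * x i)"
proof
  fix i
  show "act M (torus a) x i = a powi wt i * x i"
  proof (cases "i \<in> I")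
    case True
    then show ?thesis
      using a fin_I by (simp add: act_matrix[OF torus_in_SL2[OF a] x] R_torus
          if_distrib[where f = "\<lambda>u. u * _"] cong: if_cong)
  next
    case False
    then show ?thesis using supp[OF act_closed[OF torus_in_SL2[OF a] x]] supp[OF x] by simp
  qed
qed

lemma powi_two_inject: "(2::complex) powi k = 2 powi l \<longleftrightarrow> k = l"
proof -
  have "(2::complex) powi k = of_real (2 powi k)" for k by simp
  then have "(2::complex) powi k = 2 powi l \<longleftrightarrow> (2::real) powi k = 2 powi l"
    by (metis of_real_eq_iff)
  also have "\<dots> \<longleftrightarrow> k = l"
    using power_int_strict_increasing[of k l "2::real"] power_int_strict_increasing[of l k "2::real"]
    by (cases k l rule: linorder_cases) auto
  finally show ?thesis .
qed

text \<open>
  A single element of infinite order separates all weights, which makes weight spaces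
  visible to any equivariant map.
\<close>

lemma wspace_eigen:
  assumes "submodule U" "x \<in> U"
  shows "x \<in> wspace k U \<longleftrightarrow> act M (torus 2) x = fscale (2 powi k) x"
proof -
  have x: "x \<in> vecs M" using assms submoduleD by blast
  have "act M (torus 2) x = fscale (2 powi k) x \<longleftrightarrow> (\<forall>i. x i \<noteq> 0 \<longrightarrow> wt i = k)"
    by (simp add: act_torus[OF _ x] fscale_def fun_eq_iff powi_two_inject) blast
  also have "\<dots> \<longleftrightarrow> (\<forall>i\<in>I. x i \<noteq> 0 \<longrightarrow> wt i = k)" using supp[OF x] by blast
  finally show ?thesis using assms(2) by (simp add: wspace_def)
qed

definition wproj :: "int \<Rightarrow> ('a \<Rightarrow> complex) \<Rightarrow> 'a \<Rightarrow> complex" where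
  "wproj k x = (\<lambda>i. if wt i = k then x i else 0)"

text \<open>
  The projection to a weight space is a polynomial in the action of \<open>torus 2\<close>, so submodules
  are stable under it.
\<close>

lemma wproj_in:
  assumes U: "submodule U" and x: "x \<in> U"
  shows "wproj k x \<in> wspace k U"
proof -
  note xM = submoduleD(2)[OF U x]
  \<comment> \<open>each factor is the operator \<open>torus 2\<close> minus a scalar\<close>
  have "(\<lambda>i. (\<Prod>l\<in>K. 2 powi wt i - 2 powi l) * x i) \<in> U" if "finite K" for K :: "int set"
    using that
  proof induction
    case empty
    then show ?case using x by simp
  next
    case (insert l K)
    let ?y = "\<lambda>i. (\<Prod>l\<in>K. 2 powi wt i - 2 powi l) * x i"
    have "act M (torus 2) ?y - fscale (2 powi l) ?y \<in> U"
      using submoduleD(3)[OF U _ insert.IH]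
      by (intro fun_vs.subspace_diff[OF submoduleD(1)[OF U]] fun_vs.subspace_scale[OF submoduleD(1)[OF U]] insert.IH) auto
    also have "act M (torus 2) ?y - fscale (2 powi l) ?y = (\<lambda>i. (\<Prod>l\<in>insert l K. 2 powi wt i - 2 powi l) * x i)"
      using insert submoduleD(2)[OF U insert.IH] by (subst act_torus) (auto simp: fscale_def fun_eq_iff algebra_simps)
    finally show ?case .
  qed
  from this[of "wt ` I - {k}"] have
    y: "(\<lambda>i. (\<Prod>l\<in>wt ` I - {k}. 2 powi wt i - 2 powi l) * x i) \<in> U" (is "?y \<in> U") using fin_I by simp
  let ?c = "\<Prod>l\<in>wt ` I - {k}. 2 powi k - 2 powi l :: complex"
  have c: "?c \<noteq> 0" using fin_I by (auto simp: powi_two_inject)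
  have "fscale (inverse ?c) ?y = wproj k x"
  proof
    fix i
    show "fscale (inverse ?c) ?y i = wproj k x i"
    proof (cases "i \<in> I")
      case True
      have "(\<Prod>l\<in>wt ` I - {k}. 2 powi wt i - 2 powi l :: complex) = 0" if "wt i \<noteq> k"
        using True that fin_I by (intro prod_zero) auto
      then show ?thesis using c by (auto simp: fscale_def wproj_def)
    qed (use supp[OF xM] in \<open>auto simp: fscale_def wproj_def\<close>)
  qed
  with fun_vs.subspace_scale[OF submoduleD(1)[OF U] y, of "inverse ?c"]
  have "wproj k x \<in> U" by (simp only:)
  then show ?thesis by (auto simp: wspace_def wproj_def)
qed

lemma wspace_zero_imp_zero:
  assumes U: "submodule U" and z: "\<And>k. wspace k U \<subseteq> {0}" and x: "x \<in> U"
  shows "x = 0"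
proof
  fix i
  have "wproj (wt i) x = 0" using wproj_in[OF U x, of "wt i"] z by blast
  then have "wproj (wt i) x i = 0" by simp
  then show "x i = 0 i" by (simp add: wproj_def)
qed

text \<open>
  The difference of the two sides is supported in weights above \<open>k\<close>, where the module vanishes.
\<close>

lemma highest_weight_fixed:
  assumes U: "submodule U" and x: "x \<in> wspace k U" and top: "\<And>l. k < l \<Longrightarrow> wspace l U \<subseteq> {0}"
  shows "act M (upper_unip s) x = x"
proof -
  have xU: "x \<in> U" using x by (simp add: wspace_def)
  note xM = submoduleD(2)[OF U xU]
  let ?z = "act M (upper_unip s) x - x"
  have zU: "?z \<in> U"
    using submoduleD(3)[OF U _ xU] xU by (intro fun_vs.subspace_diff[OF submoduleD(1)[OF U]]) auto
  have "?z i = 0" for i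
  proof (rule ccontr)
    assume nz: "?z i \<noteq> 0"
    have i: "i \<in> I" using nz supp[OF submoduleD(2)[OF U zU]] by blast
    have "act M (upper_unip s) x i = R (upper_unip s) i i * x i + (\<Sum>j\<in>I-{i}. R (upper_unip s) i j * x j)"
      unfolding act_matrix[OF unip_in_SL2(1) xM i] by (rule sum.remove[OF fin_I i])
    then have "(\<Sum>j\<in>I-{i}. R (upper_unip s) i j * x j) \<noteq> 0" using nz i by (simp add: R_upper_diag)
    then obtain j where "j \<in> I - {i}" "R (upper_unip s) i j * x j \<noteq> 0"
      by (rule sum.not_neutral_contains_not_neutral)
    then have j: "j \<in> I" "j \<noteq> i" "R (upper_unip s) i j \<noteq> 0" "x j \<noteq> 0" by auto
    then have "k < wt i" using R_upper[OF i, of j s] x by (auto simp: wspace_def)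
    then have "wproj (wt i) ?z = 0" using wproj_in[OF U zU] top by blast
    then have "wproj (wt i) ?z i = 0" by simp
    then show False using nz by (simp add: wproj_def)
  qed
  then have "?z = 0" by (auto simp: fun_eq_iff)
  then show ?thesis by simp
qed

text \<open>
  Write \<open>g\<close> as lower unipotent, torus, upper unipotent. The last factor fixes \<open>x\<close>, the
  torus scales it, and the adjoint of the first factor is again upper unipotent and fixes the other copy of \<open>x\<close>.
\<close>

lemma highest_weight_coefficient:
  assumes U: "submodule U" and x: "x \<in> wspace k U" and top: "\<And>l. k < l \<Longrightarrow> wspace l U \<subseteq> {0}"
    and g: "g \<in> SL2" and a: "g $ 1 $ 1 \<noteq> 0"
  shows "ip (act M g x) x = (g $ 1 $ 1) powi k * ip x x"
proof -
  have xU: "x \<in> U" using x by (simp add: wspace_def)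
  note xM = submoduleD(2)[OF U xU]
  note fixed = highest_weight_fixed[OF U x top]
  define p q where "p = g $ 2 $ 1 / g $ 1 $ 1" "q = g $ 1 $ 2 / g $ 1 $ 1"
  have g_eq: "g = lower_unip p ** (torus (g $ 1 $ 1) ** upper_unip q)"
    unfolding p_q_def by (rule LDU_decomposition[OF g a])
  have tx: "act M (torus (g $ 1 $ 1)) x = fscale (g $ 1 $ 1 powi k) x"
    using x supp[OF xM] unfolding act_torus[OF a xM] by (auto simp: fscale_def wspace_def fun_eq_iff)
  have "act M g x = act M (lower_unip p) (act M (torus (g $ 1 $ 1)) x)"
    by (subst g_eq) (simp add: act_mult mult_in_SL2 a xM fixed)
  then have "ip (act M g x) x = ip (act M (torus (g $ 1 $ 1)) x) (act M (upper_unip (cnj p)) x)"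
    using a xM by (simp add: ip_act act_closed adj2_lower_unip)
  then show ?thesis by (simp add: fixed tx ip_scale_left)
qed

lemma coefficient_isCont:
  assumes g: "g \<in> SL2" and x: "x \<in> vecs M"
  shows "isCont (\<lambda>t. ip (act M (g ** lower_unip t) x) x) 0"
proof -
  have "(\<lambda>t. ip (act M (g ** lower_unip t) x) x) = (\<lambda>t. \<Sum>i\<in>I. (\<Sum>j\<in>I. R (g ** lower_unip t) i j * x j) * cnj (x i))"
    using g x by (simp add: ip_def act_matrix mult_in_SL2)
  moreover have "isCont (\<lambda>t. \<Sum>i\<in>I. (\<Sum>j\<in>I. R (g ** lower_unip t) i j * x j) * cnj (x i)) 0"
    by (intro continuous_intros R_cont)
  ultimately show ?thesis by simp
qed

definition orbit_span :: "('a \<Rightarrow> complex) \<Rightarrow> ('a \<Rightarrow> complex) set" where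
  "orbit_span x = fun_vs.span ((\<lambda>g. act M g x) ` SL2)"

lemma orbit_span_submodule:
  assumes x: "x \<in> vecs M" shows "submodule (orbit_span x)"
proof -
  have sub: "orbit_span x \<subseteq> vecs M"
    unfolding orbit_span_def using x act_closed by (intro fun_vs.span_minimal[OF _ subspace]) auto
  have "act M h z \<in> orbit_span x" if h: "h \<in> SL2" and z: "z \<in> orbit_span x" for h z
  proof -
    have "act M h z \<in> fun_vs.span (act M h ` (\<lambda>g. act M g x) ` SL2)"
      using z x act_closed unfolding orbit_span_def
      by (intro linear_on_span_image[OF act_linear[OF h] subspace]) auto
    also have "act M h ` (\<lambda>g. act M g x) ` SL2 \<subseteq> (\<lambda>g. act M g x) ` SL2"
    proof clarify
      fix g assume "g \<in> SL2"
      then show "act M h (act M g x) \<in> (\<lambda>g. act M g x) ` SL2"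
        using h x by (intro image_eqI[of _ _ "h ** g"]) (auto simp: act_mult mult_in_SL2)
    qed
    then have "fun_vs.span (act M h ` (\<lambda>g. act M g x) ` SL2) \<subseteq> orbit_span x"
      unfolding orbit_span_def by (rule fun_vs.span_mono)
    finally show ?thesis .
  qed
  then show ?thesis using sub by (simp add: submodule_def orbit_span_def)
qed

lemma orbit_span_base: "g \<in> SL2 \<Longrightarrow> act M g x \<in> orbit_span x"
  unfolding orbit_span_def by (intro fun_vs.span_base) auto

lemma orbit_span_subset:
  assumes "submodule U" "x \<in> U" shows "orbit_span x \<subseteq> U"
  unfolding orbit_span_def using assms submoduleD[OF assms(1)] by (intro fun_vs.span_minimal) auto

lemma orbit_span_orthogonal:
  assumes x: "x \<in> vecs M" and z: "z \<in> orbit_span x" and orth: "\<And>g. g \<in> SL2 \<Longrightarrow> ip z (act M g x) = 0"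
  shows "z = 0"
proof -
  have "ip z w = 0" if "w \<in> orbit_span x" for w
    using that unfolding orbit_span_def
  proof (induction rule: fun_vs.span_induct_alt)
    case base
    show ?case by (rule ip_zero_right)
  next
    case (step c x y)
    then show ?case unfolding ip_add_right ip_scale_right using orth by auto
  qed
  then have "ip z z = 0" using z by blast
  then show ?thesis using ip_self_eq_0 submoduleD(2)[OF orbit_span_submodule[OF x] z] by blast
qed

text \<open>
  Gram-Schmidt: the part of the new vector orthogonal to the old span is divided out.
\<close>

lemma orthogonal_projection:
  assumes "finite B" "B \<subseteq> vecs M" "z \<in> vecs M"
  shows "\<exists>a\<in>fun_vs.span B. \<forall>b\<in>fun_vs.span B. ip (z - a) b = 0"
  using assms
proof (induction B arbitrary: z rule: finite_induct)
  case empty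
  then show ?case by (intro bexI[of _ 0]) (simp_all only: fun_vs.span_empty singleton_iff ip_zero_right ball_simps)
next
  case (insert b B)
  have spanM: "fun_vs.span B \<subseteq> vecs M" using insert.prems by (intro fun_vs.span_minimal[OF _ subspace]) auto
  obtain b0 where b0: "b0 \<in> fun_vs.span B" "\<And>w. w \<in> fun_vs.span B \<Longrightarrow> ip (b - b0) w = 0"
    using insert.IH[of b] insert.prems by blast
  obtain a0 where a0: "a0 \<in> fun_vs.span B" "\<And>w. w \<in> fun_vs.span B \<Longrightarrow> ip (z - a0) w = 0"
    using insert.IH[of z] insert.prems by blast
  let ?d = "b - b0"
  have dM: "?d \<in> vecs M" using insert.prems b0 spanM by (intro fun_vs.subspace_diff[OF subspace]) auto
  have mono: "fun_vs.span B \<subseteq> fun_vs.span (insert b B)" by (rule fun_vs.span_mono) auto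
  have bsp: "b \<in> fun_vs.span (insert b B)" by (rule fun_vs.span_base) simp
  have dsp: "?d \<in> fun_vs.span (insert b B)" using mono b0 bsp by (intro fun_vs.span_diff) auto
  have decomp: "\<exists>c w. v = fscale c ?d + w \<and> w \<in> fun_vs.span B" if v: "v \<in> fun_vs.span (insert b B)" for v
  proof -
    obtain c where "v - fscale c b \<in> fun_vs.span B" using v fun_vs.span_breakdown_eq[of v b B] by blast
    then have "v - fscale c b + fscale c b0 \<in> fun_vs.span B"
      using b0 by (intro fun_vs.span_add fun_vs.span_scale)
    moreover have "v = fscale c ?d + (v - fscale c b + fscale c b0)"
      by (rule ext) (simp add: fscale_def algebra_simps)
    ultimately show ?thesis by blast
  qed
  show ?case
  proof (cases "ip ?d ?d = 0")
    case True
    have "?d = 0" by (rule ip_self_eq_0[OF dM True])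
    then have "b = b0" by (rule iffD2[OF eq_iff_diff_eq_0])
    then have "b \<in> fun_vs.span B" using b0(1) by (simp only:)
    then have "fun_vs.span (insert b B) = fun_vs.span B" by (rule fun_vs.span_redundant)
    then show ?thesis using a0 by blast
  next
    case False
    let ?c = "ip (z - a0) ?d / ip ?d ?d"
    let ?a = "a0 + fscale ?c ?d"
    have "?a \<in> fun_vs.span (insert b B)" using mono a0 dsp by (intro fun_vs.span_add fun_vs.span_scale) auto
    moreover have "ip (z - ?a) v = 0" if v: "v \<in> fun_vs.span (insert b B)" for v
    proof -
      obtain c w where cw: "v = fscale c ?d + w" "w \<in> fun_vs.span B" using decomp[OF v] by blast
      have split: "z - ?a = (z - a0) - fscale ?c ?d" by (rule ext) (simp add: algebra_simps)
      show ?thesis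
        unfolding split cw(1) ip_add_right ip_diff_left[of "z - a0"] ip_scale_left ip_scale_right
        using a0(2)[OF cw(2)] b0(2)[OF cw(2)] False by simp
    qed
    ultimately show ?thesis by blast
  qed
qed

definition orth_compl :: "('a \<Rightarrow> complex) set \<Rightarrow> ('a \<Rightarrow> complex) set \<Rightarrow> ('a \<Rightarrow> complex) set" where
  "orth_compl A U = {z \<in> U. \<forall>a\<in>A. ip z a = 0}"

text \<open>
  Stability of \<open>SL2\<close> under \<open>adj2\<close> makes the complement a submodule, and so every submodule a
  direct summand.
\<close>

lemma orth_compl_submodule:
  assumes A: "submodule A" and U: "submodule U"
  shows "submodule (orth_compl A U)"
  unfolding submodule_def orth_compl_def
proof (intro conjI ballI subsetI)
  show "fun_vs.subspace {z \<in> U. \<forall>a\<in>A. ip z a = 0}"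
    using submoduleD(1)[OF U] by (auto simp: fun_vs.subspace_def ip_add_left ip_scale_left)
next
  fix x assume "x \<in> {z \<in> U. \<forall>a\<in>A. ip z a = 0}"
  then show "x \<in> vecs M" using submoduleD(2)[OF U] by blast
next
  fix g x assume g: "g \<in> SL2" and "x \<in> {z \<in> U. \<forall>a\<in>A. ip z a = 0}"
  then have x: "x \<in> U" "\<And>a. a \<in> A \<Longrightarrow> ip x a = 0" by blast+
  have "ip (act M g x) a = 0" if a: "a \<in> A" for a
    using ip_act[OF g submoduleD(2)[OF U x(1)] submoduleD(2)[OF A a]]
      x(2)[OF submoduleD(3)[OF A adj2_in_SL2[OF g] a]] by simp
  then show "act M g x \<in> {z \<in> U. \<forall>a\<in>A. ip z a = 0}"
    using submoduleD(3)[OF U g x(1)] by blast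
qed

lemma orth_decomposition:
  assumes A: "submodule A" and U: "submodule U" and AU: "A \<subseteq> U" and z: "z \<in> U"
  shows "\<exists>a\<in>A. z - a \<in> orth_compl A U"
proof -
  obtain B where B: "B \<subseteq> A" "fun_vs.independent B" "A \<subseteq> fun_vs.span B"
    by (rule fun_vs.maximal_independent_subset)
  have BM: "B \<subseteq> vecs M" using B(1) submoduleD(2)[OF A] by blast
  have sp: "fun_vs.span B = A"
    using B(3) fun_vs.span_minimal[OF B(1) submoduleD(1)[OF A]] by blast
  obtain a where a: "a \<in> A" "\<forall>b\<in>A. ip (z - a) b = 0"
    using orthogonal_projection[OF finite_independent[OF B(2) BM] BM submoduleD(2)[OF U z]] unfolding sp by blast
  have "z - a \<in> U" using AU a(1) by (intro fun_vs.subspace_diff[OF submoduleD(1)[OF U] z]) blast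
  then show ?thesis using a by (intro bexI[of _ a]) (simp_all only: orth_compl_def mem_Collect_eq)
qed

lemma orth_direct_sum:
  assumes A: "submodule A" and U: "submodule U" and AU: "A \<subseteq> U"
  shows "U = {a + c | a c. a \<in> A \<and> c \<in> orth_compl A U}"
proof (intro equalityI subsetI)
  fix z assume "z \<in> U"
  then obtain a where "a \<in> A" "z - a \<in> orth_compl A U" using orth_decomposition[OF A U AU] by blast
  moreover have "z = a + (z - a)" by simp
  ultimately show "z \<in> {a + c | a c. a \<in> A \<and> c \<in> orth_compl A U}" by blast
next
  fix z assume "z \<in> {a + c | a c. a \<in> A \<and> c \<in> orth_compl A U}"
  then obtain a c where "z = a + c" "a \<in> U" "c \<in> U" using AU unfolding orth_compl_def by blast
  then show "z \<in> U" using fun_vs.subspace_add[OF submoduleD(1)[OF U]] by (simp only:)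
qed

lemma orth_compl_Int:
  assumes A: "submodule A" and U: "submodule U"
  shows "A \<inter> orth_compl A U = {0}"
proof -
  have "z = 0" if "z \<in> A" "z \<in> orth_compl A U" for z
  proof (rule ip_self_eq_0[OF submoduleD(2)[OF A that(1)]])
    show "ip z z = 0" using that unfolding orth_compl_def by blast
  qed
  moreover have "0 \<in> A" "0 \<in> orth_compl A U"
    by (rule fun_vs.subspace_0[OF submoduleD(1)[OF A]],
        rule fun_vs.subspace_0[OF submoduleD(1)[OF orth_compl_submodule[OF A U]]])
  ultimately show ?thesis by blast
qed

lemma wproj_add: "wproj k (x + y) = wproj k x + wproj k y"
  by (auto simp: wproj_def fun_eq_iff)

lemma wproj_id: "x \<in> wspace k U \<Longrightarrow> submodule U \<Longrightarrow> wproj k x = x"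
  using supp submoduleD(2) by (fastforce simp: wspace_def wproj_def)

lemma dim_orth_decomposition:
  assumes A: "submodule A" and U: "submodule U" and AU: "A \<subseteq> U"
  shows "fun_vs.dim U = fun_vs.dim A + fun_vs.dim (orth_compl A U)" (is ?g1)
    and "fun_vs.dim (wspace k U) = fun_vs.dim (wspace k A) + fun_vs.dim (wspace k (orth_compl A U))" (is ?g2)
proof -
  let ?C = "orth_compl A U"
  have C: "submodule ?C" by (rule orth_compl_submodule[OF A U])
  have CU: "?C \<subseteq> U" by (auto simp: orth_compl_def)
  have fin: "finite B" if "fun_vs.independent B" "B \<subseteq> U" for B
    using that submoduleD(2)[OF U] by (intro finite_independent) auto
  have Ueq: "U = {a + c | a c. a \<in> A \<and> c \<in> ?C}" by (rule orth_direct_sum[OF A U AU])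
  show ?g1
    by (rule dim_direct_sum[OF submoduleD(1)[OF A] submoduleD(1)[OF C] orth_compl_Int[OF A U] Ueq fin])
  have weq: "wspace k U = {a + c | a c. a \<in> wspace k A \<and> c \<in> wspace k ?C}"
  proof (intro equalityI subsetI)
    fix z assume z: "z \<in> wspace k U"
    then have "z \<in> U" by (simp add: wspace_def)
    then obtain a c where ac: "a \<in> A" "c \<in> ?C" "z = a + c" using Ueq by blast
    have "z = wproj k a + wproj k c" using wproj_id[OF z U] unfolding ac(3) wproj_add by (rule sym)
    then show "z \<in> {a + c | a c. a \<in> wspace k A \<and> c \<in> wspace k ?C}"
      using wproj_in[OF A ac(1)] wproj_in[OF C ac(2)] by blast
  next
    fix z assume "z \<in> {a + c | a c. a \<in> wspace k A \<and> c \<in> wspace k ?C}"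
    then obtain a c where "z = a + c" "a \<in> wspace k U" "c \<in> wspace k U"
      using AU CU unfolding wspace_def by blast
    then show "z \<in> wspace k U"
      using fun_vs.subspace_add[OF wspace_subspace[OF submoduleD(1)[OF U]]] by (simp only:)
  qed
  have wU: "wspace k U \<subseteq> U" by (auto simp: wspace_def)
  have "wspace k A \<inter> wspace k ?C = {0}"
    using orth_compl_Int[OF A U] fun_vs.subspace_0[OF wspace_subspace[OF submoduleD(1)[OF A], of k]]
      fun_vs.subspace_0[OF wspace_subspace[OF submoduleD(1)[OF C], of k]]
    unfolding wspace_def by blast
  then show ?g2
    using wspace_subspace submoduleD(1)[OF A] submoduleD(1)[OF C] weq fin wU
    by (intro dim_direct_sum) blast+
qed

end

section \<open>Weight multiplicities determine a module\<close>

definition equivariant_iso ::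
  "'a rep \<Rightarrow> ('a \<Rightarrow> complex) set \<Rightarrow> 'b rep \<Rightarrow> ('b \<Rightarrow> complex) set \<Rightarrow> (('a \<Rightarrow> complex) \<Rightarrow> ('b \<Rightarrow> complex)) \<Rightarrow> bool" where
  "equivariant_iso M U N U' \<phi> \<longleftrightarrow> linear_on U \<phi> \<and> bij_betw \<phi> U U' \<and>
     (\<forall>g\<in>SL2. \<forall>x\<in>U. \<phi> (act M g x) = act N g (\<phi> x))"

text \<open>
  Equivariant isomorphisms of the summands of two internal direct sums add up.
\<close>

lemma equivariant_iso_direct_sum:
  fixes \<phi>1 \<phi>2 :: "('a \<Rightarrow> complex) \<Rightarrow> ('b \<Rightarrow> complex)"
  assumes M: "sl2_module M" and N: "sl2_module N"
    and sub: "fun_vs.subspace A" "fun_vs.subspace C" "fun_vs.subspace A'" "fun_vs.subspace C'"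
    and vecs: "A \<subseteq> vecs M" "C \<subseteq> vecs M" "A' \<subseteq> vecs N" "C' \<subseteq> vecs N"
    and inv: "\<And>g a. g \<in> SL2 \<Longrightarrow> a \<in> A \<Longrightarrow> act M g a \<in> A" "\<And>g c. g \<in> SL2 \<Longrightarrow> c \<in> C \<Longrightarrow> act M g c \<in> C"
    and zero: "A \<inter> C = {0}" "A' \<inter> C' = {0}"
    and U: "U = {a + c | a c. a \<in> A \<and> c \<in> C}" and U': "U' = {a + c | a c. a \<in> A' \<and> c \<in> C'}"
    and \<phi>1: "equivariant_iso M A N A' \<phi>1" and \<phi>2: "equivariant_iso M C N C' \<phi>2"
  shows "\<exists>\<phi>. equivariant_iso M U N U' \<phi>"
proof -
  interpret M: sl2_module M by fact
  interpret N: sl2_module N by fact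
  have unique: "a = a' \<and> c = c'"
    if "a + c = a' + c'" "a \<in> S" "a' \<in> S" "c \<in> T" "c' \<in> T" "fun_vs.subspace S" "fun_vs.subspace T" "S \<inter> T = {0}"
    for a a' c c' :: "'c \<Rightarrow> complex" and S T
  proof -
    have eq: "a - a' = c' - c" using that(1) by (metis add_diff_eq add_implies_diff diff_diff_eq2 add.commute)
    have "a - a' \<in> S" by (rule fun_vs.subspace_diff[OF that(6,2,3)])
    moreover have "c' - c \<in> T" by (rule fun_vs.subspace_diff[OF that(7,5,4)])
    ultimately have "a - a' \<in> S \<inter> T" unfolding eq by (rule IntI)
    then have "a - a' = 0" unfolding that(8) by (rule singletonD)
    moreover have "c' - c = 0" using calculation unfolding eq .
    ultimately show ?thesis by (simp only: right_minus_eq)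
  qed
  note uM = unique[OF _ _ _ _ _ sub(1,2) zero(1)] and uN = unique[OF _ _ _ _ _ sub(3,4) zero(2)]
  \<comment> \<open>decompositions are unique, so this description determines the value\<close>
  define \<phi> where "\<phi> z = (THE w. \<exists>a\<in>A. \<exists>c\<in>C. z = a + c \<and> w = \<phi>1 a + \<phi>2 c)" for z
  have \<phi>: "\<phi> (a + c) = \<phi>1 a + \<phi>2 c" if ac: "a \<in> A" "c \<in> C" for a c
    unfolding \<phi>_def
  proof (rule the_equality)
    show "\<exists>a'\<in>A. \<exists>c'\<in>C. a + c = a' + c' \<and> \<phi>1 a + \<phi>2 c = \<phi>1 a' + \<phi>2 c'" using ac by blast
  next
    fix w assume "\<exists>a'\<in>A. \<exists>c'\<in>C. a + c = a' + c' \<and> w = \<phi>1 a' + \<phi>2 c'"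
    then obtain a' c' where w: "a' \<in> A" "c' \<in> C" "a + c = a' + c'" "w = \<phi>1 a' + \<phi>2 c'" by blast
    have "a = a' \<and> c = c'" by (rule uM[OF w(3) ac(1) w(1) ac(2) w(2)])
    then show "w = \<phi>1 a + \<phi>2 c" unfolding w(4) by (simp only:)
  qed
  have lin: "linear_on A \<phi>1" "linear_on C \<phi>2" and bij: "bij_betw \<phi>1 A A'" "bij_betw \<phi>2 C C'"
    and eqv: "\<And>g a. g \<in> SL2 \<Longrightarrow> a \<in> A \<Longrightarrow> \<phi>1 (act M g a) = act N g (\<phi>1 a)"
      "\<And>g c. g \<in> SL2 \<Longrightarrow> c \<in> C \<Longrightarrow> \<phi>2 (act M g c) = act N g (\<phi>2 c)"
    using \<phi>1 \<phi>2 unfolding equivariant_iso_def by blast+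
  have im: "\<phi>1 a \<in> A'" if "a \<in> A" for a using bij_betwE[OF bij(1)] that by blast
  have im2: "\<phi>2 c \<in> C'" if "c \<in> C" for c using bij_betwE[OF bij(2)] that by blast
  have UE: "\<exists>a c. z = a + c \<and> a \<in> A \<and> c \<in> C" if "z \<in> U" for z using that unfolding U by blast
  have "equivariant_iso M U N U' \<phi>"
    unfolding equivariant_iso_def
  proof (intro conjI ballI)
    show "linear_on U \<phi>"
      unfolding linear_on_def
    proof (intro conjI ballI allI)
      fix x y assume "x \<in> U" "y \<in> U"
      then obtain a c b d where xy: "x = a + c" "y = b + d" and m: "a \<in> A" "c \<in> C" "b \<in> A" "d \<in> C"
        using UE by metis
      have "x + y = (a + b) + (c + d)" unfolding xy by (rule ext) simp
      then have "\<phi> (x + y) = \<phi>1 (a + b) + \<phi>2 (c + d)"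
        using \<phi>[OF fun_vs.subspace_add[OF sub(1) m(1,3)] fun_vs.subspace_add[OF sub(2) m(2,4)]] by (simp only:)
      also have "\<dots> = (\<phi>1 a + \<phi>2 c) + (\<phi>1 b + \<phi>2 d)"
        unfolding linear_onD(1)[OF lin(1) m(1,3)] linear_onD(1)[OF lin(2) m(2,4)] by (rule ext) simp
      finally show "\<phi> (x + y) = \<phi> x + \<phi> y" unfolding xy \<phi>[OF m(1,2)] \<phi>[OF m(3,4)] .
    next
      fix k x assume "x \<in> U"
      then obtain a c where x: "x = a + c" and m: "a \<in> A" "c \<in> C" using UE by metis
      have "fscale k x = fscale k a + fscale k c" unfolding x by (rule fun_vs.scale_right_distrib)
      then have "\<phi> (fscale k x) = \<phi>1 (fscale k a) + \<phi>2 (fscale k c)"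
        using \<phi>[OF fun_vs.subspace_scale[OF sub(1) m(1)] fun_vs.subspace_scale[OF sub(2) m(2)]] by (simp only:)
      then show "\<phi> (fscale k x) = fscale k (\<phi> x)"
        unfolding x \<phi>[OF m] linear_onD(2)[OF lin(1) m(1)] linear_onD(2)[OF lin(2) m(2)] fun_vs.scale_right_distrib .
    qed
    show "bij_betw \<phi> U U'"
    proof (rule bij_betw_imageI)
      show "inj_on \<phi> U"
      proof (rule inj_onI)
        fix x y assume "x \<in> U" "y \<in> U" and eq: "\<phi> x = \<phi> y"
        then obtain a c b d where xy: "x = a + c" "y = b + d" and m: "a \<in> A" "c \<in> C" "b \<in> A" "d \<in> C"
          using UE by metis
        have "\<phi>1 a + \<phi>2 c = \<phi>1 b + \<phi>2 d" using eq unfolding xy \<phi>[OF m(1,2)] \<phi>[OF m(3,4)] .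
        then have "\<phi>1 a = \<phi>1 b \<and> \<phi>2 c = \<phi>2 d" by (rule uN[OF _ im[OF m(1)] im[OF m(3)] im2[OF m(2)] im2[OF m(4)]])
        then have "a = b" "c = d"
          using inj_onD[OF bij_betw_imp_inj_on[OF bij(1)]] inj_onD[OF bij_betw_imp_inj_on[OF bij(2)]] m by blast+
        then show "x = y" unfolding xy by (simp only:)
      qed
      show "\<phi> ` U = U'"
      proof (intro equalityI subsetI)
        fix w assume "w \<in> \<phi> ` U"
        then obtain z where "z \<in> U" "w = \<phi> z" by blast
        then obtain a c where "w = \<phi> (a + c)" and m: "a \<in> A" "c \<in> C" using UE by metis
        then have "w = \<phi>1 a + \<phi>2 c" using \<phi>[OF m] by (simp only:)
        then show "w \<in> U'" unfolding U' using im[OF m(1)] im2[OF m(2)] by blast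
      next
        fix w assume "w \<in> U'"
        then obtain a' c' where w: "w = a' + c'" "a' \<in> A'" "c' \<in> C'" unfolding U' by blast
        obtain a c where ac: "a \<in> A" "a' = \<phi>1 a" "c \<in> C" "c' = \<phi>2 c"
          using w(2,3) bij_betw_imp_surj_on[OF bij(1)] bij_betw_imp_surj_on[OF bij(2)] by blast
        have "w = \<phi> (a + c)" unfolding w(1) ac(2,4) \<phi>[OF ac(1,3)] ..
        moreover have "a + c \<in> U" unfolding U using ac(1,3) by blast
        ultimately show "w \<in> \<phi> ` U" by blast
      qed
    qed
    fix g x assume g: "g \<in> SL2" and "x \<in> U"
    then obtain a c where x: "x = a + c" and m: "a \<in> A" "c \<in> C" using UE by metis
    have mv: "a \<in> vecs M" "c \<in> vecs M" using m vecs by blast+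
    have mv': "\<phi>1 a \<in> vecs N" "\<phi>2 c \<in> vecs N" using im[OF m(1)] im2[OF m(2)] vecs by blast+
    have "\<phi> (act M g x) = \<phi>1 (act M g a) + \<phi>2 (act M g c)"
      unfolding x linear_onD(1)[OF M.act_linear[OF g] mv] by (rule \<phi>[OF inv(1)[OF g m(1)] inv(2)[OF g m(2)]])
    then show "\<phi> (act M g x) = act N g (\<phi> x)"
      unfolding x \<phi>[OF m] linear_onD(1)[OF N.act_linear[OF g] mv'] eqv(1)[OF g m(1)] eqv(2)[OF g m(2)] .
  qed
  then show ?thesis by blast
qed

context unitary_module
begin

lemma unit_vector_exists:
  assumes S: "fun_vs.subspace S" "S \<subseteq> vecs M" and nz: "\<not> S \<subseteq> {0}"
  shows "\<exists>x\<in>S. ip x x = 1"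
proof -
  obtain x where x: "x \<in> S" "x \<noteq> 0" using nz by blast
  define r where "r = (\<Sum>i\<in>I. (cmod (x i))\<^sup>2)"
  have ipx: "ip x x = of_real r" unfolding r_def by (rule ip_self)
  have "r \<ge> 0" unfolding r_def by (intro sum_nonneg) simp
  moreover have "r \<noteq> 0" using ip_self_eq_0[of x] x S(2) ipx by auto
  ultimately have r: "r > 0" by simp
  let ?c = "of_real (1 / sqrt r) :: complex"
  have "ip (fscale ?c x) (fscale ?c x) = of_real (1 / sqrt r * (1 / sqrt r) * r)"
    unfolding ip_scale_left ip_scale_right ipx by (simp only: complex_cnj_complex_of_real of_real_mult mult.assoc)
  also have "1 / sqrt r * (1 / sqrt r) * r = 1" using r by (simp add: field_simps)
  finally have "ip (fscale ?c x) (fscale ?c x) = 1" by simp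
  then show ?thesis using fun_vs.subspace_scale[OF S(1) x(1)] by blast
qed

lemma dim_eq_0_iff:
  assumes S: "S \<subseteq> vecs M"
  shows "fun_vs.dim S = 0 \<longleftrightarrow> S \<subseteq> {0}"
proof
  obtain B where B: "B \<subseteq> S" "fun_vs.independent B" "S \<subseteq> fun_vs.span B" "card B = fun_vs.dim S"
    using fun_vs.basis_exists by blast
  have "finite B" using B(1) S by (intro finite_independent[OF B(2)]) blast
  moreover assume "fun_vs.dim S = 0"
  ultimately have "B = {}" using B(4) by simp
  then show "S \<subseteq> {0}" using B(3) by simp
next
  assume "S \<subseteq> {0}"
  then have "fun_vs.dim S \<le> card ({} :: ('a \<Rightarrow> complex) set)" by (intro fun_vs.dim_le_card) simp_all
  then show "fun_vs.dim S = 0" by simp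
qed

end

locale unitary_pair = M: unitary_module M I R wt + N: unitary_module N J S wt'
  for M :: "'a rep" and I R wt and N :: "'b rep" and J S wt'
begin

text \<open>
  The idea of the Gelfand-Naimark-Segal construction: the coefficients \<open>\<langle>g x, x\<rangle>\<close> determine
  all inner products between points of the orbit of \<open>x\<close>, hence all linear relations between them. The image of
  \<open>z\<close> is the vector with the same inner products against the orbit; described this way it is unique, and
  linearity, inverse and equivariance of the assignment come for free.
\<close>

lemma orbit_transport:
  assumes x: "x \<in> vecs M" and y: "y \<in> vecs N"
    and coeff: "\<forall>g\<in>SL2. M.ip (act M g x) x = N.ip (act N g y) y"
    and z: "z \<in> M.orbit_span x"
  shows "\<exists>!z'. z' \<in> N.orbit_span y \<and> (\<forall>g\<in>SL2. N.ip z' (act N g y) = M.ip z (act M g x))"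
proof (rule ex_ex1I)
  have gh: "M.ip (act M h x) (act M g x) = N.ip (act N h y) (act N g y)" if g: "g \<in> SL2" and h: "h \<in> SL2" for g h
  proof -
    have cM: "cnj (M.ip (act M (adj2 h ** g) x) x) = M.ip (act M h x) (act M g x)"
      using g h x M.ip_act[OF h x M.act_closed[OF g x]] by (simp add: M.act_mult flip: M.ip_commute)
    have cN: "cnj (N.ip (act N (adj2 h ** g) y) y) = N.ip (act N h y) (act N g y)"
      using g h y N.ip_act[OF h y N.act_closed[OF g y]] by (simp add: N.act_mult flip: N.ip_commute)
    show ?thesis
      unfolding cM[symmetric] cN[symmetric] using bspec[OF coeff, of "adj2 h ** g"] g h by (simp add: mult_in_SL2)
  qed
  show "\<exists>z'. z' \<in> N.orbit_span y \<and> (\<forall>g\<in>SL2. N.ip z' (act N g y) = M.ip z (act M g x))"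
    using z unfolding M.orbit_span_def
  proof (induction rule: fun_vs.span_induct_alt)
    case base
    have "0 \<in> N.orbit_span y" unfolding N.orbit_span_def by (rule fun_vs.span_zero)
    then show ?case by (intro exI[of _ 0] conjI ballI) (simp_all only: M.ip_zero_left N.ip_zero_left)
  next
    case (step c w z)
    from step.hyps obtain h where h: "h \<in> SL2" "w = act M h x" by blast
    from step.IH obtain z' where z': "z' \<in> N.orbit_span y" "\<And>g. g \<in> SL2 \<Longrightarrow> N.ip z' (act N g y) = M.ip z (act M g x)"
      by blast
    have "fscale c (act N h y) + z' \<in> N.orbit_span y"
      using z'(1) N.orbit_span_base[OF h(1), of y] unfolding N.orbit_span_def
      by (intro fun_vs.span_add fun_vs.span_scale)
    moreover have "N.ip (fscale c (act N h y) + z') (act N g y) = M.ip (fscale c w + z) (act M g x)" if g: "g \<in> SL2" for g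
      unfolding N.ip_add_left M.ip_add_left N.ip_scale_left M.ip_scale_left h(2) z'(2)[OF g] gh[OF g h(1)] ..
    ultimately show ?case by blast
  qed
next
  fix z1 z2
  assume 1: "z1 \<in> N.orbit_span y \<and> (\<forall>g\<in>SL2. N.ip z1 (act N g y) = M.ip z (act M g x))"
    and 2: "z2 \<in> N.orbit_span y \<and> (\<forall>g\<in>SL2. N.ip z2 (act N g y) = M.ip z (act M g x))"
  have "z1 - z2 = 0"
  proof (rule N.orbit_span_orthogonal[OF y])
    show "z1 - z2 \<in> N.orbit_span y"
      using 1 2 unfolding N.orbit_span_def by (intro fun_vs.span_diff) blast+
    show "N.ip (z1 - z2) (act N g y) = 0" if "g \<in> SL2" for g
      unfolding N.ip_diff_left using 1 2 that by simp
  qed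
  then show "z1 = z2" by (simp only: right_minus_eq)
qed

definition transport where
  "transport x y z = (THE z'. z' \<in> N.orbit_span y \<and> (\<forall>g\<in>SL2. N.ip z' (act N g y) = M.ip z (act M g x)))"

context
  fixes x y
  assumes x: "x \<in> vecs M" and y: "y \<in> vecs N"
    and coeff: "\<forall>g\<in>SL2. M.ip (act M g x) x = N.ip (act N g y) y"
begin

lemma transport:
  assumes "z \<in> M.orbit_span x"
  shows "transport x y z \<in> N.orbit_span y"
    and "g \<in> SL2 \<Longrightarrow> N.ip (transport x y z) (act N g y) = M.ip z (act M g x)"
  using theI'[OF orbit_transport[OF x y coeff assms]] unfolding transport_def by blast+

lemma transport_eqI:
  assumes "z \<in> M.orbit_span x" "z' \<in> N.orbit_span y"
    and "\<And>g. g \<in> SL2 \<Longrightarrow> N.ip z' (act N g y) = M.ip z (act M g x)"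
  shows "transport x y z = z'"
  using the1_equality[OF orbit_transport[OF x y coeff assms(1)]] assms(2,3) unfolding transport_def by blast

end

lemma orbit_span_iso:
  assumes x: "x \<in> vecs M" and y: "y \<in> vecs N"
    and coeff: "\<forall>g\<in>SL2. M.ip (act M g x) x = N.ip (act N g y) y"
  shows "equivariant_iso M (M.orbit_span x) N (N.orbit_span y) (transport x y)"
proof -
  interpret rev: unitary_pair N J S wt' M I R wt ..
  have coeff': "\<forall>g\<in>SL2. N.ip (act N g y) y = M.ip (act M g x) x" using coeff by simp
  note t = transport[OF x y coeff] and r = rev.transport[OF y x coeff']
  note sM = M.orbit_span_submodule[OF x] and sN = N.orbit_span_submodule[OF y]
  show ?thesis
    unfolding equivariant_iso_def
  proof (intro conjI ballI)
    show "linear_on (M.orbit_span x) (transport x y)"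
      unfolding linear_on_def
    proof (intro conjI ballI allI)
      fix a b assume a: "a \<in> M.orbit_span x" and b: "b \<in> M.orbit_span x"
      show "transport x y (a + b) = transport x y a + transport x y b"
        by (rule transport_eqI[OF x y coeff fun_vs.subspace_add[OF M.submoduleD(1)[OF sM] a b]
            fun_vs.subspace_add[OF N.submoduleD(1)[OF sN] t(1)[OF a] t(1)[OF b]]])
          (simp_all only: M.ip_add_left N.ip_add_left t(2)[OF a] t(2)[OF b])
    next
      fix c a assume a: "a \<in> M.orbit_span x"
      show "transport x y (fscale c a) = fscale c (transport x y a)"
        by (rule transport_eqI[OF x y coeff fun_vs.subspace_scale[OF M.submoduleD(1)[OF sM] a]
            fun_vs.subspace_scale[OF N.submoduleD(1)[OF sN] t(1)[OF a]]])
          (simp_all only: M.ip_scale_left N.ip_scale_left t(2)[OF a])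
    qed
    show "bij_betw (transport x y) (M.orbit_span x) (N.orbit_span y)"
    proof (rule bij_betw_byWitness[where f' = "rev.transport y x"])
      show "\<forall>a\<in>M.orbit_span x. rev.transport y x (transport x y a) = a"
      proof
        fix a assume a: "a \<in> M.orbit_span x"
        show "rev.transport y x (transport x y a) = a"
          by (rule rev.transport_eqI[OF y x coeff' t(1)[OF a] a]) (simp_all only: t(2)[OF a])
      qed
      show "\<forall>b\<in>N.orbit_span y. transport x y (rev.transport y x b) = b"
      proof
        fix b assume b: "b \<in> N.orbit_span y"
        show "transport x y (rev.transport y x b) = b"
          by (rule transport_eqI[OF x y coeff r(1)[OF b] b]) (simp_all only: r(2)[OF b])
      qed
    qed (use t(1) r(1) in blast)+
    fix h a assume h: "h \<in> SL2" and a: "a \<in> M.orbit_span x"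
    note aM = M.submoduleD(2)[OF sM a] and taN = N.submoduleD(2)[OF sN t(1)[OF a]]
    show "transport x y (act M h a) = act N h (transport x y a)"
    proof (rule transport_eqI[OF x y coeff M.submoduleD(3)[OF sM h a] N.submoduleD(3)[OF sN h t(1)[OF a]]])
      fix g assume g: "g \<in> SL2"
      have hg: "adj2 h ** g \<in> SL2" using g h by (simp add: mult_in_SL2)
      have "N.ip (act N h (transport x y a)) (act N g y) = N.ip (transport x y a) (act N (adj2 h ** g) y)"
        unfolding N.ip_act[OF h taN N.act_closed[OF g y]] N.act_mult[OF adj2_in_SL2[OF h] g y] ..
      also have "\<dots> = M.ip a (act M (adj2 h ** g) x)" by (rule t(2)[OF a hg])
      also have "\<dots> = M.ip (act M h a) (act M g x)"
        unfolding M.ip_act[OF h aM M.act_closed[OF g x]] M.act_mult[OF adj2_in_SL2[OF h] g x] ..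
      finally show "N.ip (act N h (transport x y a)) (act N g y) = M.ip (act M h a) (act M g x)" .
    qed
  qed
qed

text \<open>
  If the corner entry of \<open>g\<close> is nonzero, both coefficients are the \<open>k\<close>-th power of this
  entry; the remaining group elements are limits of such ones.
\<close>

lemma highest_weight_coefficients_eq:
  assumes U: "M.submodule U" and x: "x \<in> M.wspace k U" "M.ip x x = 1" and top: "\<And>l. k < l \<Longrightarrow> M.wspace l U \<subseteq> {0}"
    and U': "N.submodule U'" and y: "y \<in> N.wspace k U'" "N.ip y y = 1" and top': "\<And>l. k < l \<Longrightarrow> N.wspace l U' \<subseteq> {0}"
    and g: "g \<in> SL2"
  shows "M.ip (act M g x) x = N.ip (act N g y) y"
proof -
  have *: "M.ip (act M h x) x = N.ip (act N h y) y" if "h \<in> SL2" "h $ 1 $ 1 \<noteq> 0" for h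
    using M.highest_weight_coefficient[OF U x(1) top that] N.highest_weight_coefficient[OF U' y(1) top' that]
    unfolding x(2) y(2) by simp
  have xM: "x \<in> vecs M" using x(1) M.submoduleD(2)[OF U] by (simp add: M.wspace_def)
  have yN: "y \<in> vecs N" using y(1) N.submoduleD(2)[OF U'] by (simp add: N.wspace_def)
  show ?thesis
  proof (cases "g $ 1 $ 1 = 0")
    case False then show ?thesis using * g by blast
  next
    case True
    then have b: "g $ 1 $ 2 \<noteq> 0" using g by (auto simp: SL2_def det_2)
    let ?F = "\<lambda>t. M.ip (act M (g ** lower_unip t) x) x" and ?F' = "\<lambda>t. N.ip (act N (g ** lower_unip t) y) y"
    have eq: "?F t = ?F' t" if "t \<noteq> 0" for t
    proof (rule *)
      show "g ** lower_unip t \<in> SL2" using g by (simp add: mult_in_SL2)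
      show "(g ** lower_unip t) $ 1 $ 1 \<noteq> 0"
        using True b that by (simp add: matrix_matrix_mult_def UNIV_2 lower_unip_def)
    qed
    have l: "?F \<midarrow>0\<rightarrow> ?F 0" "?F' \<midarrow>0\<rightarrow> ?F' 0"
      using M.coefficient_isCont[OF g xM] N.coefficient_isCont[OF g yN] unfolding isCont_def by blast+
    have "?F \<midarrow>0\<rightarrow> ?F' 0"
      using l(2) by (rule Lim_transform_eventually) (auto simp: eventually_at_filter eq)
    then have "?F 0 = ?F' 0" using LIM_unique l(1) by blast
    moreover have "g ** lower_unip 0 = g"
      by (simp add: Finite_Cartesian_Product.vec_eq_iff forall_2 matrix_matrix_mult_def UNIV_2 lower_unip_def)
    ultimately show ?thesis by simp
  qed
qed

lemma equivariant_iso_dim_wspace_le: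
  assumes U: "M.submodule U" and U': "N.submodule U'" and \<phi>: "equivariant_iso M U N U' \<phi>"
  shows "fun_vs.dim (N.wspace k U') \<le> fun_vs.dim (M.wspace k U)"
proof (rule dim_surj_le)
  have lin: "linear_on U \<phi>" and bij: "bij_betw \<phi> U U'" and eqv: "\<And>g x. g \<in> SL2 \<Longrightarrow> x \<in> U \<Longrightarrow> \<phi> (act M g x) = act N g (\<phi> x)"
    using \<phi> unfolding equivariant_iso_def by blast+
  have wU: "M.wspace k U \<subseteq> U" by (auto simp: M.wspace_def)
  show "linear_on (M.wspace k U) \<phi>" using lin wU unfolding linear_on_def by blast
  show "fun_vs.subspace (M.wspace k U)" by (rule M.wspace_subspace[OF M.submoduleD(1)[OF U]])
  have iff: "\<phi> x \<in> N.wspace k U' \<longleftrightarrow> x \<in> M.wspace k U" if x: "x \<in> U" for x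
  proof -
    have fx: "\<phi> x \<in> U'" using bij_betwE[OF bij] x by blast
    have t: "torus 2 \<in> SL2" by simp
    have "\<phi> x \<in> N.wspace k U' \<longleftrightarrow> act N (torus 2) (\<phi> x) = fscale (2 powi k) (\<phi> x)"
      by (rule N.wspace_eigen[OF U' fx])
    also have "\<dots> \<longleftrightarrow> \<phi> (act M (torus 2) x) = \<phi> (fscale (2 powi k) x)"
      unfolding eqv[OF t x] linear_onD(2)[OF lin x] ..
    also have "\<dots> \<longleftrightarrow> act M (torus 2) x = fscale (2 powi k) x"
      by (rule inj_on_eq_iff[OF bij_betw_imp_inj_on[OF bij] M.submoduleD(3)[OF U t x]
          fun_vs.subspace_scale[OF M.submoduleD(1)[OF U] x]])
    also have "\<dots> \<longleftrightarrow> x \<in> M.wspace k U" by (rule M.wspace_eigen[OF U x, symmetric])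
    finally show ?thesis .
  qed
  show "\<phi> ` M.wspace k U = N.wspace k U'"
  proof (intro equalityI subsetI)
    fix w assume "w \<in> \<phi> ` M.wspace k U" then show "w \<in> N.wspace k U'" using iff wU by blast
  next
    fix w assume w: "w \<in> N.wspace k U'"
    then have "w \<in> U'" by (simp add: N.wspace_def)
    then obtain x where "x \<in> U" "w = \<phi> x" using bij_betw_imp_surj_on[OF bij] by blast
    then show "w \<in> \<phi> ` M.wspace k U" using iff w by blast
  qed
  fix B assume "fun_vs.independent B" "B \<subseteq> M.wspace k U"
  then show "finite B" using wU M.submoduleD(2)[OF U] by (intro M.finite_independent) auto
qed

end

lemma equivariant_iso_sym:
  assumes M: "sl2_module M" "fun_vs.subspace U" "U \<subseteq> vecs M" "\<And>g x. g \<in> SL2 \<Longrightarrow> x \<in> U \<Longrightarrow> act M g x \<in> U"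
    and \<phi>: "equivariant_iso M U N U' \<phi>"
  shows "equivariant_iso N U' M U (inv_into U \<phi>)"
proof -
  have lin: "linear_on U \<phi>" and bij: "bij_betw \<phi> U U'" and eqv: "\<And>g x. g \<in> SL2 \<Longrightarrow> x \<in> U \<Longrightarrow> \<phi> (act M g x) = act N g (\<phi> x)"
    using \<phi> unfolding equivariant_iso_def by blast+
  let ?i = "inv_into U \<phi>"
  have i: "?i w \<in> U" "\<phi> (?i w) = w" if "w \<in> U'" for w
    using bij_betw_imp_surj_on[OF bij] that by (auto simp: inv_into_into f_inv_into_f)
  have iI: "?i w = x" if "x \<in> U" "\<phi> x = w" for x w
    using inv_into_f_f[OF bij_betw_imp_inj_on[OF bij] that(1)] that(2) by simp
  show ?thesis
    unfolding equivariant_iso_def linear_on_def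
  proof (intro conjI ballI allI)
    fix a b assume a: "a \<in> U'" and b: "b \<in> U'"
    show "?i (a + b) = ?i a + ?i b"
      by (rule iI[OF fun_vs.subspace_add[OF M(2) i(1)[OF a] i(1)[OF b]]])
        (simp only: linear_onD(1)[OF lin i(1)[OF a] i(1)[OF b]] i(2)[OF a] i(2)[OF b])
  next
    fix c a assume a: "a \<in> U'"
    show "?i (fscale c a) = fscale c (?i a)"
      by (rule iI[OF fun_vs.subspace_scale[OF M(2) i(1)[OF a]]])
        (simp only: linear_onD(2)[OF lin i(1)[OF a]] i(2)[OF a])
  next
    show "bij_betw ?i U' U" by (rule bij_betw_inv_into[OF bij])
  next
    fix g a assume g: "g \<in> SL2" and a: "a \<in> U'"
    show "?i (act N g a) = act M g (?i a)"
      by (rule iI[OF M(4)[OF g i(1)[OF a]]]) (simp only: eqv[OF g i(1)[OF a]] i(2)[OF a])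
  qed
qed

context unitary_pair
begin

lemma equivariant_iso_dim_wspace:
  assumes U: "M.submodule U" and U': "N.submodule U'" and \<phi>: "equivariant_iso M U N U' \<phi>"
  shows "fun_vs.dim (N.wspace k U') = fun_vs.dim (M.wspace k U)"
proof (rule antisym)
  interpret rev: unitary_pair N J S wt' M I R wt ..
  show "fun_vs.dim (N.wspace k U') \<le> fun_vs.dim (M.wspace k U)"
    by (rule equivariant_iso_dim_wspace_le[OF U U' \<phi>])
  have "equivariant_iso N U' M U (inv_into U \<phi>)"
    using M.submoduleD[OF U] by (intro equivariant_iso_sym[OF M.sl2 _ _ _ \<phi>]) blast+
  then show "fun_vs.dim (M.wspace k U) \<le> fun_vs.dim (N.wspace k U')"
    by (rule rev.equivariant_iso_dim_wspace_le[OF U' U])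
qed

text \<open>
  Unit vectors \<open>x\<close>, \<open>y\<close> of the same highest weight generate isomorphic submodules; these
  have equal weight multiplicities, hence so do their orthogonal complements, which have smaller dimension.
\<close>

theorem equal_weights_imp_iso:
  assumes "M.submodule U" "N.submodule U'" "\<And>k. fun_vs.dim (M.wspace k U) = fun_vs.dim (N.wspace k U')"
  shows "\<exists>\<phi>. equivariant_iso M U N U' \<phi>"
  using assms
proof (induction "fun_vs.dim U" arbitrary: U U' rule: less_induct)
  case less
  note U = less.prems(1) and U' = less.prems(2) and dims = less.prems(3)
  have wM: "M.wspace k X \<subseteq> vecs M" if "M.submodule X" for k X using M.submoduleD(2)[OF that] by (auto simp: M.wspace_def)
  have wN: "N.wspace k X \<subseteq> vecs N" if "N.submodule X" for k X using N.submoduleD(2)[OF that] by (auto simp: N.wspace_def)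
  have zero_iff: "M.wspace k U \<subseteq> {0} \<longleftrightarrow> N.wspace k U' \<subseteq> {0}" for k
    using dims[of k] M.dim_eq_0_iff[OF wM[OF U], of k] N.dim_eq_0_iff[OF wN[OF U'], of k] by simp
  define K where "K = {k. \<not> M.wspace k U \<subseteq> {0}}"
  have "K \<subseteq> wt ` I"
  proof
    fix k assume "k \<in> K"
    then obtain x where x: "x \<in> M.wspace k U" "x \<noteq> 0" unfolding K_def by blast
    then obtain i where "x i \<noteq> 0" by (auto simp: fun_eq_iff)
    moreover have "x \<in> vecs M" using x wM[OF U] by blast
    ultimately show "k \<in> wt ` I" using x(1) M.supp[of x i] by (auto simp: M.wspace_def)
  qed
  then have finK: "finite K" using M.fin_I finite_surj by blast
  show ?case
  proof (cases "K = {}")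
    case True
    then have zM: "M.wspace k U \<subseteq> {0}" for k unfolding K_def by blast
    then have zN: "N.wspace k U' \<subseteq> {0}" for k using zero_iff by blast
    have "U = {0}" using M.wspace_zero_imp_zero[OF U zM] fun_vs.subspace_0[OF M.submoduleD(1)[OF U]] by blast
    moreover have "U' = {0}" using N.wspace_zero_imp_zero[OF U' zN] fun_vs.subspace_0[OF N.submoduleD(1)[OF U']] by blast
    moreover have "act M g 0 = 0" "act N g 0 = 0" if "g \<in> SL2" for g
      using linear_on_zero[OF M.act_linear[OF that] M.subspace] linear_on_zero[OF N.act_linear[OF that] N.subspace] by blast+
    ultimately have "equivariant_iso M U N U' (\<lambda>_. 0)"
      unfolding equivariant_iso_def linear_on_def bij_betw_def
      by (simp only: ball_simps simp_thms fun_vs.scale_zero_right add_0_left image_insert image_empty inj_on_insert inj_on_empty Diff_empty empty_iff) simp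
    then show ?thesis by blast
  next
    case False
    define k where "k = Max K"
    have kK: "k \<in> K" and kmax: "\<And>l. l \<in> K \<Longrightarrow> l \<le> k" unfolding k_def using finK False by auto
    have top: "M.wspace l U \<subseteq> {0}" if "k < l" for l using kmax[of l] that unfolding K_def by force
    have top': "N.wspace l U' \<subseteq> {0}" if "k < l" for l using top[OF that] zero_iff by blast
    have nzM: "\<not> M.wspace k U \<subseteq> {0}" using kK unfolding K_def by blast
    then have nzN: "\<not> N.wspace k U' \<subseteq> {0}" using zero_iff by blast
    obtain x where x: "x \<in> M.wspace k U" "M.ip x x = 1"
      using M.unit_vector_exists[OF M.wspace_subspace[OF M.submoduleD(1)[OF U]] wM[OF U] nzM] by blast
    obtain y where y: "y \<in> N.wspace k U'" "N.ip y y = 1"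
      using N.unit_vector_exists[OF N.wspace_subspace[OF N.submoduleD(1)[OF U']] wN[OF U'] nzN] by blast
    have xM: "x \<in> vecs M" and yN: "y \<in> vecs N" using x y wM[OF U] wN[OF U'] by blast+
    have xU: "x \<in> U" and yU: "y \<in> U'" using x y by (simp_all add: M.wspace_def N.wspace_def)
    define A A' where "A = M.orbit_span x" and "A' = N.orbit_span y"
    have A: "M.submodule A" and A': "N.submodule A'" unfolding A_def A'_def
      by (rule M.orbit_span_submodule[OF xM], rule N.orbit_span_submodule[OF yN])
    have AU: "A \<subseteq> U" and AU': "A' \<subseteq> U'" unfolding A_def A'_def
      by (rule M.orbit_span_subset[OF U xU], rule N.orbit_span_subset[OF U' yU])
    have iso1: "equivariant_iso M A N A' (transport x y)"
      unfolding A_def A'_def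
      by (rule orbit_span_iso[OF xM yN ballI[OF highest_weight_coefficients_eq[OF U x top U' y top']]])
    define C C' where "C = M.orth_compl A U" and "C' = N.orth_compl A' U'"
    have C: "M.submodule C" and C': "N.submodule C'" unfolding C_def C'_def
      by (rule M.orth_compl_submodule[OF A U], rule N.orth_compl_submodule[OF A' U'])
    have dimsC: "fun_vs.dim (M.wspace l C) = fun_vs.dim (N.wspace l C')" for l
      using M.dim_orth_decomposition(2)[OF A U AU, of l] N.dim_orth_decomposition(2)[OF A' U' AU', of l]
        dims[of l] equivariant_iso_dim_wspace[OF A A' iso1, of l] unfolding C_def C'_def by simp
    have "x \<in> A" using M.orbit_span_base[OF mat_1_in_SL2, of x] M.act_one[OF xM] unfolding A_def by simp
    moreover have "x \<noteq> 0" using x(2) M.ip_zero_left[of 0] by (metis zero_neq_one)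
    ultimately have "\<not> A \<subseteq> {0}" by blast
    moreover have "A \<subseteq> vecs M" using M.submoduleD(2)[OF A] by blast
    ultimately have "fun_vs.dim A \<noteq> 0" using M.dim_eq_0_iff[of A] by blast
    then have "fun_vs.dim C < fun_vs.dim U"
      using M.dim_orth_decomposition(1)[OF A U AU] unfolding C_def by simp
    then obtain \<phi>2 where iso2: "equivariant_iso M C N C' \<phi>2"
      using less.hyps[OF _ C C' dimsC] by blast
    have vecs: "A \<subseteq> vecs M" "C \<subseteq> vecs M" "A' \<subseteq> vecs N" "C' \<subseteq> vecs N"
      using M.submoduleD(2)[OF A] M.submoduleD(2)[OF C] N.submoduleD(2)[OF A'] N.submoduleD(2)[OF C'] by blast+
    show ?thesis
      by (rule equivariant_iso_direct_sum[OF M.sl2 N.sl2 M.submoduleD(1)[OF A] M.submoduleD(1)[OF C]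
            N.submoduleD(1)[OF A'] N.submoduleD(1)[OF C'] vecs M.submoduleD(3)[OF A] M.submoduleD(3)[OF C]
            M.orth_compl_Int[OF A U, folded C_def] N.orth_compl_Int[OF A' U', folded C'_def]
            M.orth_direct_sum[OF A U AU, folded C_def] N.orth_direct_sum[OF A' U' AU', folded C'_def] iso1 iso2])
  qed
qed

corollary sl2_iso_if_equal_weights:
  assumes "\<And>k. fun_vs.dim (M.wspace k (vecs M)) = fun_vs.dim (N.wspace k (vecs N))"
  shows "M \<simeq>\<^sub>S\<^sub>L N"
  using equal_weights_imp_iso[OF M.submodule_vecs N.submodule_vecs assms] M.sl2 N.sl2
  unfolding sl2_iso_def equivariant_iso_def by blast

end

section \<open>Boxes, tuples and permutation groups\<close>

definition box_before :: "nat \<times> nat \<Rightarrow> nat \<times> nat \<Rightarrow> bool" where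
  "box_before p q \<longleftrightarrow> fst p < fst q \<or> fst p = fst q \<and> snd p < snd q"

lemma boxes_upto:
  "sorted_wrt box_before (concat (map (\<lambda>i. map (\<lambda>j. (i, j)) [0..<f i]) [0..<l])) \<and>
   length (concat (map (\<lambda>i. map (\<lambda>j. (i, j)) [0..<f i]) [0..<l])) = (\<Sum>i<l. f i)"
  by (induction l) (auto simp: sorted_wrt_append sorted_wrt_map box_before_def strict_sorted_iff)

lemma set_boxes: "set (boxes lam) = {(i, j). i < length lam \<and> j < lam ! i}"
  by (auto simp: boxes_def)

lemma length_boxes: "length (boxes lam) = sum_list lam"
  using boxes_upto[of "\<lambda>i. lam ! i" "length lam"]
  by (simp add: boxes_def sum_list_sum_nth atLeast0LessThan)

lemma sorted_boxes: "sorted_wrt box_before (boxes lam)"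
  unfolding boxes_def using boxes_upto by blast

text \<open>
  This expands tensors in a basis and computes the matrix of a tensor power of a linear map.
\<close>

lemma prod_sum_lists:
  fixes g :: "nat \<Rightarrow> 'b \<Rightarrow> 'c::comm_semiring_1"
  assumes "finite J"
  shows "(\<Prod>a<n. \<Sum>j\<in>J. g a j) = (\<Sum>T | set T \<subseteq> J \<and> length T = n. \<Prod>a<n. g a (T ! a))"
proof (induction n arbitrary: g)
  case 0
  have "{T. set T \<subseteq> J \<and> length T = 0} = {[]}" by auto
  then show ?case by simp
next
  case (Suc n)
  let ?L = "\<lambda>n. {T. set T \<subseteq> J \<and> length T = n}"
  have "(\<Prod>a<Suc n. \<Sum>j\<in>J. g a j) = (\<Sum>j\<in>J. g 0 j) * (\<Prod>a<n. \<Sum>j\<in>J. g (Suc a) j)"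
    by (simp add: prod.lessThan_Suc_shift del: prod.lessThan_Suc)
  also have "\<dots> = (\<Sum>j\<in>J. g 0 j) * (\<Sum>T\<in>?L n. \<Prod>a<n. g (Suc a) (T ! a))"
    by (simp only: Suc)
  also have "\<dots> = (\<Sum>(j, T)\<in>J \<times> ?L n. g 0 j * (\<Prod>a<n. g (Suc a) (T ! a)))"
    by (simp only: sum_product sum.cartesian_product)
  also have "\<dots> = (\<Sum>T\<in>?L (Suc n). \<Prod>a<Suc n. g a (T ! a))"
    by (rule sum.reindex_bij_witness[of _ "\<lambda>T. (hd T, tl T)" "\<lambda>(j, T). j # T"])
       (auto simp: length_Suc_conv prod.lessThan_Suc_shift simp del: prod.lessThan_Suc)
  finally show ?case .
qed

text \<open>
  The unqualified name of the permutation is taken by transposition of matrices.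
\<close>

abbreviation swp :: "nat \<Rightarrow> nat \<Rightarrow> nat \<Rightarrow> nat" where "swp \<equiv> Transposition.transpose"

text \<open>
  With \<open>f\<close> the row or the column of a box this is the row group or the column group.
\<close>

definition fibre_perms :: "nat \<Rightarrow> (nat \<Rightarrow> nat) \<Rightarrow> (nat \<Rightarrow> nat) set" where
  "fibre_perms n f = {\<sigma>. \<sigma> permutes {..<n} \<and> (\<forall>k<n. f (\<sigma> k) = f k)}"

lemma fibre_permsD: "\<sigma> \<in> fibre_perms n f \<Longrightarrow> \<sigma> permutes {..<n}" "\<sigma> \<in> fibre_perms n f \<Longrightarrow> k < n \<Longrightarrow> f (\<sigma> k) = f k"
  "\<sigma> \<in> fibre_perms n f \<Longrightarrow> k < n \<Longrightarrow> \<sigma> k < n"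
  by (auto simp: fibre_perms_def dest: permutes_in_image)

lemma finite_fibre_perms: "finite (fibre_perms n f)"
  unfolding fibre_perms_def using finite_permutations[of "{..<n}"] by simp

lemma id_fibre_perms: "id \<in> fibre_perms n f"
  by (simp add: fibre_perms_def permutes_id)

lemma comp_fibre_perms: "\<sigma> \<in> fibre_perms n f \<Longrightarrow> \<tau> \<in> fibre_perms n f \<Longrightarrow> \<sigma> \<circ> \<tau> \<in> fibre_perms n f"
  by (auto simp: fibre_perms_def permutes_compose dest: permutes_in_image)

lemma inv_fibre_perms:
  assumes "\<sigma> \<in> fibre_perms n f" shows "inv \<sigma> \<in> fibre_perms n f"
proof -
  have p: "\<sigma> permutes {..<n}" using assms by (rule fibre_permsD)
  have "f (inv \<sigma> k) = f k" if k: "k < n" for k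
  proof -
    have "inv \<sigma> k < n" using permutes_in_image[OF permutes_inv[OF p], of k] k by simp
    then show ?thesis using fibre_permsD(2)[OF assms, of "inv \<sigma> k"] permutes_inverses(1)[OF p] by simp
  qed
  then show ?thesis using permutes_inv[OF p] by (simp add: fibre_perms_def)
qed

lemma transpose_fibre_perms:
  "a < n \<Longrightarrow> b < n \<Longrightarrow> f a = f b \<Longrightarrow> swp a b \<in> fibre_perms n f"
  by (auto simp: fibre_perms_def permutes_swap_id Transposition.transpose_def)

lemma sum_fibre_perms_left:
  assumes "\<sigma> \<in> fibre_perms n f"
  shows "(\<Sum>\<rho>\<in>fibre_perms n f. G (\<sigma> \<circ> \<rho>)) = (\<Sum>\<rho>\<in>fibre_perms n f. G \<rho>)"
proof (rule sum.reindex_bij_witness[where i = "\<lambda>\<rho>. inv \<sigma> \<circ> \<rho>" and j = "\<lambda>\<rho>. \<sigma> \<circ> \<rho>"])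
  have p: "\<sigma> permutes {..<n}" using assms by (rule fibre_permsD)
  fix \<rho>
  show "inv \<sigma> \<circ> (\<sigma> \<circ> \<rho>) = \<rho>" "\<sigma> \<circ> (inv \<sigma> \<circ> \<rho>) = \<rho>"
    using permutes_inverses[OF p] by (auto simp: fun_eq_iff)
qed (auto intro: comp_fibre_perms inv_fibre_perms assms)

text \<open>
  The elementary step of the rearrangement inequality: removing an inversion increases the
  sum of products.
\<close>

lemma sum_swap_less:
  fixes f g :: "nat \<Rightarrow> nat"
  assumes ab: "a < n" "b < n" and f: "f a < f b" and g: "g b < g a"
  shows "(\<Sum>i<n. f i * g i) < (\<Sum>i<n. f i * g (swp a b i))"
proof -
  have ne: "a \<noteq> b" using f by auto
  let ?R = "{..<n} - {a} - {b}"
  have split: "(\<Sum>i<n. h i) = h a + (h b + sum h ?R)" for h :: "nat \<Rightarrow> nat"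
    using ab ne by (simp add: sum.remove[of "{..<n}" a] sum.remove[of "{..<n} - {a}" b])
  have rest: "(\<Sum>i\<in>?R. f i * g (swp a b i)) = (\<Sum>i\<in>?R. f i * g i)"
    by (intro sum.cong) (auto simp: Transposition.transpose_def)
  define d e where "d = f b - f a" and "e = g a - g b"
  have d: "f b = f a + d" "0 < d" and e: "g a = g b + e" "0 < e" using f g by (auto simp: d_def e_def)
  have "f a * g a + f b * g b < f a * g b + f b * g a"
    unfolding d e using d(2) e(2) by (simp add: algebra_simps)
  then show ?thesis unfolding split rest using ne by (simp add: Transposition.transpose_def)
qed

section \<open>A basis of the image of the Young symmetrizer\<close>

text \<open>
  The vectors \<open>E 0, \<dots>, E (m - 1)\<close> are a basis of the space to which the Schur functor is
  applied. Evaluation at the points \<open>p j\<close> gives the dual basis, so coordinates of tensors are values of functions.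
\<close>

locale tableau_basis =
  fixes lam :: "nat list" and m :: nat and E :: "nat \<Rightarrow> 'a \<Rightarrow> complex" and p :: "nat \<Rightarrow> 'a"
  assumes partition: "sorted_wrt (\<ge>) lam"
    and dual: "i < m \<Longrightarrow> j < m \<Longrightarrow> E i (p j) = (if i = j then 1 else 0)"
begin

definition n :: nat where "n = sum_list lam"
definition row :: "nat \<Rightarrow> nat" where "row k = fst (boxes lam ! k)"
definition col :: "nat \<Rightarrow> nat" where "col k = snd (boxes lam ! k)"

text \<open>
  A filling of the diagram is the list of its entries in the order of the boxes; permutations
  of places act on fillings by \<open>permute_list\<close>.
\<close>

definition fillings :: "nat list set" where "fillings = {T. set T \<subseteq> {..<m} \<and> length T = n}"

definition e :: "nat list \<Rightarrow> 'a list \<Rightarrow> complex" where "e T = pure_tensor (map E T)"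
definition D :: "nat list \<Rightarrow> 'a list \<Rightarrow> complex" where "D T = young_symmetrizer lam (e T)"

text \<open>
  Strictness is only asked for vertically adjacent boxes; \<open>ssyt_col\<close> extends it to columns.
\<close>

definition ssyt :: "nat list set" where
  "ssyt = {T \<in> fillings. (\<forall>k<n. \<forall>k'<n. row k = row k' \<and> col k \<le> col k' \<longrightarrow> T ! k \<le> T ! k') \<and>
     (\<forall>k<n. \<forall>k'<n. col k = col k' \<and> row k' = Suc (row k) \<longrightarrow> T ! k < T ! k')}"

lemma row_group_eq: "row_group lam = fibre_perms n row"
  by (simp add: row_group_def fibre_perms_def n_def row_def)

lemma col_group_eq: "col_group lam = fibre_perms n col"
  by (simp add: col_group_def fibre_perms_def n_def col_def)

lemma box_order:
  assumes "k < k'" "k' < n"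
  shows "row k < row k' \<or> row k = row k' \<and> col k < col k'"
  using sorted_wrt_nth_less[OF sorted_boxes[of lam], of k k'] assms length_boxes[of lam]
  by (simp add: box_before_def row_def col_def n_def)

lemma box_inject: "k < n \<Longrightarrow> k' < n \<Longrightarrow> row k = row k' \<Longrightarrow> col k = col k' \<Longrightarrow> k = k'"
  using box_order[of k k'] box_order[of k' k] by (cases k k' rule: linorder_cases) auto

lemma box_in: assumes "k < n" shows "row k < length lam" "col k < lam ! row k"
proof -
  have "boxes lam ! k \<in> set (boxes lam)" using assms length_boxes[of lam] by (simp add: n_def)
  then show "row k < length lam" "col k < lam ! row k" by (auto simp: set_boxes row_def col_def)
qed

lemma box_exists: assumes "i < length lam" "j < lam ! i" shows "\<exists>k<n. row k = i \<and> col k = j"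
proof -
  have "(i, j) \<in> set (boxes lam)" using assms by (simp add: set_boxes)
  then show ?thesis unfolding in_set_conv_nth by (auto simp: row_def col_def n_def length_boxes)
qed

lemma finite_fillings: "finite fillings"
  unfolding fillings_def by (rule finite_lists_length_eq) simp

lemma fillings_permute: "T \<in> fillings \<Longrightarrow> \<sigma> permutes {..<n} \<Longrightarrow> permute_list \<sigma> T \<in> fillings"
  by (auto simp: fillings_def)

lemma permute_nth: "T \<in> fillings \<Longrightarrow> \<sigma> permutes {..<n} \<Longrightarrow> k < n \<Longrightarrow> permute_list \<sigma> T ! k = T ! \<sigma> k"
  by (auto simp: fillings_def intro: permute_list_nth)

lemma permute_comp: "T \<in> fillings \<Longrightarrow> \<tau> permutes {..<n} \<Longrightarrow> permute_list \<tau> (permute_list \<sigma> T) = permute_list (\<sigma> \<circ> \<tau>) T"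
  by (auto simp: fillings_def permute_list_compose)

lemma filling_eqI: "S \<in> fillings \<Longrightarrow> T \<in> fillings \<Longrightarrow> (\<And>k. k < n \<Longrightarrow> S ! k = T ! k) \<Longrightarrow> S = T"
  by (auto simp: fillings_def intro: nth_equalityI)

lemma filling_less: "T \<in> fillings \<Longrightarrow> k < n \<Longrightarrow> T ! k < m"
proof -
  assume "T \<in> fillings" "k < n"
  then have "set T \<subseteq> {..<m}" "T ! k \<in> set T" by (simp_all add: fillings_def)
  then show ?thesis by blast
qed

lemma place_perm_e: "T \<in> fillings \<Longrightarrow> \<sigma> permutes {..<n} \<Longrightarrow> place_perm \<sigma> (e T) = e (permute_list \<sigma> T)"
  unfolding e_def fillings_def by (simp add: place_perm_pure permute_list_map)

lemma additive_sum:
  fixes F :: "('b \<Rightarrow> complex) \<Rightarrow> ('c \<Rightarrow> complex)"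
  assumes add: "\<And>s t. F (s + t) = F s + F t" and sc: "\<And>c t. F (fscale c t) = fscale c (F t)"
  shows "F (\<Sum>i\<in>A. x i) = (\<Sum>i\<in>A. F (x i))"
proof -
  have "F 0 = F (fscale 0 0)" by simp
  then have z: "F 0 = 0" unfolding sc by simp
  show ?thesis
  proof (induction A rule: infinite_finite_induct)
    case (infinite A) show ?case unfolding sum.infinite[OF infinite] by (rule z)
  next
    case empty show ?case unfolding sum.empty by (rule z)
  next
    case (insert a A) show ?case unfolding sum.insert[OF insert(1,2)] add insert(3) by (rule refl)
  qed
qed

lemmas col_antisymmetrizer_sum = additive_sum[OF col_antisymmetrizer_add col_antisymmetrizer_scale]
lemmas young_symmetrizer_sum = additive_sum[OF young_symmetrizer_add young_symmetrizer_scale]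

lemma row_symmetrizer_e: "T \<in> fillings \<Longrightarrow> row_symmetrizer lam (e T) = (\<Sum>\<sigma>\<in>fibre_perms n row. e (permute_list \<sigma> T))"
  unfolding row_symmetrizer_def row_group_eq by (intro sum.cong refl place_perm_e) (auto dest: fibre_permsD)

lemma col_antisymmetrizer_e:
  "T \<in> fillings \<Longrightarrow> col_antisymmetrizer lam (e T) = (\<Sum>\<tau>\<in>fibre_perms n col. fscale (of_int (sign \<tau>)) (e (permute_list \<tau> T)))"
  unfolding col_antisymmetrizer_def col_group_eq
  by (intro sum.cong refl arg_cong[of _ _ "fscale _"] place_perm_e) (auto dest: fibre_permsD)

lemma D_eq: "T \<in> fillings \<Longrightarrow> D T = (\<Sum>\<sigma>\<in>fibre_perms n row. col_antisymmetrizer lam (e (permute_list \<sigma> T)))"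
  unfolding D_def young_symmetrizer_def by (simp only: row_symmetrizer_e col_antisymmetrizer_sum)

lemma D_permute_row:
  assumes T: "T \<in> fillings" and \<sigma>: "\<sigma> \<in> fibre_perms n row"
  shows "D (permute_list \<sigma> T) = D T"
proof -
  have "D (permute_list \<sigma> T) = (\<Sum>\<rho>\<in>fibre_perms n row. col_antisymmetrizer lam (e (permute_list \<rho> (permute_list \<sigma> T))))"
    by (rule D_eq[OF fillings_permute[OF T fibre_permsD(1)[OF \<sigma>]]])
  also have "\<dots> = (\<Sum>\<rho>\<in>fibre_perms n row. col_antisymmetrizer lam (e (permute_list (\<sigma> \<circ> \<rho>) T)))"
    by (intro sum.cong refl arg_cong[of _ _ "col_antisymmetrizer lam"] arg_cong[of _ _ e] permute_comp[OF T]) (rule fibre_permsD(1))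
  also have "\<dots> = D T"
    unfolding D_eq[OF T] by (rule sum_fibre_perms_left[OF \<sigma>])
  finally show ?thesis .
qed

lemma col_antisymmetrizer_permute:
  assumes T: "T \<in> fillings" and \<tau>: "\<tau> \<in> fibre_perms n col"
  shows "col_antisymmetrizer lam (e (permute_list \<tau> T)) = fscale (of_int (sign \<tau>)) (col_antisymmetrizer lam (e T))"
proof -
  note p\<tau> = fibre_permsD(1)[OF \<tau>]
  have perm: "permutation \<rho>" if "\<rho> \<in> fibre_perms n col" for \<rho>
    using fibre_permsD(1)[OF that] by (rule permutation_permutes[THEN iffD2, OF exI, OF conjI[OF finite_lessThan]])
  have "col_antisymmetrizer lam (e (permute_list \<tau> T))
    = (\<Sum>\<rho>\<in>fibre_perms n col. fscale (of_int (sign \<rho>)) (e (permute_list \<rho> (permute_list \<tau> T))))"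
    by (rule col_antisymmetrizer_e[OF fillings_permute[OF T p\<tau>]])
  also have "\<dots> = (\<Sum>\<rho>\<in>fibre_perms n col. fscale (of_int (sign \<tau>)) (fscale (of_int (sign (\<tau> \<circ> \<rho>))) (e (permute_list (\<tau> \<circ> \<rho>) T))))"
  proof (rule sum.cong[OF refl])
    fix \<rho> assume \<rho>: "\<rho> \<in> fibre_perms n col"
    have "sign \<rho> = sign \<tau> * sign (\<tau> \<circ> \<rho>)"
      unfolding sign_compose[OF perm[OF \<tau>] perm[OF \<rho>]] by (simp add: sign_idempotent flip: mult.assoc)
    then have "(of_int (sign \<rho>) :: complex) = of_int (sign \<tau>) * of_int (sign (\<tau> \<circ> \<rho>))" by (metis of_int_mult)
    then show "fscale (of_int (sign \<rho>)) (e (permute_list \<rho> (permute_list \<tau> T)))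
      = fscale (of_int (sign \<tau>)) (fscale (of_int (sign (\<tau> \<circ> \<rho>))) (e (permute_list (\<tau> \<circ> \<rho>) T)))"
      unfolding permute_comp[OF T fibre_permsD(1)[OF \<rho>]] fun_vs.scale_scale by (simp only:)
  qed
  also have "\<dots> = fscale (of_int (sign \<tau>)) (\<Sum>\<rho>\<in>fibre_perms n col. fscale (of_int (sign (\<tau> \<circ> \<rho>))) (e (permute_list (\<tau> \<circ> \<rho>) T)))"
    by (rule fun_vs.scale_sum_right[symmetric])
  also have "(\<Sum>\<rho>\<in>fibre_perms n col. fscale (of_int (sign (\<tau> \<circ> \<rho>))) (e (permute_list (\<tau> \<circ> \<rho>) T)))
    = (\<Sum>\<rho>\<in>fibre_perms n col. fscale (of_int (sign \<rho>)) (e (permute_list \<rho> T)))"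
    by (rule sum_fibre_perms_left[OF \<tau>])
  finally show ?thesis unfolding col_antisymmetrizer_e[OF T] .
qed

subsection \<open>Garnir relations\<close>

text \<open>
  A place transposition inside a column changes the sign under the column antisymmetrizer. If
  it exchanges two places that \<open>\<rho>\<close> sends into \<open>X\<close>, then it only permutes the summands, so the sum equals its
  negative.
\<close>

lemma garnir_term:
  assumes T: "T \<in> fillings" and X: "X \<subseteq> {..<n}" and \<rho>: "\<rho> permutes {..<n}"
    and ab: "a < n" "b < n" "a \<noteq> b" "col a = col b" "\<rho> a \<in> X" "\<rho> b \<in> X"
  shows "(\<Sum>\<pi> | \<pi> permutes X. col_antisymmetrizer lam (e (permute_list (\<pi> \<circ> \<rho>) T))) = 0" (is "?S = 0")
proof -
  let ?\<tau> = "swp a b" and ?\<theta> = "swp (\<rho> a) (\<rho> b)"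
  have \<tau>: "?\<tau> \<in> fibre_perms n col" by (rule transpose_fibre_perms[OF ab(1,2,4)])
  have \<theta>: "?\<theta> permutes X" by (rule permutes_swap_id[OF ab(5,6)])
  have \<theta>\<rho>: "?\<theta> \<circ> \<rho> = \<rho> \<circ> ?\<tau>"
    using permutes_inj[OF \<rho>] by (auto simp: fun_eq_iff Transposition.transpose_def inj_eq)
  have perm: "\<pi> \<circ> \<rho> permutes {..<n}" if "\<pi> permutes X" for \<pi>
    using permutes_compose[OF \<rho> permutes_subset[OF that X]] .
  have "?S = (\<Sum>\<pi> | \<pi> permutes X. col_antisymmetrizer lam (e (permute_list (\<pi> \<circ> ?\<theta> \<circ> \<rho>) T)))"
  proof (rule sum.reindex_bij_witness[where i = "\<lambda>\<pi>. \<pi> \<circ> ?\<theta>" and j = "\<lambda>\<pi>. \<pi> \<circ> ?\<theta>"])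
    fix \<pi> :: "nat \<Rightarrow> nat"
    show "\<pi> \<circ> ?\<theta> \<circ> ?\<theta> = \<pi>" by (simp add: comp_assoc)
    then show "col_antisymmetrizer lam (e (permute_list (\<pi> \<circ> ?\<theta> \<circ> ?\<theta> \<circ> \<rho>) T)) = col_antisymmetrizer lam (e (permute_list (\<pi> \<circ> \<rho>) T))"
      by (simp only:)
  qed (use permutes_compose[OF \<theta>] in \<open>auto simp: comp_assoc\<close>)
  also have "\<dots> = (\<Sum>\<pi> | \<pi> permutes X. fscale (- 1) (col_antisymmetrizer lam (e (permute_list (\<pi> \<circ> \<rho>) T))))"
  proof (rule sum.cong[OF refl])
    fix \<pi> assume "\<pi> \<in> {\<pi>. \<pi> permutes X}"
    then have \<pi>: "\<pi> \<circ> \<rho> permutes {..<n}" using perm by blast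
    have "permute_list (\<pi> \<circ> ?\<theta> \<circ> \<rho>) T = permute_list ?\<tau> (permute_list (\<pi> \<circ> \<rho>) T)"
      unfolding permute_comp[OF T fibre_permsD(1)[OF \<tau>]] comp_assoc \<theta>\<rho> ..
    then have "col_antisymmetrizer lam (e (permute_list (\<pi> \<circ> ?\<theta> \<circ> \<rho>) T))
      = fscale (of_int (sign ?\<tau>)) (col_antisymmetrizer lam (e (permute_list (\<pi> \<circ> \<rho>) T)))"
      using col_antisymmetrizer_permute[OF fillings_permute[OF T \<pi>] \<tau>] by (simp only:)
    then show "col_antisymmetrizer lam (e (permute_list (\<pi> \<circ> ?\<theta> \<circ> \<rho>) T))
      = fscale (- 1) (col_antisymmetrizer lam (e (permute_list (\<pi> \<circ> \<rho>) T)))"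
      using ab(3) by (simp add: sign_swap_id)
  qed
  also have "\<dots> = fscale (- 1) ?S" by (rule fun_vs.scale_sum_right[symmetric])
  finally have eq: "?S = fscale (- 1) ?S" .
  show ?thesis
  proof
    fix l
    have "?S l = - ?S l" using fun_cong[OF eq, of l] unfolding fscale_def by simp
    then show "?S l = 0 l" by simp
  qed
qed

lemma garnir_relation:
  assumes T: "T \<in> fillings" and X: "X \<subseteq> {..<n}"
    and big: "\<And>\<rho>. \<rho> \<in> fibre_perms n row \<Longrightarrow> \<exists>a<n. \<exists>b<n. a \<noteq> b \<and> col a = col b \<and> \<rho> a \<in> X \<and> \<rho> b \<in> X"
  shows "(\<Sum>\<pi> | \<pi> permutes X. D (permute_list \<pi> T)) = 0"
proof -
  have "(\<Sum>\<pi> | \<pi> permutes X. D (permute_list \<pi> T))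
    = (\<Sum>\<pi> | \<pi> permutes X. \<Sum>\<rho>\<in>fibre_perms n row. col_antisymmetrizer lam (e (permute_list (\<pi> \<circ> \<rho>) T)))"
  proof (rule sum.cong[OF refl])
    fix \<pi> assume "\<pi> \<in> {\<pi>. \<pi> permutes X}"
    then have \<pi>: "\<pi> permutes {..<n}" using permutes_subset[OF _ X] by blast
    show "D (permute_list \<pi> T) = (\<Sum>\<rho>\<in>fibre_perms n row. col_antisymmetrizer lam (e (permute_list (\<pi> \<circ> \<rho>) T)))"
      unfolding D_eq[OF fillings_permute[OF T \<pi>]]
      by (intro sum.cong refl arg_cong[of _ _ "col_antisymmetrizer lam"] arg_cong[of _ _ e] permute_comp[OF T]) (rule fibre_permsD(1))
  qed
  also have "\<dots> = (\<Sum>\<rho>\<in>fibre_perms n row. \<Sum>\<pi> | \<pi> permutes X. col_antisymmetrizer lam (e (permute_list (\<pi> \<circ> \<rho>) T)))"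
    by (rule sum.swap)
  also have "\<dots> = 0"
  proof (rule sum.neutral, rule ballI)
    fix \<rho> assume \<rho>: "\<rho> \<in> fibre_perms n row"
    then obtain a b where "a < n" "b < n" "a \<noteq> b" "col a = col b" "\<rho> a \<in> X" "\<rho> b \<in> X" using big by blast
    then show "(\<Sum>\<pi> | \<pi> permutes X. col_antisymmetrizer lam (e (permute_list (\<pi> \<circ> \<rho>) T))) = 0"
      by (rule garnir_term[OF T X fibre_permsD(1)[OF \<rho>]])
  qed
  finally show ?thesis .
qed

text \<open>
  The boxes weakly right of \<open>k0\<close> in its row and weakly left of \<open>k1\<close> in the next row number one
  more than the columns of the upper row; so after any permutation of the rows two of them share a column.
\<close>

lemma garnir_set_big:
  assumes k0: "k0 < n" and k1: "k1 < n" and r: "row k1 = Suc (row k0)" and c: "col k1 = col k0"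
    and X: "X = {k. k < n \<and> (row k = row k0 \<and> col k0 \<le> col k \<or> row k = row k1 \<and> col k \<le> col k0)}"
    and \<rho>: "\<rho> \<in> fibre_perms n row"
  shows "\<exists>a<n. \<exists>b<n. a \<noteq> b \<and> col a = col b \<and> \<rho> a \<in> X \<and> \<rho> b \<in> X"
proof -
  let ?a = "row k0" and ?b = "col k0"
  note p\<rho> = fibre_permsD(1)[OF \<rho>]
  have la: "lam ! Suc ?a \<le> lam ! ?a"
    using sorted_wrt_nth_less[OF partition, of ?a "Suc ?a"] box_in(1)[OF k1] r by simp
  have b: "?b < lam ! Suc ?a" using box_in(2)[OF k1] r c by simp
  have "(\<lambda>k. (row k, col k)) ` X = {?a} \<times> {?b..<lam ! ?a} \<union> {Suc ?a} \<times> {..?b}" (is "?f ` X = ?Y")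
  proof (intro equalityI subsetI)
    fix q assume "q \<in> ?f ` X"
    then show "q \<in> ?Y" unfolding X using box_in(2) r by fastforce
  next
    fix q assume q: "q \<in> ?Y"
    have "\<exists>k<n. row k = fst q \<and> col k = snd q"
      using q box_in(1)[OF k0] box_in(1)[OF k1] r b by (intro box_exists) auto
    then show "q \<in> ?f ` X" using q r unfolding X by (auto simp: image_iff)
  qed
  moreover have "card ?Y = card ({?a} \<times> {?b..<lam ! ?a}) + card ({Suc ?a} \<times> {..?b})"
    by (rule card_Un_disjoint) auto
  moreover have "inj_on ?f X" by (rule inj_onI) (auto simp: X intro: box_inject)
  ultimately have cardX: "card X = Suc (lam ! ?a)" using b la by (auto dest: card_image)
  let ?A = "\<rho> -` X \<inter> {..<n}"
  have XA: "\<rho> ` ?A = X"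
  proof (intro equalityI subsetI)
    fix k assume k: "k \<in> X"
    then have "k < n" unfolding X by blast
    then have "inv \<rho> k < n" using permutes_in_image[OF permutes_inv[OF p\<rho>], of k] by simp
    then show "k \<in> \<rho> ` ?A" using k permutes_inverses(1)[OF p\<rho>, of k] by (intro image_eqI[of _ _ "inv \<rho> k"]) auto
  qed auto
  have cardA: "card ?A = Suc (lam ! ?a)"
    using card_image[OF inj_on_subset[OF permutes_inj[OF p\<rho>] subset_UNIV], of ?A] XA cardX by simp
  have "col ` ?A \<subseteq> {..<lam ! ?a}"
  proof
    fix j assume "j \<in> col ` ?A"
    then obtain k where k: "k < n" "\<rho> k \<in> X" "j = col k" by auto
    have "row k = ?a \<or> row k = Suc ?a" using k(2) fibre_permsD(2)[OF \<rho> k(1)] r unfolding X by auto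
    then show "j \<in> {..<lam ! ?a}" using box_in(2)[OF k(1)] la k(3) by auto
  qed
  then have "card (col ` ?A) \<le> lam ! ?a" using card_mono[of "{..<lam ! ?a}"] by fastforce
  then have "\<not> inj_on col ?A" using cardA card_image[of col ?A] by auto
  then show ?thesis unfolding inj_on_def by auto
qed

subsection \<open>Straightening\<close>

text \<open>
  Potential functions for the straightening algorithm: they grow when large entries
  move to lower rows, and to the right within their row.
\<close>

definition row_weight :: "nat list \<Rightarrow> nat" where "row_weight T = (\<Sum>k<n. row k * T ! k)"
definition col_weight :: "nat list \<Rightarrow> nat" where "col_weight T = (\<Sum>k<n. col k * T ! k)"

lemma row_weight_permute_row:
  assumes T: "T \<in> fillings" and \<sigma>: "\<sigma> \<in> fibre_perms n row"
  shows "row_weight (permute_list \<sigma> T) = row_weight T"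
proof -
  have "row_weight (permute_list \<sigma> T) = (\<Sum>k<n. row (\<sigma> k) * T ! \<sigma> k)"
    unfolding row_weight_def using fibre_permsD(2)[OF \<sigma>] permute_nth[OF T fibre_permsD(1)[OF \<sigma>]]
    by (intro sum.cong) auto
  also have "\<dots> = row_weight T"
    unfolding row_weight_def using sum.permute[OF fibre_permsD(1)[OF \<sigma>], of "\<lambda>k. row k * T ! k"] by (simp add: o_def)
  finally show ?thesis .
qed

lemma permute_swp:
  "T \<in> fillings \<Longrightarrow> a < n \<Longrightarrow> b < n \<Longrightarrow> k < n \<Longrightarrow> permute_list (swp a b) T ! k = T ! (swp a b k)"
  by (intro permute_nth permutes_swap_id) auto

text \<open>
  Fillings with the same multiset of entries in each row differ by a row permutation, which the
  row symmetrizer absorbs.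
\<close>

lemma mset_pairs_imp_D_eq:
  assumes T: "T \<in> fillings" and T': "T' \<in> fillings"
    and eq: "image_mset (\<lambda>k. (row k, T' ! k)) (mset_set {..<n}) = image_mset (\<lambda>k. (row k, T ! k)) (mset_set {..<n})"
  shows "D T' = D T"
proof -
  let ?l = "\<lambda>T. map (\<lambda>k. (row k, T ! k)) [0..<n]"
  have "mset (?l T') = mset (?l T)"
    using eq by (simp add: lessThan_atLeast0 mset_map)
  then obtain \<sigma> where \<sigma>: "\<sigma> permutes {..<length (?l T)}" "permute_list \<sigma> (?l T) = ?l T'"
    by (rule mset_eq_permutation)
  have p: "\<sigma> permutes {..<n}" using \<sigma>(1) by simp
  have k: "row (\<sigma> k) = row k \<and> T ! \<sigma> k = T' ! k" if "k < n" for k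
  proof -
    have "?l T ! \<sigma> k = ?l T' ! k" using permute_list_nth[OF \<sigma>(1), of k] that \<sigma>(2) by simp
    then show ?thesis using that permutes_in_image[OF p, of k] by simp
  qed
  have "\<sigma> \<in> fibre_perms n row" using p k by (simp add: fibre_perms_def)
  moreover have "permute_list \<sigma> T = T'"
    using k by (intro filling_eqI fillings_permute[OF T p] T') (simp add: permute_nth[OF T p])
  ultimately show ?thesis using D_permute_row[OF T] by metis
qed

lemma sum_exchange_le:
  fixes t1 :: nat
  assumes fin: "finite Y" "finite Y'" and card: "card Y' = card Y"
    and lo: "\<And>k. k \<in> Y - Y' \<Longrightarrow> g k \<le> t1" and hi: "\<And>k. k \<in> Y' - Y \<Longrightarrow> t1 \<le> g k"
  shows "sum g Y \<le> sum g Y'"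
    and "sum g Y' = sum g Y \<Longrightarrow> (\<forall>k\<in>Y - Y'. g k = t1) \<and> (\<forall>k\<in>Y' - Y. g k = t1) \<and> card (Y' - Y) = card (Y - Y')"
proof -
  have c: "card (Y' - Y) = card (Y - Y')"
    using card fin by (metis card_Diff_subset_Int card_Int_Diff add_left_cancel finite_Int inf_commute)
  have s: "sum g Y = sum g (Y \<inter> Y') + sum g (Y - Y')" "sum g Y' = sum g (Y \<inter> Y') + sum g (Y' - Y)"
    using fin by (simp_all add: sum.Int_Diff[of Y g Y'] sum.Int_Diff[of Y' g Y] inf_commute)
  have l: "sum g (Y - Y') \<le> card (Y - Y') * t1" using sum_bounded_above[of "Y - Y'" g t1] lo by simp
  have h: "card (Y - Y') * t1 \<le> sum g (Y' - Y)" using sum_bounded_below[of "Y' - Y" t1 g] hi c by simp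
  show "sum g Y \<le> sum g Y'" using s l h by linarith
  assume "sum g Y' = sum g Y"
  then have eq: "sum g (Y - Y') = card (Y - Y') * t1" "sum g (Y' - Y) = card (Y - Y') * t1" using s l h by linarith+
  have "g k = t1" if "k \<in> Y - Y'" for k
    using sum_mono_inv[of g "Y - Y'" "\<lambda>_. t1" k] eq(1) lo that fin by simp
  moreover have "g k = t1" if "k \<in> Y' - Y" for k
    using sum_mono_inv[of "\<lambda>_. t1" "Y' - Y" g k] eq(2) hi that fin c by simp
  ultimately show "(\<forall>k\<in>Y - Y'. g k = t1) \<and> (\<forall>k\<in>Y' - Y. g k = t1) \<and> card (Y' - Y) = card (Y - Y')" using c by blast
qed

lemma image_mset_eq_if_exchange:
  assumes fin: "finite Y" "finite Y'" and card: "card (Y' - Y) = card (Y - Y')"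
    and c: "\<And>k. k \<in> Y - Y' \<Longrightarrow> g k = t1" "\<And>k. k \<in> Y' - Y \<Longrightarrow> g k = t1"
  shows "image_mset g (mset_set Y') = image_mset g (mset_set Y)"
proof -
  have split: "image_mset g (mset_set A) = image_mset g (mset_set (A \<inter> B)) + image_mset g (mset_set (A - B))" if "finite A" for A B
  proof -
    have "mset_set A = mset_set (A \<inter> B) + mset_set (A - B)"
      using that by (subst mset_set_Union[symmetric]) (auto intro!: arg_cong[of _ _ mset_set])
    then show ?thesis by simp
  qed
  have const: "image_mset g (mset_set A) = replicate_mset (card A) t1" if "finite A" "\<And>k. k \<in> A \<Longrightarrow> g k = t1" for A
  proof -
    have "image_mset g (mset_set A) = image_mset (\<lambda>_. t1) (mset_set A)" using that by (intro image_mset_cong) auto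
    then show ?thesis by (simp add: image_mset_const_eq)
  qed
  have "image_mset g (mset_set (Y' - Y)) = image_mset g (mset_set (Y - Y'))"
    using const[of "Y' - Y"] const[of "Y - Y'"] fin c card by simp
  then show ?thesis using split[OF fin(1), of Y'] split[OF fin(2), of Y] by (simp add: inf_commute)
qed

text \<open>
  The values in the lower part of the Garnir set are at most those in the upper part; so an exchange
  moves large values downwards, unless it only exchanges equal values. All terms of a Garnir relation
  occur with coefficient one, so those of the second kind add up to a positive multiple of \<open>D T\<close>.
\<close>

lemma garnir_exchange:
  assumes T: "T \<in> fillings" and X: "X \<subseteq> {..<n}"
    and rows: "\<And>k. k \<in> X \<Longrightarrow> row k = a \<or> row k = Suc a"
    and lo: "\<And>k. k \<in> X \<Longrightarrow> row k = Suc a \<Longrightarrow> T ! k \<le> t1" and hi: "\<And>k. k \<in> X \<Longrightarrow> row k = a \<Longrightarrow> t1 \<le> T ! k"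
    and \<pi>: "\<pi> permutes X"
  shows "row_weight T < row_weight (permute_list \<pi> T) \<or> D (permute_list \<pi> T) = D T"
proof -
  let ?T' = "permute_list \<pi> T"
  let ?Y = "{k\<in>X. row k = Suc a}"
  let ?Y' = "\<pi> ` ?Y"
  let ?g = "\<lambda>k. T ! k"
  have \<pi>n: "\<pi> permutes {..<n}" using permutes_subset[OF \<pi> X] .
  have finX: "finite X" using X finite_subset by blast
  have inj: "inj \<pi>" by (rule permutes_inj[OF \<pi>])
  have Y'X: "?Y' \<subseteq> X" using permutes_in_image[OF \<pi>] by auto
  have nth: "?T' ! k = T ! \<pi> k" if "k < n" for k by (rule permute_nth[OF T \<pi>n that])
  have card: "card ?Y' = card ?Y" by (rule card_image[OF inj_on_subset[OF inj subset_UNIV]])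
  have hi': "t1 \<le> T ! k" if "k \<in> ?Y' - ?Y" for k using that Y'X rows[of k] hi[of k] by auto
  have lo': "T ! k \<le> t1" if "k \<in> ?Y - ?Y'" for k using that lo[of k] by auto
  have rw: "(\<Sum>k<n. row k * h k) = (\<Sum>k\<in>{..<n} - X. row k * h k) + a * (\<Sum>k\<in>X. h k) + (\<Sum>k\<in>?Y. h k)" for h :: "nat \<Rightarrow> nat"
  proof -
    have "(\<Sum>k<n. row k * h k) = (\<Sum>k\<in>{..<n} - X. row k * h k) + (\<Sum>k\<in>X. row k * h k)"
      using X by (intro sum.subset_diff) auto
    also have "(\<Sum>k\<in>X. row k * h k) = (\<Sum>k\<in>X. a * h k + (if row k = Suc a then h k else 0))"
      using rows by (intro sum.cong) auto
    also have "\<dots> = a * (\<Sum>k\<in>X. h k) + (\<Sum>k\<in>?Y. h k)"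
      using finX by (simp add: sum.distrib sum_distrib_left sum.inter_filter)
    finally show ?thesis by simp
  qed
  have "(\<Sum>k\<in>{..<n} - X. row k * ?T' ! k) = (\<Sum>k\<in>{..<n} - X. row k * T ! k)"
    using permutes_not_in[OF \<pi>] nth by (intro sum.cong) auto
  moreover have "(\<Sum>k\<in>X. ?T' ! k) = (\<Sum>k\<in>X. T ! k)"
  proof -
    have "(\<Sum>k\<in>X. ?T' ! k) = (\<Sum>k\<in>X. T ! \<pi> k)" using X nth by (intro sum.cong) auto
    also have "\<dots> = (\<Sum>k\<in>X. T ! k)" using sum.permute[OF \<pi>, of ?g] by (simp add: o_def)
    finally show ?thesis .
  qed
  moreover have "(\<Sum>k\<in>?Y. ?T' ! k) = sum ?g ?Y'"
  proof -
    have "(\<Sum>k\<in>?Y. ?T' ! k) = (\<Sum>k\<in>?Y. T ! \<pi> k)" using X nth by (intro sum.cong) auto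
    also have "\<dots> = sum ?g ?Y'" using inj by (subst sum.reindex) (auto intro: inj_on_subset)
    finally show ?thesis .
  qed
  ultimately have diff: "row_weight ?T' + sum ?g ?Y = row_weight T + sum ?g ?Y'"
    unfolding row_weight_def rw[of "\<lambda>k. ?T' ! k"] rw[of ?g] by simp
  show ?thesis
  proof (cases "sum ?g ?Y' = sum ?g ?Y")
    case False
    have "sum ?g ?Y \<le> sum ?g ?Y'"
      by (rule sum_exchange_le(1)[OF _ _ card]) (erule lo' | erule hi' | simp add: finX)+
    then have "sum ?g ?Y < sum ?g ?Y'" using False by simp
    then show ?thesis using diff by linarith
  next
    case True
    have ex: "(\<forall>k\<in>?Y - ?Y'. ?g k = t1) \<and> (\<forall>k\<in>?Y' - ?Y. ?g k = t1) \<and> card (?Y' - ?Y) = card (?Y - ?Y')"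
      by (rule sum_exchange_le(2)[OF _ _ card _ _ True]) (erule lo' | erule hi' | simp add: finX)+
    then have eqs: "\<And>k. k \<in> ?Y - ?Y' \<Longrightarrow> ?g k = t1" "\<And>k. k \<in> ?Y' - ?Y \<Longrightarrow> ?g k = t1" and cardd: "card (?Y' - ?Y) = card (?Y - ?Y')"
      by blast+
    have im: "image_mset \<pi> (mset_set A) = mset_set (\<pi> ` A)" for A
      by (rule image_mset_mset_set[OF inj_on_subset[OF inj subset_UNIV]])
    let ?Z = "{k\<in>X. row k = a}"
    have ZY: "?Z = X - ?Y" using rows by auto
    have \<pi>X: "\<pi> ` X = X" by (rule permutes_image[OF \<pi>])
    have Z': "\<pi> ` ?Z = X - ?Y'" unfolding ZY using inj \<pi>X by (simp add: image_set_diff)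
    have 1: "image_mset (\<lambda>k. T ! \<pi> k) (mset_set ?Y) = image_mset ?g (mset_set ?Y)"
    proof -
      have "image_mset (\<lambda>k. T ! \<pi> k) (mset_set ?Y) = image_mset ?g (image_mset \<pi> (mset_set ?Y))"
        by (simp add: multiset.map_comp o_def)
      also have "\<dots> = image_mset ?g (mset_set ?Y')" unfolding im ..
      also have "\<dots> = image_mset ?g (mset_set ?Y)"
        using finX by (intro image_mset_eq_if_exchange[OF _ _ cardd eqs]) auto
      finally show ?thesis .
    qed
    have 2: "image_mset (\<lambda>k. T ! \<pi> k) (mset_set ?Z) = image_mset ?g (mset_set ?Z)"
    proof -
      have "image_mset (\<lambda>k. T ! \<pi> k) (mset_set ?Z) = image_mset ?g (image_mset \<pi> (mset_set ?Z))"
        by (simp add: multiset.map_comp o_def)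
      also have "\<dots> = image_mset ?g (mset_set (X - ?Y'))" unfolding im Z' ..
      also have "\<dots> = image_mset ?g (mset_set (X - ?Y))"
      proof (rule image_mset_eq_if_exchange)
        have d: "(X - ?Y') - (X - ?Y) = ?Y - ?Y'" "(X - ?Y) - (X - ?Y') = ?Y' - ?Y" using Y'X by auto
        show "card ((X - ?Y') - (X - ?Y)) = card ((X - ?Y) - (X - ?Y'))" unfolding d by (rule cardd[symmetric])
        show "?g k = t1" if "k \<in> (X - ?Y) - (X - ?Y')" for k using that eqs(2) unfolding d by blast
        show "?g k = t1" if "k \<in> (X - ?Y') - (X - ?Y)" for k using that eqs(1) unfolding d by blast
      qed (use finX in auto)
      finally show ?thesis unfolding ZY .
    qed
    have pair: "image_mset (\<lambda>k. (row k, h k)) (mset_set {..<n})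
      = image_mset (\<lambda>k. (row k, h k)) (mset_set ({..<n} - X)) + image_mset (Pair (Suc a)) (image_mset h (mset_set ?Y))
        + image_mset (Pair a) (image_mset h (mset_set ?Z))" for h :: "nat \<Rightarrow> nat"
    proof -
      have "{..<n} = ({..<n} - X) \<union> (?Y \<union> ?Z)" using X rows by auto
      then have "mset_set {..<n} = mset_set (({..<n} - X) \<union> (?Y \<union> ?Z))" by (rule arg_cong)
      also have "\<dots> = mset_set ({..<n} - X) + (mset_set ?Y + mset_set ?Z)"
        using finX by (subst mset_set_Union, simp, simp, blast, subst mset_set_Union) auto
      finally have "mset_set {..<n} = mset_set ({..<n} - X) + (mset_set ?Y + mset_set ?Z)" .
      moreover have "image_mset (\<lambda>k. (row k, h k)) (mset_set ?Y) = image_mset (Pair (Suc a)) (image_mset h (mset_set ?Y))"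
        using finX by (subst multiset.map_comp) (auto intro!: image_mset_cong)
      moreover have "image_mset (\<lambda>k. (row k, h k)) (mset_set ?Z) = image_mset (Pair a) (image_mset h (mset_set ?Z))"
        using finX by (subst multiset.map_comp) (auto intro!: image_mset_cong)
      ultimately show ?thesis by simp
    qed
    have "image_mset (\<lambda>k. (row k, ?T' ! k)) (mset_set {..<n}) = image_mset (\<lambda>k. (row k, T ! \<pi> k)) (mset_set {..<n})"
      using nth by (intro image_mset_cong) auto
    also have "\<dots> = image_mset (\<lambda>k. (row k, T ! k)) (mset_set {..<n})"
    proof -
      have "image_mset (\<lambda>k. (row k, T ! \<pi> k)) (mset_set ({..<n} - X)) = image_mset (\<lambda>k. (row k, T ! k)) (mset_set ({..<n} - X))"
        using permutes_not_in[OF \<pi>] by (intro image_mset_cong) auto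
      then show ?thesis unfolding pair[of "\<lambda>k. T ! \<pi> k"] pair[of ?g] 1 2 by simp
    qed
    finally show ?thesis using mset_pairs_imp_D_eq[OF T fillings_permute[OF T \<pi>n]] by blast
  qed
qed

lemma row_weight_bound: "T \<in> fillings \<Longrightarrow> row_weight T \<le> (\<Sum>k<n. row k * m)"
  unfolding row_weight_def using filling_less[of T] by (intro sum_mono mult_le_mono2) (auto simp: less_imp_le)

lemma col_weight_bound: "T \<in> fillings \<Longrightarrow> col_weight T \<le> (\<Sum>k<n. col k * m)"
  unfolding col_weight_def using filling_less[of T] by (intro sum_mono mult_le_mono2) (auto simp: less_imp_le)

text \<open>
  An inversion in a row is removed by a row permutation, which does not change \<open>D T\<close>. A
  violation in a column is removed by the Garnir relation, which expresses a positive multiple of \<open>D T\<close> through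
  fillings of larger \<open>row_weight\<close>. Both potentials are bounded.
\<close>

lemma straightening:
  assumes "T \<in> fillings"
  shows "D T \<in> fun_vs.span (D ` ssyt)"
  using assms
proof (induction T rule: wf_induct_rule[OF wf_measures[of "[\<lambda>T. (\<Sum>k<n. row k * m) - row_weight T, \<lambda>T. (\<Sum>k<n. col k * m) - col_weight T]"]])
  case (1 T)
  have T: "T \<in> fillings" by (rule 1(2))
  have IH_row: "D T' \<in> fun_vs.span (D ` ssyt)" if "T' \<in> fillings" "row_weight T < row_weight T'" for T'
  proof -
    have "(\<Sum>k<n. row k * m) - row_weight T' < (\<Sum>k<n. row k * m) - row_weight T"
      using that(2) row_weight_bound[OF that(1)] by linarith
    then show ?thesis using 1(1)[of T'] that(1) by simp
  qed
  have IH_col: "D T' \<in> fun_vs.span (D ` ssyt)" if "T' \<in> fillings" "row_weight T = row_weight T'" "col_weight T < col_weight T'" for T'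
  proof -
    have "(\<Sum>k<n. col k * m) - col_weight T' < (\<Sum>k<n. col k * m) - col_weight T"
      using that(3) col_weight_bound[OF that(1)] by linarith
    then show ?thesis using 1(1)[of T'] that(1,2) by simp
  qed
  show ?case
  proof (cases "\<forall>k<n. \<forall>k'<n. row k = row k' \<and> col k \<le> col k' \<longrightarrow> T ! k \<le> T ! k'")
    case False
    then obtain k k' where k: "k < n" "k' < n" "row k = row k'" "col k \<le> col k'" "T ! k' < T ! k" by (auto simp: not_le)
    then have "col k \<noteq> col k'" using box_inject[of k k'] by auto
    then have lt: "col k < col k'" using k(4) by simp
    have \<sigma>: "swp k k' \<in> fibre_perms n row" by (rule transpose_fibre_perms[OF k(1-3)])
    let ?T' = "permute_list (swp k k') T"
    have T': "?T' \<in> fillings" by (rule fillings_permute[OF T fibre_permsD(1)[OF \<sigma>]])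
    have "col_weight ?T' = (\<Sum>i<n. col i * T ! (swp k k' i))"
      unfolding col_weight_def using permute_swp[OF T k(1,2)] by (intro sum.cong) auto
    then have "col_weight T < col_weight ?T'"
      unfolding col_weight_def using sum_swap_less[OF k(1,2) lt k(5)] by simp
    then have "D ?T' \<in> fun_vs.span (D ` ssyt)" by (rule IH_col[OF T' row_weight_permute_row[OF T \<sigma>, symmetric]])
    then show ?thesis unfolding D_permute_row[OF T \<sigma>] .
  next
    case True
    then have rows: "T ! k \<le> T ! k'" if "k < n" "k' < n" "row k = row k'" "col k \<le> col k'" for k k' using that by blast
    show ?thesis
    proof (cases "\<forall>k<n. \<forall>k'<n. col k = col k' \<and> row k' = Suc (row k) \<longrightarrow> T ! k < T ! k'")
      case cols: True
      have "T \<in> ssyt" unfolding ssyt_def using T True cols by blast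
      then show ?thesis by (intro fun_vs.span_base imageI)
    next
      case False
      then obtain k0 k1 where k: "k0 < n" "k1 < n" "col k0 = col k1" "row k1 = Suc (row k0)" "T ! k1 \<le> T ! k0"
        by (auto simp: not_less)
      define X where "X = {k. k < n \<and> (row k = row k0 \<and> col k0 \<le> col k \<or> row k = row k1 \<and> col k \<le> col k0)}"
      have X: "X \<subseteq> {..<n}" unfolding X_def by auto
      let ?P = "{\<pi>. \<pi> permutes X}"
      have finP: "finite ?P" using finite_permutations X finite_subset by blast
      have rel: "(\<Sum>\<pi>\<in>?P. D (permute_list \<pi> T)) = 0"
        by (rule garnir_relation[OF T X garnir_set_big[OF k(1,2,4) k(3)[symmetric] X_def]])
      have dich: "row_weight T < row_weight (permute_list \<pi> T) \<or> D (permute_list \<pi> T) = D T" if "\<pi> permutes X" for \<pi>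
      proof (rule garnir_exchange[OF T X _ _ _ that, where a = "row k0" and ?t1.0 = "T ! k1"])
        show "row x = row k0 \<or> row x = Suc (row k0)" if "x \<in> X" for x using that k(4) unfolding X_def by auto
        show "T ! x \<le> T ! k1" if "x \<in> X" "row x = Suc (row k0)" for x
          using that k rows[of x k1] unfolding X_def by auto
        show "T ! k1 \<le> T ! x" if "x \<in> X" "row x = row k0" for x
          using that k rows[of k0 x] unfolding X_def by auto
      qed
      let ?G = "{\<pi>\<in>?P. row_weight T < row_weight (permute_list \<pi> T)}"
      let ?H = "?P - ?G"
      have "(\<Sum>\<pi>\<in>?P. D (permute_list \<pi> T)) = (\<Sum>\<pi>\<in>?H. D (permute_list \<pi> T)) + (\<Sum>\<pi>\<in>?G. D (permute_list \<pi> T))"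
        by (rule sum.subset_diff[OF _ finP]) blast
      also have "(\<Sum>\<pi>\<in>?H. D (permute_list \<pi> T)) = (\<Sum>\<pi>\<in>?H. fscale 1 (D T))"
        using dich by (intro sum.cong refl) (simp only: fun_vs.scale_one, blast)
      also have "\<dots> = fscale (\<Sum>\<pi>\<in>?H. 1) (D T)" by (rule fun_vs.scale_sum_left[symmetric])
      finally have eq: "fscale (of_nat (card ?H)) (D T) + (\<Sum>\<pi>\<in>?G. D (permute_list \<pi> T)) = 0"
        unfolding rel by (simp only: sum_constant mult_1_right)
      have G: "(\<Sum>\<pi>\<in>?G. D (permute_list \<pi> T)) \<in> fun_vs.span (D ` ssyt)"
      proof (rule fun_vs.span_sum)
        fix \<pi> assume "\<pi> \<in> ?G"
        then have "\<pi> permutes {..<n}" "row_weight T < row_weight (permute_list \<pi> T)" using permutes_subset[OF _ X] by blast+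
        then show "D (permute_list \<pi> T) \<in> fun_vs.span (D ` ssyt)" by (intro IH_row fillings_permute[OF T])
      qed
      have idH: "id \<in> ?H" by (simp add: permutes_id)
      have "card ?H \<noteq> 0"
      proof
        assume "card ?H = 0"
        then have "?H = {}" by (rule card_0_eq[OF finite_Diff[OF finP], THEN iffD1])
        from equals0D[OF this] idH show False by (rule notE)
      qed
      then have nz: "(of_nat (card ?H) :: complex) \<noteq> 0" unfolding of_nat_eq_0_iff .
      have "fscale (of_nat (card ?H)) (D T) = - (\<Sum>\<pi>\<in>?G. D (permute_list \<pi> T))"
        using eq by (rule eq_neg_iff_add_eq_0[THEN iffD2])
      then have "fscale (of_nat (card ?H)) (D T) \<in> fun_vs.span (D ` ssyt)" by (rule ssubst) (rule fun_vs.span_neg[OF G])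
      then have "fscale (inverse (of_nat (card ?H))) (fscale (of_nat (card ?H)) (D T)) \<in> fun_vs.span (D ` ssyt)"
        by (rule fun_vs.span_scale)
      then show ?thesis unfolding fun_vs.scale_scale left_inverse[OF nz] fun_vs.scale_one .
    qed
  qed
qed

subsection \<open>Linear independence\<close>

lemma fillings_coord:
  assumes S: "S \<in> fillings" and T: "T \<in> fillings"
  shows "e T (map p S) = (if S = T then 1 else 0)"
proof -
  have "e T (map p S) = (\<Prod>k<n. if T ! k = S ! k then 1 else 0)"
    unfolding e_def pure_tensor_def using S T filling_less[OF S] filling_less[OF T]
    by (auto simp: fillings_def dual intro!: prod.cong)
  also have "\<dots> = (if \<forall>k<n. T ! k = S ! k then 1 else 0)"
    by (auto intro!: prod_zero)
  also have "(\<forall>k<n. T ! k = S ! k) \<longleftrightarrow> S = T" using filling_eqI[OF S T] by auto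
  finally show ?thesis .
qed

lemma ssyt_fillings: "T \<in> ssyt \<Longrightarrow> T \<in> fillings"
  by (simp add: ssyt_def)

lemma ssyt_row: "T \<in> ssyt \<Longrightarrow> k < n \<Longrightarrow> k' < n \<Longrightarrow> row k = row k' \<Longrightarrow> col k \<le> col k' \<Longrightarrow> T ! k \<le> T ! k'"
  by (simp add: ssyt_def)

lemma ssyt_col:
  assumes T: "T \<in> ssyt"
  shows "k < n \<Longrightarrow> k' < n \<Longrightarrow> col k = col k' \<Longrightarrow> row k' = Suc d + row k \<Longrightarrow> T ! k < T ! k'"
proof (induction d arbitrary: k')
  case 0
  then show ?case using T by (simp add: ssyt_def)
next
  case (Suc d)
  have r: "row k' < length lam" "col k' < lam ! row k'" using box_in[OF Suc.prems(2)] .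
  have "lam ! row k' \<le> lam ! (Suc d + row k)"
    using sorted_wrt_nth_less[OF partition, of "Suc d + row k" "row k'"] r Suc.prems by simp
  then obtain k'' where k'': "k'' < n" "row k'' = Suc d + row k" "col k'' = col k"
    using box_exists[of "Suc d + row k" "col k"] r Suc.prems by auto
  then have "T ! k < T ! k''" using Suc by simp
  also have "T ! k'' < T ! k'" using T k'' Suc.prems by (simp add: ssyt_def)
  finally show ?case .
qed

text \<open>
  Take a moved box in the highest possible row: its image and its preimage both lie
  strictly below it.
\<close>

lemma column_inversion:
  assumes \<tau>: "\<tau> \<in> fibre_perms n col" and ne: "\<tau> \<noteq> id"
  shows "\<exists>k<n. \<exists>k'<n. col k = col k' \<and> row k < row k' \<and> row (\<tau> k') < row (\<tau> k)"
proof -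
  note p\<tau> = fibre_permsD(1)[OF \<tau>]
  define Mv where "Mv = {k. k < n \<and> \<tau> k \<noteq> k}"
  have "Mv \<noteq> {}"
  proof
    assume "Mv = {}"
    then have "\<tau> k = k" for k using permutes_not_in[OF p\<tau>, of k] unfolding Mv_def by auto
    then show False using ne by (auto simp: fun_eq_iff)
  qed
  then obtain k where k: "k \<in> Mv" "\<And>l. l \<in> Mv \<Longrightarrow> row k \<le> row l"
    using ex_has_least_nat[of "\<lambda>k. k \<in> Mv" _ row] by blast
  have kn: "k < n" "\<tau> k \<noteq> k" using k(1) unfolding Mv_def by auto
  have inj: "inj \<tau>" by (rule permutes_inj[OF p\<tau>])
  have "\<tau> k \<in> Mv" unfolding Mv_def using kn fibre_permsD(3)[OF \<tau> kn(1)] inj by (auto simp: inj_eq)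
  then have 1: "row k < row (\<tau> k)"
    using k(2)[of "\<tau> k"] box_inject[of k "\<tau> k"] fibre_permsD(2,3)[OF \<tau> kn(1)] kn by (auto simp: le_less)
  let ?k' = "inv \<tau> k"
  have k': "\<tau> ?k' = k" by (rule permutes_inverses(1)[OF p\<tau>])
  have k'n: "?k' < n" using permutes_in_image[OF permutes_inv[OF p\<tau>], of k] kn by simp
  have ne': "?k' \<noteq> k" using k' kn by auto
  then have "?k' \<in> Mv" unfolding Mv_def using k' k'n by auto
  moreover have col: "col ?k' = col k" using fibre_permsD(2)[OF \<tau> k'n] k' by simp
  ultimately have 2: "row k < row ?k'" using k(2)[of ?k'] box_inject[of k ?k'] ne' k'n kn by (auto simp: le_less)
  show ?thesis using 1 2 col kn k'n k' by (intro exI[of _ k] exI[of _ ?k'] conjI) auto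
qed

text \<open>
  A column permutation with an inversion does not maximize the weight, so the identity is the
  only maximum.
\<close>

lemma row_weight_column_permute:
  assumes S: "S \<in> ssyt" and \<tau>: "\<tau> \<in> fibre_perms n col" and ne: "\<tau> \<noteq> id"
  shows "row_weight (permute_list \<tau> S) < row_weight S"
proof -
  note SF = ssyt_fillings[OF S]
  let ?C = "fibre_perms n col" and ?w = "\<lambda>\<tau>. row_weight (permute_list \<tau> S)"
  have better: "\<exists>\<tau>'\<in>?C. ?w \<tau> < ?w \<tau>'" if \<tau>: "\<tau> \<in> ?C" "\<tau> \<noteq> id" for \<tau>
  proof -
    obtain k k' where k: "k < n" "k' < n" "col k = col k'" "row k < row k'" "row (\<tau> k') < row (\<tau> k)"
      using column_inversion[OF \<tau>] by blast
    have c: "col (\<tau> k') = col (\<tau> k)" using fibre_permsD(2)[OF \<tau>(1)] k by simp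
    obtain d where "row (\<tau> k) = Suc d + row (\<tau> k')" using less_imp_Suc_add[OF k(5)] by auto
    then have S_less: "S ! (\<tau> k') < S ! (\<tau> k)"
      using ssyt_col[OF S fibre_permsD(3)[OF \<tau>(1) k(2)] fibre_permsD(3)[OF \<tau>(1) k(1)] c] by blast
    let ?s = "swp k k'"
    have s: "?s \<in> ?C" by (rule transpose_fibre_perms[OF k(1-3)])
    have \<tau>s: "\<tau> \<circ> ?s \<in> ?C" by (rule comp_fibre_perms[OF \<tau>(1) s])
    have "?w \<tau> = (\<Sum>i<n. row i * S ! (\<tau> i))"
      unfolding row_weight_def using permute_nth[OF SF fibre_permsD(1)[OF \<tau>(1)]] by (intro sum.cong) auto
    also have "\<dots> < (\<Sum>i<n. row i * S ! (\<tau> (?s i)))" by (rule sum_swap_less[OF k(1,2,4) S_less])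
    also have "\<dots> = ?w (\<tau> \<circ> ?s)"
      unfolding row_weight_def using permute_nth[OF SF fibre_permsD(1)[OF \<tau>s]] by (intro sum.cong) auto
    finally show ?thesis using \<tau>s by blast
  qed
  have fin: "finite (?w ` ?C)" using finite_fibre_perms by blast
  have "Max (?w ` ?C) \<in> ?w ` ?C" using id_fibre_perms by (intro Max_in[OF fin]) blast
  then obtain \<tau>0 where \<tau>0: "\<tau>0 \<in> ?C" "?w \<tau>0 = Max (?w ` ?C)" by auto
  have max: "?w \<tau>' \<le> ?w \<tau>0" if "\<tau>' \<in> ?C" for \<tau>' unfolding \<tau>0(2) using that by (intro Max_ge[OF fin]) blast
  have "\<tau>0 = id" using better[OF \<tau>0(1)] max by (metis not_le)
  moreover obtain \<tau>' where "\<tau>' \<in> ?C" "?w \<tau> < ?w \<tau>'" using better[OF \<tau> ne] by blast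
  ultimately show ?thesis using max[of \<tau>'] by simp
qed

text \<open>
  Row by row, both tableaux list the same multiset in increasing order.
\<close>

lemma ssyt_row_permute_eq:
  assumes S: "S \<in> ssyt" and T: "T \<in> ssyt" and \<sigma>: "\<sigma> \<in> fibre_perms n row" and eq: "permute_list \<sigma> T = S"
  shows "S = T"
proof -
  \<comment> \<open>the code of row and entry sorts the boxes row by row\<close>
  let ?l = "\<lambda>T. map (\<lambda>k. row k * m + T ! k) [0..<n]"
  have sorted: "sorted (?l T)" if T: "T \<in> ssyt" for T
  proof (unfold sorted_iff_nth_mono_less, intro allI impI)
    fix i j assume ij: "i < j" "j < length (?l T)"
    then have "row i < row j \<or> row i = row j \<and> col i < col j" by (intro box_order) auto
    then have "row i * m + T ! i \<le> row j * m + T ! j"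
    proof
      assume "row i < row j"
      then have "Suc (row i) * m \<le> row j * m" by (intro mult_le_mono1) simp
      then show ?thesis using filling_less[OF ssyt_fillings[OF T], of i] ij by simp
    qed (use ssyt_row[OF T, of i j] ij in simp)
    then show "?l T ! i \<le> ?l T ! j" using ij by simp
  qed
  have "permute_list \<sigma> (?l T) = ?l S"
  proof (rule nth_equalityI)
    fix k assume "k < length (permute_list \<sigma> (?l T))"
    then have k: "k < n" by simp
    have "permute_list \<sigma> (?l T) ! k = ?l T ! \<sigma> k" using k fibre_permsD(1)[OF \<sigma>] by (intro permute_list_nth) auto
    also have "\<dots> = row k * m + S ! k"
      using fibre_permsD(2,3)[OF \<sigma> k] permute_nth[OF ssyt_fillings[OF T] fibre_permsD(1)[OF \<sigma>] k] eq by simp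
    finally show "permute_list \<sigma> (?l T) ! k = ?l S ! k" using k by simp
  qed simp
  moreover have "mset (permute_list \<sigma> (?l T)) = mset (?l T)" using fibre_permsD(1)[OF \<sigma>] by (intro mset_permute_list) simp
  ultimately have "mset (?l S) = mset (?l T)" by (simp only:)
  then have "sort (?l T) = ?l S" by (rule properties_for_sort[OF _ sorted[OF S]])
  then have "?l S = ?l T" unfolding sorted_sort_id[OF sorted[OF T]] by (rule sym)
  then have "S ! k = T ! k" if "k < n" for k using that by simp
  then show ?thesis by (rule filling_eqI[OF ssyt_fillings[OF S] ssyt_fillings[OF T]])
qed

lemma D_coord:
  assumes S: "S \<in> fillings" and T: "T \<in> fillings"
  shows "D T (map p S) = (\<Sum>\<sigma>\<in>fibre_perms n row. \<Sum>\<tau>\<in>fibre_perms n col.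
      if permute_list \<tau> (permute_list \<sigma> T) = S then of_int (sign \<tau>) else 0)"
proof -
  have "D T (map p S) = (\<Sum>\<sigma>\<in>fibre_perms n row. col_antisymmetrizer lam (e (permute_list \<sigma> T)) (map p S))"
    unfolding D_eq[OF T] sum_apply_pointwise ..
  also have "\<dots> = (\<Sum>\<sigma>\<in>fibre_perms n row. \<Sum>\<tau>\<in>fibre_perms n col.
      if permute_list \<tau> (permute_list \<sigma> T) = S then of_int (sign \<tau>) else 0)"
  proof (rule sum.cong[OF refl])
    fix \<sigma> assume \<sigma>: "\<sigma> \<in> fibre_perms n row"
    note F = fillings_permute[OF T fibre_permsD(1)[OF \<sigma>]]
    show "col_antisymmetrizer lam (e (permute_list \<sigma> T)) (map p S)
      = (\<Sum>\<tau>\<in>fibre_perms n col. if permute_list \<tau> (permute_list \<sigma> T) = S then of_int (sign \<tau>) else 0)"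
      unfolding col_antisymmetrizer_e[OF F] sum_apply_pointwise fscale_def
      by (intro sum.cong refl) (use fillings_coord[OF S fillings_permute[OF F fibre_permsD(1)]] in auto)
  qed
  finally show ?thesis .
qed

text \<open>
  Undo the column permutation: it lowers the weight of \<open>S\<close> unless it is trivial, and then
  \<open>S\<close> is a row permutation of \<open>T\<close>. Hence the coordinates of the \<open>D T\<close> at semistandard places form a triangular matrix,
  ordered by \<open>row_weight\<close>.
\<close>

lemma ssyt_permute_cases:
  assumes S: "S \<in> ssyt" and T: "T \<in> ssyt" and \<sigma>: "\<sigma> \<in> fibre_perms n row" and \<tau>: "\<tau> \<in> fibre_perms n col"
    and eq: "permute_list \<tau> (permute_list \<sigma> T) = S"
  shows "row_weight T < row_weight S \<or> S = T \<and> \<tau> = id"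
proof -
  note SF = ssyt_fillings[OF S] and TF = ssyt_fillings[OF T]
  note F = fillings_permute[OF TF fibre_permsD(1)[OF \<sigma>]]
  note \<tau>' = inv_fibre_perms[OF \<tau>]
  have "permute_list (inv \<tau>) S = permute_list (\<tau> \<circ> inv \<tau>) (permute_list \<sigma> T)"
    unfolding eq[symmetric] by (rule permute_comp[OF F fibre_permsD(1)[OF \<tau>']])
  also have "\<tau> \<circ> inv \<tau> = id" by (rule permutes_inv_o(1)[OF fibre_permsD(1)[OF \<tau>]])
  finally have eq': "permute_list (inv \<tau>) S = permute_list \<sigma> T" by simp
  show ?thesis
  proof (cases "inv \<tau> = id")
    case False
    have "row_weight T = row_weight (permute_list (inv \<tau>) S)" unfolding eq' row_weight_permute_row[OF TF \<sigma>] ..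
    also have "\<dots> < row_weight S" by (rule row_weight_column_permute[OF S \<tau>' False])
    finally show ?thesis by simp
  next
    case True
    then have "permute_list \<sigma> T = S" using eq' by simp
    then have "S = T" by (rule ssyt_row_permute_eq[OF S T \<sigma>])
    moreover have "\<tau> = id" using True permutes_inv_inv[OF fibre_permsD(1)[OF \<tau>]] by (metis inv_id)
    ultimately show ?thesis by simp
  qed
qed

lemma D_coord_triangular:
  assumes S: "S \<in> ssyt" and T: "T \<in> ssyt" and nz: "D T (map p S) \<noteq> 0"
  shows "S = T \<or> row_weight T < row_weight S"
proof (rule ccontr)
  assume neg: "\<not> (S = T \<or> row_weight T < row_weight S)"
  have "D T (map p S) = 0"
    unfolding D_coord[OF ssyt_fillings[OF S] ssyt_fillings[OF T]]
    using ssyt_permute_cases[OF S T] neg by (intro sum.neutral ballI) auto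
  then show False using nz by simp
qed

text \<open>
  Only the identity of the column group contributes, so no signs occur and the coordinate
  counts the row permutations that fix \<open>T\<close>.
\<close>

lemma D_coord_diag:
  assumes T: "T \<in> ssyt" shows "D T (map p T) \<noteq> 0"
proof -
  let ?R = "fibre_perms n row"
  have "D T (map p T) = (\<Sum>\<sigma>\<in>?R. if permute_list \<sigma> T = T then 1 else 0)"
    unfolding D_coord[OF ssyt_fillings[OF T] ssyt_fillings[OF T]]
  proof (rule sum.cong[OF refl])
    fix \<sigma> assume \<sigma>: "\<sigma> \<in> ?R"
    have "(\<Sum>\<tau>\<in>fibre_perms n col. if permute_list \<tau> (permute_list \<sigma> T) = T then of_int (sign \<tau>) else 0)
      = (\<Sum>\<tau>\<in>fibre_perms n col. if \<tau> = id then (if permute_list \<sigma> T = T then 1 else 0) else 0 :: complex)"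
    proof (intro sum.cong refl)
      fix \<tau> assume \<tau>: "\<tau> \<in> fibre_perms n col"
      show "(if permute_list \<tau> (permute_list \<sigma> T) = T then of_int (sign \<tau>) else 0)
        = (if \<tau> = id then (if permute_list \<sigma> T = T then 1 else 0) else 0 :: complex)"
        using ssyt_permute_cases[OF T T \<sigma> \<tau>] by (cases "\<tau> = id") (auto simp: sign_id)
    qed
    then show "(\<Sum>\<tau>\<in>fibre_perms n col. if permute_list \<tau> (permute_list \<sigma> T) = T then of_int (sign \<tau>) else 0)
      = (if permute_list \<sigma> T = T then 1 else 0 :: complex)"
      using finite_fibre_perms id_fibre_perms by (simp add: sum.delta)
  qed
  also have "\<dots> = of_nat (card {\<sigma>\<in>?R. permute_list \<sigma> T = T})"
    using finite_fibre_perms by (simp add: sum.If_cases Int_def)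
  also have "\<dots> \<noteq> 0"
    using finite_fibre_perms[of n row] id_fibre_perms[of n row] by (auto simp: card_eq_0_iff)
  finally show ?thesis .
qed

lemma finite_ssyt: "finite ssyt"
  using finite_fillings by (rule finite_subset[rotated]) (auto simp: ssyt_def)

lemma ssyt_independent:
  assumes zero: "(\<Sum>T\<in>ssyt. fscale (c T) (D T)) = 0" and S: "S \<in> ssyt"
  shows "c S = 0"
proof (rule ccontr)
  assume "c S \<noteq> 0"
  then obtain T0 where T0: "T0 \<in> ssyt" "c T0 \<noteq> 0" and min: "\<And>T. T \<in> ssyt \<Longrightarrow> c T \<noteq> 0 \<Longrightarrow> row_weight T0 \<le> row_weight T"
    using ex_has_least_nat[of "\<lambda>T. T \<in> ssyt \<and> c T \<noteq> 0" S row_weight] S by blast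
  have "0 = (\<Sum>T\<in>ssyt. c T * D T (map p T0))"
    using fun_cong[OF zero, of "map p T0"] unfolding sum_apply_pointwise fscale_def by simp
  also have "\<dots> = (\<Sum>T\<in>ssyt. if T = T0 then c T0 * D T0 (map p T0) else 0)"
  proof (intro sum.cong refl)
    fix T assume T: "T \<in> ssyt"
    show "c T * D T (map p T0) = (if T = T0 then c T0 * D T0 (map p T0) else 0)"
      using D_coord_triangular[OF T0(1) T] min[OF T] by force
  qed
  also have "\<dots> = c T0 * D T0 (map p T0)" using finite_ssyt T0(1) by simp
  finally show False using T0 D_coord_diag[OF T0(1)] by simp
qed

lemma tensor_expansion:
  assumes t: "t \<in> tensor_power n (fun_vs.span (E ` {..<m}))"
  shows "t = (\<Sum>T\<in>fillings. fscale (t (map p T)) (e T))"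
proof (rule tensor_power_eqI[where F = "\<lambda>t. t", OF _ _ _ t])
  show "linear_on (tensor_power n (fun_vs.span (E ` {..<m}))) (\<lambda>t. t)" by (simp add: linear_on_def)
  show "linear_on (tensor_power n (fun_vs.span (E ` {..<m}))) (\<lambda>t. \<Sum>T\<in>fillings. fscale (t (map p T)) (e T))"
    unfolding linear_on_def
  proof (intro conjI ballI allI)
    fix x y :: "'a list \<Rightarrow> complex"
    have "fscale ((x + y) (map p T)) (e T) = fscale (x (map p T)) (e T) + fscale (y (map p T)) (e T)" for T
      by (rule ext) (simp add: fscale_def algebra_simps)
    then show "(\<Sum>T\<in>fillings. fscale ((x + y) (map p T)) (e T)) = (\<Sum>T\<in>fillings. fscale (x (map p T)) (e T)) + (\<Sum>T\<in>fillings. fscale (y (map p T)) (e T))"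
      by (simp only: sum.distrib)
  next
    fix c and x :: "'a list \<Rightarrow> complex"
    have "(\<Sum>T\<in>fillings. fscale (fscale c x (map p T)) (e T)) = (\<Sum>T\<in>fillings. fscale c (fscale (x (map p T)) (e T)))"
      unfolding fun_vs.scale_scale by (simp only: fscale_def)
    also have "\<dots> = fscale c (\<Sum>T\<in>fillings. fscale (x (map p T)) (e T))" by (rule fun_vs.scale_sum_right[symmetric])
    finally show "(\<Sum>T\<in>fillings. fscale (fscale c x (map p T)) (e T)) = fscale c (\<Sum>T\<in>fillings. fscale (x (map p T)) (e T))" .
  qed
  have W: "v x = (\<Sum>j<m. v (p j) * E j x)" if "v \<in> fun_vs.span (E ` {..<m})" for v x
    using that
  proof (induction rule: fun_vs.span_induct_alt)
    case base show ?case by simp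
  next
    case (step c w v)
    then obtain i where i: "i < m" "w = E i" by blast
    have "(\<Sum>j<m. w (p j) * E j x) = (\<Sum>j<m. if j = i then E i x else 0)"
      unfolding i(2) using i(1) by (intro sum.cong) (auto simp: dual)
    then have "(\<Sum>j<m. w (p j) * E j x) = w x" using i by simp
    then have "c * w x = (\<Sum>j<m. c * (w (p j) * E j x))" by (simp add: sum_distrib_left[symmetric])
    then show ?case using step.IH by (simp add: fscale_def sum.distrib algebra_simps)
  qed
  fix vs :: "('a \<Rightarrow> complex) list"
  assume vs: "length vs = n" "set vs \<subseteq> fun_vs.span (E ` {..<m})"
  show "pure_tensor vs = (\<Sum>T\<in>fillings. fscale (pure_tensor vs (map p T)) (e T))"
  proof
    fix l
    have "(\<Sum>T\<in>fillings. fscale (pure_tensor vs (map p T)) (e T)) l = (\<Sum>T\<in>fillings. pure_tensor vs (map p T) * e T l)"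
      unfolding sum_apply_pointwise fscale_def ..
    also have "\<dots> = pure_tensor vs l"
    proof (cases "length l = n")
      case True
      have "pure_tensor vs l = (\<Prod>k<n. \<Sum>j<m. (vs ! k) (p j) * E j (l ! k))"
        unfolding pure_tensor_def using vs True W[of "vs ! _" "l ! _"] by (auto intro!: prod.cong simp: subset_iff)
      also have "\<dots> = (\<Sum>T\<in>fillings. \<Prod>k<n. (vs ! k) (p (T ! k)) * E (T ! k) (l ! k))"
        unfolding fillings_def by (rule prod_sum_lists) simp
      also have "\<dots> = (\<Sum>T\<in>fillings. pure_tensor vs (map p T) * e T l)"
        using vs True by (intro sum.cong) (auto simp: pure_tensor_def e_def fillings_def prod.distrib)
      finally show ?thesis by simp
    next
      case False
      then show ?thesis using vs by (auto simp: pure_tensor_def e_def fillings_def intro!: sum.neutral)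
    qed
    finally show "pure_tensor vs l = (\<Sum>T\<in>fillings. fscale (pure_tensor vs (map p T)) (e T)) l" by simp
  qed
qed

theorem young_image_span:
  "young_symmetrizer lam ` tensor_power n (fun_vs.span (E ` {..<m})) = fun_vs.span (D ` ssyt)"
proof (intro equalityI subsetI)
  fix x assume "x \<in> young_symmetrizer lam ` tensor_power n (fun_vs.span (E ` {..<m}))"
  then obtain t where t: "t \<in> tensor_power n (fun_vs.span (E ` {..<m}))" "x = young_symmetrizer lam t" by blast
  have "x = young_symmetrizer lam (\<Sum>T\<in>fillings. fscale (t (map p T)) (e T))"
    unfolding t(2) by (rule arg_cong[OF tensor_expansion[OF t(1)]])
  also have "\<dots> = (\<Sum>T\<in>fillings. fscale (t (map p T)) (D T))"
    unfolding young_symmetrizer_sum young_symmetrizer_scale D_def ..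
  also have "\<dots> \<in> fun_vs.span (D ` ssyt)"
    by (intro fun_vs.span_sum fun_vs.span_scale straightening)
  finally show "x \<in> fun_vs.span (D ` ssyt)" .
next
  fix x assume "x \<in> fun_vs.span (D ` ssyt)"
  then show "x \<in> young_symmetrizer lam ` tensor_power n (fun_vs.span (E ` {..<m}))"
  proof (induction rule: fun_vs.span_induct_alt)
    case base
    have "young_symmetrizer lam (fscale 0 0) = (0 :: 'a list \<Rightarrow> complex)"
      unfolding young_symmetrizer_scale by (rule fun_vs.scale_zero_left)
    then have "young_symmetrizer lam 0 = (0 :: 'a list \<Rightarrow> complex)" by (simp only: fun_vs.scale_zero_left)
    then show ?case by (rule image_eqI[OF sym fun_vs.subspace_0[OF tensor_power_subspace]])
  next
    case (step c d y)
    from step.hyps obtain T where T: "T \<in> ssyt" "d = D T" by blast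
    from step.IH obtain t where t: "t \<in> tensor_power n (fun_vs.span (E ` {..<m}))" "y = young_symmetrizer lam t" by blast
    have "e T \<in> tensor_power n (fun_vs.span (E ` {..<m}))"
      unfolding e_def using ssyt_fillings[OF T(1)] by (intro pure_tensor_in) (auto simp: fillings_def intro!: fun_vs.span_base)
    then have "fscale c (e T) + t \<in> tensor_power n (fun_vs.span (E ` {..<m}))"
      using t(1) by (intro fun_vs.subspace_add[OF tensor_power_subspace] fun_vs.subspace_scale[OF tensor_power_subspace])
    moreover have "fscale c d + y = young_symmetrizer lam (fscale c (e T) + t)"
      unfolding young_symmetrizer_add young_symmetrizer_scale T(2) t(2) D_def ..
    ultimately show ?case by blast
  qed
qed

end

section \<open>Vandermonde determinants\<close>

definition vandermonde :: "nat \<Rightarrow> (nat \<Rightarrow> 'a::comm_ring_1) \<Rightarrow> 'a" where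
  "vandermonde m y = (\<Prod>i<m. \<Prod>j<i. y i - y j)"

lemma vandermonde_Suc:
  "vandermonde (Suc m) y = (\<Prod>i<m. y (Suc i) - y 0) * vandermonde m (\<lambda>i. y (Suc i))"
proof -
  have "vandermonde (Suc m) y = (\<Prod>i<m. \<Prod>j<Suc i. y (Suc i) - y j)"
    unfolding vandermonde_def by (simp add: prod.lessThan_Suc_shift del: prod.lessThan_Suc)
  also have "\<dots> = (\<Prod>i<m. (y (Suc i) - y 0) * (\<Prod>j<i. y (Suc i) - y (Suc j)))"
    by (simp add: prod.lessThan_Suc_shift del: prod.lessThan_Suc)
  finally show ?thesis by (simp add: vandermonde_def prod.distrib)
qed

lemma det_first_column_unit:
  fixes f :: "nat \<Rightarrow> nat \<Rightarrow> 'a::comm_ring_1"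
  assumes "f 0 0 = 1" "\<And>i. 0 < i \<Longrightarrow> i < Suc m \<Longrightarrow> f i 0 = 0"
  shows "Determinant.det (mat (Suc m) (Suc m) (\<lambda>(i,j). f i j))
    = Determinant.det (mat m m (\<lambda>(i,j). f (Suc i) (Suc j)))"
proof -
  let ?A = "mat (Suc m) (Suc m) (\<lambda>(i,j). f i j)"
  have "Determinant.det ?A = (\<Sum>i<Suc m. ?A $$ (i,0) * cofactor ?A i 0)"
    by (rule laplace_expansion_column[where n = "Suc m"]) auto
  also have "\<dots> = cofactor ?A 0 0"
    using assms by (simp add: sum.lessThan_Suc_shift del: sum.lessThan_Suc)
  also have "\<dots> = Determinant.det (mat m m (\<lambda>(i,j). f (Suc i) (Suc j)))"
    unfolding cofactor_def mat_delete_def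
    by (simp, intro arg_cong[of _ _ Determinant.det] eq_matI) auto
  finally show ?thesis .
qed

lemma det_row_differences:
  fixes f :: "nat \<Rightarrow> nat \<Rightarrow> 'a::comm_ring_1"
  shows "Determinant.det (mat m m (\<lambda>(i,j). f i j))
    = Determinant.det (mat m m (\<lambda>(i,j). if i = 0 then f 0 j else f i j - c i * f (i - 1) j))"
proof -
  let ?A = "mat m m (\<lambda>(i,j). f i j)"
  let ?L = "mat m m (\<lambda>(i,j). if j = i then 1 else if i = Suc j then - c i else 0)"
  have "Determinant.det ?L = prod_list (diag_mat ?L)"
    by (rule det_lower_triangular[where n = m]) auto
  also have "diag_mat ?L = replicate m 1"
    by (auto simp: diag_mat_def intro!: nth_equalityI)
  finally have detL: "Determinant.det ?L = 1" by (simp add: prod_list_replicate)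
  have "?L * ?A = mat m m (\<lambda>(i,j). if i = 0 then f 0 j else f i j - c i * f (i - 1) j)"
  proof (rule eq_matI)
    fix i j assume "i < dim_row (mat m m (\<lambda>(i,j). if i = 0 then f 0 j else f i j - c i * f (i - 1) j))"
      "j < dim_col (mat m m (\<lambda>(i,j). if i = 0 then f 0 j else f i j - c i * f (i - 1) j))"
    then have ij: "i < m" "j < m" by auto
    have "(?L * ?A) $$ (i,j) = (\<Sum>k\<in>{0..<m}. (if k = i then 1 else if i = Suc k then - c i else 0) * f k j)"
      using ij by (auto simp: scalar_prod_def intro!: sum.cong)
    also have "\<dots> = (\<Sum>k\<in>{0..<m}. (if k = i then f i j else 0) + (if k = i - 1 \<and> i \<noteq> 0 then - c i * f (i-1) j else 0))"
      by (intro sum.cong) auto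
    also have "\<dots> = f i j + (if i = 0 then 0 else - c i * f (i-1) j)"
      using ij by (cases "i = 0") (auto simp: sum.distrib)
    finally show "(?L * ?A) $$ (i,j) = mat m m (\<lambda>(i,j). if i = 0 then f 0 j else f i j - c i * f (i - 1) j) $$ (i,j)"
      using ij by auto
  qed auto
  moreover have "Determinant.det (?L * ?A) = Determinant.det ?L * Determinant.det ?A"
    by (rule det_mult[where n = m]) auto
  ultimately show ?thesis using detL by simp
qed

lemma det_transpose_fun:
  fixes f :: "nat \<Rightarrow> nat \<Rightarrow> 'a::comm_ring_1"
  shows "Determinant.det (mat m m (\<lambda>(i,j). f i j)) = Determinant.det (mat m m (\<lambda>(i,j). f j i))"
proof -
  have "transpose_mat (mat m m (\<lambda>(i,j). f i j)) = mat m m (\<lambda>(i,j). f j i)"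
    by (auto intro!: eq_matI)
  then show ?thesis
    using Determinant.det_transpose[of "mat m m (\<lambda>(i,j). f i j)" m] by simp
qed

lemma det_vandermonde:
  fixes y :: "nat \<Rightarrow> 'a::comm_ring_1"
  shows "Determinant.det (mat m m (\<lambda>(i,j). y i ^ j)) = vandermonde m y"
proof (induction m arbitrary: y)
  case 0
  then show ?case by (simp add: vandermonde_def)
next
  case (Suc m)
  have "Determinant.det (mat (Suc m) (Suc m) (\<lambda>(i,j). y i ^ j))
      = Determinant.det (mat (Suc m) (Suc m) (\<lambda>(i,j). y j ^ i))"
    by (rule det_transpose_fun)
  also have "\<dots> = Determinant.det (mat (Suc m) (Suc m)
      (\<lambda>(i,j). if i = 0 then y j ^ 0 else y j ^ i - y 0 * y j ^ (i - 1)))"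
    by (subst det_row_differences[where c = "\<lambda>_. y 0"]) simp
  also have "\<dots> = Determinant.det (mat m m
      (\<lambda>(i,j). if Suc i = 0 then y (Suc j) ^ 0 else y (Suc j) ^ Suc i - y 0 * y (Suc j) ^ (Suc i - 1)))"
    by (rule det_first_column_unit) (auto simp flip: power_Suc)
  also have "\<dots> = Determinant.det (mat m m (\<lambda>(i,j). (y (Suc j) - y 0) * y (Suc j) ^ i))"
    by (simp add: algebra_simps)
  also have "\<dots> = Determinant.det (mat m m (\<lambda>(i,j). (y (Suc i) - y 0) * y (Suc i) ^ j))"
    by (rule det_transpose_fun)
  also have "\<dots> = (\<Prod>i<m. y (Suc i) - y 0) * Determinant.det (mat m m (\<lambda>(i,j). y (Suc i) ^ j))"
    by (subst (1 2) det_def'[where n = m])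
       (auto simp: sum_distrib_left prod.distrib lessThan_atLeast0 mult_ac intro!: sum.cong prod.cong)
  finally show ?case by (simp add: Suc vandermonde_Suc)
qed

text \<open>
  Subtracting from each row of the Vandermonde matrix its predecessor clears the first
  column below its first entry. The remaining entries \<open>y\<^sub>i\<^sub>+\<^sub>1\<^sup>j\<^sup>+\<^sup>1 - y\<^sub>i\<^sup>j\<^sup>+\<^sup>1\<close> are, for powers of \<open>q\<close>, geometric sums over the
  interval between two consecutive exponents.
\<close>

lemma vandermonde_differences:
  fixes y :: "nat \<Rightarrow> 'a::comm_ring_1"
  shows "vandermonde (Suc m) y
    = Determinant.det (mat m m (\<lambda>(i,j). y (Suc i) ^ Suc j - y i ^ Suc j))"
proof -
  have "vandermonde (Suc m) y = Determinant.det (mat (Suc m) (Suc m) (\<lambda>(i,j). y i ^ j))"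
    by (simp only: det_vandermonde)
  also have "\<dots> = Determinant.det (mat (Suc m) (Suc m)
      (\<lambda>(i,j). if i = 0 then y 0 ^ j else y i ^ j - 1 * y (i - 1) ^ j))"
    by (rule det_row_differences[where c = "\<lambda>_. 1"])
  also have "\<dots> = Determinant.det (mat m m
      (\<lambda>(i,j). if Suc i = 0 then y 0 ^ Suc j else y (Suc i) ^ Suc j - 1 * y (Suc i - 1) ^ Suc j))"
    by (rule det_first_column_unit) auto
  finally show ?thesis by simp
qed

lemma sum_power_interval:
  fixes r :: real assumes "a \<le> b" "r \<noteq> 1"
  shows "(\<Sum>c\<in>{a..<b}. r ^ c) = (r ^ b - r ^ a) / (r - 1)"
  using assms(1)
proof (induction b rule: dec_induct)
  case base show ?case by simp
next
  case (step n) then show ?case using assms(2) by (simp add: field_simps)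
qed

text \<open>
  The determinant is multilinear in its rows, so the sum over independent intervals can be
  taken row by row. Each entry becomes a geometric sum whose denominator depends on the column only.
\<close>

lemma sum_vandermonde_interlacing:
  fixes q :: real
  assumes q: "1 < q" and b: "\<And>k. k < m \<Longrightarrow> b k \<le> b (Suc k)"
  shows "(\<Sum>c\<in>PiE {..<m} (\<lambda>k. {b k..<b (Suc k)}). (\<Prod>k<m. q ^ c k) * vandermonde m (\<lambda>k. q ^ c k))
    = vandermonde (Suc m) (\<lambda>k. q ^ b k) / (\<Prod>j<m. q ^ Suc j - 1)"
proof -
  let ?P = "{p. p permutes {0..<m}}" and ?C = "PiE {..<m} (\<lambda>k. {b k..<b (Suc k)})"
  have qq: "q ^ Suc j \<noteq> 1" for j using one_less_power[OF q, of "Suc j"] by simp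
  have "(\<Sum>c\<in>?C. (\<Prod>k<m. q ^ c k) * vandermonde m (\<lambda>k. q ^ c k))
    = (\<Sum>c\<in>?C. (\<Sum>p\<in>?P. signof p * (\<Prod>k<m. (q ^ Suc (p k)) ^ c k)))"
  proof (rule sum.cong)
    fix c assume "c \<in> ?C"
    have "vandermonde m (\<lambda>k. q ^ c k) = (\<Sum>p\<in>?P. signof p * (\<Prod>k<m. (q ^ c k) ^ p k))"
      by (subst det_vandermonde[symmetric], subst det_def'[where n = m])
         (auto simp: lessThan_atLeast0 intro!: sum.cong prod.cong)
    then show "(\<Prod>k<m. q ^ c k) * vandermonde m (\<lambda>k. q ^ c k)
      = (\<Sum>p\<in>?P. signof p * (\<Prod>k<m. (q ^ Suc (p k)) ^ c k))"
      by (simp add: sum_distrib_left prod.distrib power_mult_distrib mult_ac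
           flip: power_mult)
  qed simp
  also have "\<dots> = (\<Sum>p\<in>?P. signof p * (\<Sum>c\<in>?C. (\<Prod>k<m. (q ^ Suc (p k)) ^ c k)))"
    by (subst sum.swap) (simp add: sum_distrib_left)
  also have "\<dots> = (\<Sum>p\<in>?P. signof p * (\<Prod>k<m. \<Sum>c\<in>{b k..<b (Suc k)}. (q ^ Suc (p k)) ^ c))"
    by (subst prod_sum_PiE) auto
  also have "\<dots> = (\<Sum>p\<in>?P. signof p * (\<Prod>k<m. ((q ^ b (Suc k)) ^ Suc (p k) - (q ^ b k) ^ Suc (p k))) / (\<Prod>j<m. q ^ Suc j - 1))"
  proof (rule sum.cong)
    fix p assume p: "p \<in> ?P"
    have "(\<Prod>k<m. \<Sum>c\<in>{b k..<b (Suc k)}. (q ^ Suc (p k)) ^ c)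
      = (\<Prod>k<m. ((q ^ b (Suc k)) ^ Suc (p k) - (q ^ b k) ^ Suc (p k)) / (q ^ Suc (p k) - 1))"
      using b qq by (intro prod.cong refl, subst sum_power_interval)
        (auto simp: mult.commute simp flip: power_mult power_Suc)
    also have "\<dots> = (\<Prod>k<m. ((q ^ b (Suc k)) ^ Suc (p k) - (q ^ b k) ^ Suc (p k))) / (\<Prod>k<m. q ^ Suc (p k) - 1)"
      by (rule prod_dividef)
    also have "(\<Prod>k<m. q ^ Suc (p k) - 1) = (\<Prod>j<m. q ^ Suc j - 1)"
      using p prod.permute[of p "{..<m}" "\<lambda>j. q ^ Suc j - 1"] by (auto simp: lessThan_atLeast0 o_def)
    finally show "signof p * (\<Prod>k<m. \<Sum>c\<in>{b k..<b (Suc k)}. (q ^ Suc (p k)) ^ c)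
      = signof p * (\<Prod>k<m. ((q ^ b (Suc k)) ^ Suc (p k) - (q ^ b k) ^ Suc (p k))) / (\<Prod>j<m. q ^ Suc j - 1)"
      by simp
  qed simp
  also have "\<dots> = vandermonde (Suc m) (\<lambda>k. q ^ b k) / (\<Prod>j<m. q ^ Suc j - 1)"
    by (subst vandermonde_differences, subst det_def'[where n = m])
       (auto simp: lessThan_atLeast0 sum_divide_distrib intro!: sum.cong prod.cong)
  finally show ?thesis .
qed

section \<open>The principal specialization of a Schur function\<close>

text \<open>
  Tableaux as functions of row and column, for a shape given by its row lengths. The
  value zero outside the shape makes the representation unique.
\<close>

definition ssyt_fun :: "nat \<Rightarrow> (nat \<Rightarrow> nat) \<Rightarrow> (nat \<Rightarrow> nat \<Rightarrow> nat) set" where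
  "ssyt_fun m la = {T. (\<forall>i j. la i \<le> j \<longrightarrow> T i j = 0) \<and> (\<forall>i j. j < la i \<longrightarrow> T i j < m) \<and>
     (\<forall>i j j'. j \<le> j' \<longrightarrow> j' < la i \<longrightarrow> T i j \<le> T i j') \<and>
     (\<forall>i j. j < la (Suc i) \<longrightarrow> T i j < T (Suc i) j)}"

text \<open>
  The Schur function of shape \<open>la\<close> at \<open>x\<^sub>j = q\<^sup>m\<^sup>-\<^sup>1\<^sup>-\<^sup>j\<close>. In this order the largest letter
  has weight one, which suits the recursion that deletes it.
\<close>

definition ssyt_gf :: "real \<Rightarrow> nat \<Rightarrow> (nat \<Rightarrow> nat) \<Rightarrow> real" where
  "ssyt_gf q m la = (\<Sum>T\<in>ssyt_fun m la. \<Prod>i<m. \<Prod>j<la i. q ^ (m - 1 - T i j))"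

definition interlacing :: "nat \<Rightarrow> (nat \<Rightarrow> nat) \<Rightarrow> (nat \<Rightarrow> nat) set" where
  "interlacing m la = {mu. (\<forall>i<m. la (Suc i) \<le> mu i \<and> mu i \<le> la i) \<and> (\<forall>i\<ge>m. mu i = 0)}"

lemma ssyt_funD:
  assumes "T \<in> ssyt_fun m la"
  shows "la i \<le> j \<Longrightarrow> T i j = 0" "j < la i \<Longrightarrow> T i j < m"
    "j \<le> j' \<Longrightarrow> j' < la i \<Longrightarrow> T i j \<le> T i j'" "j < la (Suc i) \<Longrightarrow> T i j < T (Suc i) j"
  using assms by (auto simp: ssyt_fun_def)

text \<open>
  Columns increase strictly from the top, so a shape with more rows than letters has no tableau.
\<close>

lemma ssyt_fun_row_le:
  assumes T: "T \<in> ssyt_fun m la" and la: "antimono la"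
  shows "j < la i \<Longrightarrow> i \<le> T i j"
proof (induction i)
  case (Suc i)
  then show ?case
    using ssyt_funD(4)[OF T] antimonoD[OF la, of i "Suc i"] by fastforce
qed simp

lemma down_closed_nat_eq_lessThan:
  fixes D :: "nat set"
  assumes fin: "finite D" and down: "\<And>i j. j \<in> D \<Longrightarrow> i \<le> j \<Longrightarrow> i \<in> D"
  shows "D = {..<card D}"
proof (cases "D = {}")
  case False
  have "{..Max D} \<subseteq> D" using down[OF Max_in[OF fin False]] by auto
  then have "D = {..Max D}" using fin by auto
  then show ?thesis by (metis card_atMost lessThan_Suc_atMost)
qed simp

definition shrink_shape :: "nat \<Rightarrow> (nat \<Rightarrow> nat) \<Rightarrow> (nat \<Rightarrow> nat \<Rightarrow> nat) \<Rightarrow> nat \<Rightarrow> nat" where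
  "shrink_shape m la T i = card {j. j < la i \<and> T i j < m}"

lemma shrink_shape_iff:
  assumes T: "T \<in> ssyt_fun (Suc m) la"
  shows "j < shrink_shape m la T i \<longleftrightarrow> j < la i \<and> T i j < m"
proof -
  have "{j. j < la i \<and> T i j < m} = {..<card {j. j < la i \<and> T i j < m}}"
    using ssyt_funD(3)[OF T] by (intro down_closed_nat_eq_lessThan) (auto intro: le_less_trans)
  then show ?thesis unfolding shrink_shape_def by blast
qed

lemma shrink_shape_interlacing:
  assumes T: "T \<in> ssyt_fun (Suc m) la" and la: "antimono la"
  shows "shrink_shape m la T \<in> interlacing m la"
  unfolding interlacing_def
proof (intro CollectI conjI allI impI)
  fix i
  show "la (Suc i) \<le> shrink_shape m la T i"
  proof (rule ccontr)
    assume "\<not> la (Suc i) \<le> shrink_shape m la T i"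
    then obtain j where j: "j < la (Suc i)" "\<not> j < shrink_shape m la T i"
      by (metis less_irrefl not_le)
    have "T i j < m" using ssyt_funD(2,4)[OF T, OF j(1)] by simp
    moreover have "j < la i" using j antimonoD[OF la, of i "Suc i"] by simp
    ultimately show False using j shrink_shape_iff[OF T] by blast
  qed
  show "shrink_shape m la T i \<le> la i"
    using shrink_shape_iff[OF T, of "la i" i] by (simp add: not_less)
next
  fix i assume "m \<le> i"
  then show "shrink_shape m la T i = 0"
    using ssyt_fun_row_le[OF T la] unfolding shrink_shape_def
    by (auto simp: card_eq_0_iff) (metis le_trans linorder_not_le)
qed

lemma finite_interlacing: "finite (interlacing m la)"
proof -
  have "mu i \<le> sum la {..<m}" if "mu \<in> interlacing m la" "i < m" for mu i
    using that member_le_sum[of i "{..<m}" la] by (fastforce simp: interlacing_def)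
  then have "interlacing m la \<subseteq> {mu. \<forall>i. (i \<in> {..<m} \<longrightarrow> mu i \<in> {..sum la {..<m}}) \<and> (i \<notin> {..<m} \<longrightarrow> mu i = 0)}"
    by (auto simp: interlacing_def)
  then show ?thesis by (rule finite_subset) (intro finite_set_of_finite_funs, auto)
qed

lemma ssyt_fun_0: "(\<And>i. la i = 0) \<Longrightarrow> ssyt_fun m la = {\<lambda>_ _. 0}"
  by (auto simp: ssyt_fun_def fun_eq_iff)

lemma finite_ssyt_fun:
  assumes "\<And>i. m \<le> i \<Longrightarrow> la i = 0"
  shows "finite (ssyt_fun m la)"
proof -
  let ?S = "{f. \<forall>x. (x \<in> Sigma {..<m} (\<lambda>i. {..<la i}) \<longrightarrow> f x \<in> {..<m}) \<and> (x \<notin> Sigma {..<m} (\<lambda>i. {..<la i}) \<longrightarrow> f x = 0)}"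
  have "finite ?S" by (rule finite_set_of_finite_funs) auto
  moreover have "ssyt_fun m la \<subseteq> curry ` ?S"
  proof
    fix T assume T: "T \<in> ssyt_fun m la"
    have "case_prod T \<in> ?S"
      using ssyt_funD(1,2)[OF T] assms by (auto simp: not_less)
    then show "T \<in> curry ` ?S" by (metis (no_types, lifting) curry_case_prod image_eqI)
  qed
  ultimately show ?thesis using finite_subset by blast
qed

lemma interlacing_antimono:
  assumes "mu \<in> interlacing m la" "antimono la"
  shows "antimono mu"
proof (rule decseq_SucI)
  fix i show "mu (Suc i) \<le> mu i"
    using assms(1) unfolding interlacing_def
    by (cases "Suc i < m") (auto dest: spec[of _ i] spec[of _ "Suc i"] intro: order_trans)
qed

text \<open>
  Deleting the boxes with the largest entry leaves a tableau on one letter less, whose shape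
  interlaces with the original one.
\<close>

lemma ssyt_gf_Suc:
  assumes la: "antimono la" and la0: "\<And>i. Suc m \<le> i \<Longrightarrow> la i = 0"
  shows "ssyt_gf q (Suc m) la = (\<Sum>mu\<in>interlacing m la. (\<Prod>i<m. q ^ mu i) * ssyt_gf q m mu)"
proof -
  let ?S = "Sigma (interlacing m la) (ssyt_fun m)"
  let ?cut = "\<lambda>T. (shrink_shape m la T, \<lambda>i j. if j < shrink_shape m la T i then T i j else 0)"
  let ?ext = "\<lambda>(mu, T'). (\<lambda>i j. if j < mu i then T' i j else if j < la i then m else 0)"
  have mu_le: "mu i \<le> la i" if "mu \<in> interlacing m la" for mu i
    using that by (cases "i < m") (auto simp: interlacing_def)
  have mu_ge: "la (Suc i) \<le> mu i" if "mu \<in> interlacing m la" for mu i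
    using that la0[of "Suc i"] by (cases "i < m") (auto simp: interlacing_def)
  have "(\<Sum>mu\<in>interlacing m la. (\<Prod>i<m. q ^ mu i) * ssyt_gf q m mu)
    = (\<Sum>(mu,T')\<in>?S. (\<Prod>i<m. q ^ mu i) * (\<Prod>i<m. \<Prod>j<mu i. q ^ (m - 1 - T' i j)))"
    unfolding ssyt_gf_def sum_distrib_left
    by (subst sum.Sigma, rule finite_interlacing) (auto intro!: finite_ssyt_fun simp: interlacing_def)
  also have "\<dots> = (\<Sum>T\<in>ssyt_fun (Suc m) la. \<Prod>i<Suc m. \<Prod>j<la i. q ^ (Suc m - 1 - T i j))"
  proof (rule sum.reindex_bij_witness[where i = ?cut and j = ?ext])
    fix T assume T: "T \<in> ssyt_fun (Suc m) la"
    let ?mu = "shrink_shape m la T"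
    note mu = shrink_shape_interlacing[OF T la] and iff = shrink_shape_iff[OF T]
    show "?ext (?cut T) = T"
    proof (intro ext)
      fix i j
      have "T i j = m" if "\<not> j < ?mu i" "j < la i"
        using that iff[of j i] ssyt_funD(2)[OF T, of j i] by auto
      then show "?ext (?cut T) i j = T i j"
        using ssyt_funD(1)[OF T, of i j] by auto
    qed
    show "?cut T \<in> ?S"
    proof (rule SigmaI[OF mu])
      show "(\<lambda>i j. if j < ?mu i then T i j else 0) \<in> ssyt_fun m ?mu"
        unfolding ssyt_fun_def
      proof (intro CollectI conjI allI impI)
        fix i j assume "j < ?mu (Suc i)"
        then have "j < ?mu i" "j < la (Suc i)"
          using antimonoD[OF interlacing_antimono[OF mu la], of i "Suc i"] iff[of j "Suc i"] by auto
        then show "(if j < ?mu i then T i j else 0) < (if j < ?mu (Suc i) then T (Suc i) j else 0)"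
          using \<open>j < ?mu (Suc i)\<close> ssyt_funD(4)[OF T] by simp
      next
        fix i j assume "j < ?mu i"
        then show "(if j < ?mu i then T i j else 0) < m" using iff[of j i] by simp
      next
        fix i j j' assume "j \<le> j'" "j' < ?mu i"
        then show "(if j < ?mu i then T i j else 0) \<le> (if j' < ?mu i then T i j' else 0)"
          using iff[of j' i] ssyt_funD(3)[OF T, of j j' i] by simp
      qed simp
    qed
  next
    fix p assume p: "p \<in> ?S"
    then obtain mu T' where p_eq: "p = (mu, T')" and mu: "mu \<in> interlacing m la" and T': "T' \<in> ssyt_fun m mu"
      by auto
    let ?T = "\<lambda>i j. if j < mu i then T' i j else if j < la i then m else 0"
    note le = mu_le[OF mu] and ge = mu_ge[OF mu]
    have lt: "T' i j < m" if "j < mu i" for i j using ssyt_funD(2)[OF T' that] .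
    have T: "?T \<in> ssyt_fun (Suc m) la"
      unfolding ssyt_fun_def
    proof (intro CollectI conjI allI impI)
      fix i j assume "la i \<le> j" then show "?T i j = 0" using le[of i] by auto
    next
      fix i j assume "j < la i" then show "?T i j < Suc m" using lt[of j i] by auto
    next
      fix i j j' assume "j \<le> j'" "j' < la i"
      then show "?T i j \<le> ?T i j'" using lt[of j i] ssyt_funD(3)[OF T', of j j' i] by auto
    next
      fix i j assume "j < la (Suc i)"
      then show "?T i j < ?T (Suc i) j"
        using ge[of i] lt[of j i] ssyt_funD(4)[OF T', of j i] by auto
    qed
    show "?ext p \<in> ssyt_fun (Suc m) la" using T p_eq by simp
    have mu_eq: "shrink_shape m la ?T = mu"
    proof
      fix i
      have "{j. j < la i \<and> ?T i j < m} = {..<mu i}"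
        using le[of i] lt[of _ i] by (auto split: if_splits)
      then show "shrink_shape m la ?T i = mu i" by (simp add: shrink_shape_def)
    qed
    show "?cut (?ext p) = p"
      using mu_eq p_eq ssyt_funD(1)[OF T'] by (auto simp: fun_eq_iff not_less)
    have row: "(\<Prod>j<la i. q ^ (Suc m - 1 - ?T i j)) = q ^ mu i * (\<Prod>j<mu i. q ^ (m - 1 - T' i j))" for i
    proof -
      have "(\<Prod>j<la i. q ^ (Suc m - 1 - ?T i j)) = (\<Prod>j<mu i. q ^ (Suc m - 1 - ?T i j))"
        using le[of i] by (intro prod.mono_neutral_right) auto
      also have "\<dots> = (\<Prod>j<mu i. q * q ^ (m - 1 - T' i j))"
        using lt by (intro prod.cong) (auto simp: Suc_diff_Suc simp flip: power_Suc)
      finally show ?thesis by (simp add: prod.distrib)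
    qed
    have "mu m = 0" using mu by (simp add: interlacing_def)
    then show "(\<Prod>i<Suc m. \<Prod>j<la i. q ^ (Suc m - 1 - ?ext p i j)) = (case p of (mu,T') \<Rightarrow> (\<Prod>i<m. q ^ mu i) * (\<Prod>i<m. \<Prod>j<mu i. q ^ (m - 1 - T' i j)))"
      using row p_eq by (simp add: prod.distrib)
  qed
  finally show ?thesis by (simp add: ssyt_gf_def)
qed

text \<open>
  The beta-numbers of the shape, numbered from the last row upwards and so increasing.
\<close>

definition beads :: "nat \<Rightarrow> (nat \<Rightarrow> nat) \<Rightarrow> nat \<Rightarrow> nat" where
  "beads m la k = la (m - 1 - k) + k"

text \<open>
  In terms of beads, interlacing means that each bead of the smaller shape lies in the
  half-open interval between two consecutive beads of the larger one, independently of the others.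
\<close>

lemma sum_interlacing_beads:
  assumes la: "antimono la"
  shows "(\<Sum>mu\<in>interlacing m la. G (\<lambda>k. if k < m then beads m mu k else undefined))
     = (\<Sum>c\<in>PiE {..<m} (\<lambda>k. {beads (Suc m) la k..<beads (Suc m) la (Suc k)}). G c)"
proof (rule sum.reindex_bij_witness[where
      j = "\<lambda>mu k. if k < m then beads m mu k else undefined" and
      i = "\<lambda>c i. if i < m then c (m - 1 - i) - (m - 1 - i) else 0"])
  fix mu assume mu: "mu \<in> interlacing m la"
  show "(\<lambda>i. if i < m then (if m - 1 - i < m then beads m mu (m - 1 - i) else undefined) - (m - 1 - i) else 0) = mu"
    using mu by (auto simp: fun_eq_iff beads_def interlacing_def)
  show "(\<lambda>k. if k < m then beads m mu k else undefined) \<in> (\<Pi>\<^sub>E k\<in>{..<m}. {beads (Suc m) la k..<beads (Suc m) la (Suc k)})"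
  proof (intro PiE_I)
    fix k assume "k \<in> {..<m}"
    then have k: "k < m" "m - 1 - k < m" by auto
    have "la (Suc (m - 1 - k)) \<le> mu (m - 1 - k)" "mu (m - 1 - k) \<le> la (m - 1 - k)"
      using mu k(2) by (auto simp: interlacing_def)
    moreover have "Suc (m - 1 - k) = m - k" "m - 1 - k = m - Suc k" using k by auto
    ultimately show "(if k < m then beads m mu k else undefined) \<in> {beads (Suc m) la k..<beads (Suc m) la (Suc k)}"
      using k by (simp add: beads_def)
  qed auto
next
  fix c assume c: "c \<in> (\<Pi>\<^sub>E k\<in>{..<m}. {beads (Suc m) la k..<beads (Suc m) la (Suc k)})"
  have cb: "la (m - k) + k \<le> c k" "c k \<le> la (m - Suc k) + k" if "k < m" for k
    using PiE_mem[OF c, of k] that by (auto simp: beads_def)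
  show "(\<lambda>k. if k < m then beads m (\<lambda>i. if i < m then c (m - 1 - i) - (m - 1 - i) else 0) k else undefined) = c"
  proof
    fix k
    show "(if k < m then beads m (\<lambda>i. if i < m then c (m - 1 - i) - (m - 1 - i) else 0) k else undefined) = c k"
    proof (cases "k < m")
      case True
      then have "m - 1 - (m - 1 - k) = k" by simp
      then show ?thesis using True cb[OF True] unfolding beads_def by simp
    next
      case False then show ?thesis using PiE_arb[OF c, of k] by simp
    qed
  qed
  show "(\<lambda>i. if i < m then c (m - 1 - i) - (m - 1 - i) else 0) \<in> interlacing m la"
    unfolding interlacing_def
  proof (intro CollectI conjI allI impI)
    fix i assume i: "i < m"
    have "m - (m - 1 - i) = Suc i" "m - Suc (m - 1 - i) = i" using i by auto
    then show "la (Suc i) \<le> (if i < m then c (m - 1 - i) - (m - 1 - i) else 0)"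
      "(if i < m then c (m - 1 - i) - (m - 1 - i) else 0) \<le> la i"
      using i cb[of "m - 1 - i"] by auto
  qed auto
qed simp

lemma vandermonde_cong: "(\<And>i. i < m \<Longrightarrow> y i = y' i) \<Longrightarrow> vandermonde m y = vandermonde m y'"
  unfolding vandermonde_def by (intro prod.cong) auto

text \<open>
  The recursion for tableaux and the one for Vandermonde products agree up to a factor that
  does not depend on the shape; the factor is found later from the empty shape.
\<close>

lemma ssyt_gf_proportional:
  fixes q :: real assumes q: "1 < q"
  shows "\<exists>K. \<forall>la. antimono la \<longrightarrow> (\<forall>i\<ge>m. la i = 0) \<longrightarrow>
    ssyt_gf q m la = K * vandermonde m (\<lambda>k. q ^ beads m la k)"
proof (induction m)
  case 0
  have "ssyt_gf q 0 la = 1 * vandermonde 0 (\<lambda>k. q ^ beads 0 la k)" if "\<forall>i\<ge>0. la i = 0" for la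
    using that by (simp add: ssyt_gf_def ssyt_fun_0 vandermonde_def)
  then show ?case by blast
next
  case (Suc m)
  then obtain K where K: "\<And>la. antimono la \<Longrightarrow> \<forall>i\<ge>m. la i = 0 \<Longrightarrow>
    ssyt_gf q m la = K * vandermonde m (\<lambda>k. q ^ beads m la k)" by blast
  let ?c = "\<Prod>k<m. q ^ k"
  have c0: "?c \<noteq> 0" using q by simp
  have "ssyt_gf q (Suc m) la = K / ?c / (\<Prod>j<m. q ^ Suc j - 1) * vandermonde (Suc m) (\<lambda>k. q ^ beads (Suc m) la k)"
    if la: "antimono la" and la0: "\<forall>i\<ge>Suc m. la i = 0" for la
  proof -
    have 1: "(\<Prod>i<m. q ^ mu i) * ?c = (\<Prod>k<m. q ^ beads m mu k)" for mu
    proof -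
      have "(\<Prod>i<m. q ^ mu i) = (\<Prod>k<m. q ^ mu (m - 1 - k))"
        using prod.nat_diff_reindex[of "\<lambda>i. q ^ mu i" m] by simp
      then show ?thesis by (simp add: beads_def power_add prod.distrib)
    qed
    have "ssyt_gf q (Suc m) la = (\<Sum>mu\<in>interlacing m la. (\<Prod>i<m. q ^ mu i) * ssyt_gf q m mu)"
      using la la0 by (intro ssyt_gf_Suc) auto
    also have "\<dots> = (\<Sum>mu\<in>interlacing m la. (\<Prod>i<m. q ^ mu i) * (K * vandermonde m (\<lambda>k. q ^ beads m mu k)))"
      using la by (intro sum.cong refl, subst K) (auto intro: interlacing_antimono simp: interlacing_def)
    also have "\<dots> = (\<Sum>mu\<in>interlacing m la. (\<lambda>c. K / ?c * ((\<Prod>k<m. q ^ c k) * vandermonde m (\<lambda>k. q ^ c k)))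
        (\<lambda>k. if k < m then beads m mu k else undefined))"
    proof (intro sum.cong refl)
      fix mu
      have "(\<Prod>i<m. q ^ mu i) = (\<Prod>k<m. q ^ beads m mu k) / ?c"
        using c0 1[of mu] by (metis nonzero_mult_div_cancel_right)
      then show "(\<Prod>i<m. q ^ mu i) * (K * vandermonde m (\<lambda>k. q ^ beads m mu k))
        = (\<lambda>c. K / ?c * ((\<Prod>k<m. q ^ c k) * vandermonde m (\<lambda>k. q ^ c k)))
        (\<lambda>k. if k < m then beads m mu k else undefined)"
        by (simp cong: vandermonde_cong)
    qed
    also have "\<dots> = (\<Sum>c\<in>PiE {..<m} (\<lambda>k. {beads (Suc m) la k..<beads (Suc m) la (Suc k)}).
         K / ?c * ((\<Prod>k<m. q ^ c k) * vandermonde m (\<lambda>k. q ^ c k)))"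
      by (rule sum_interlacing_beads[OF la])
    also have "\<dots> = K / ?c * (vandermonde (Suc m) (\<lambda>k. q ^ beads (Suc m) la k) / (\<Prod>j<m. q ^ Suc j - 1))"
      unfolding sum_distrib_left[symmetric]
      by (subst sum_vandermonde_interlacing[OF q])
         (auto simp: beads_def intro!: le_SucI antimonoD[OF la])
    finally show ?thesis by simp
  qed
  then show ?case by blast
qed

lemma vandermonde_power_pos:
  fixes q :: real assumes "1 < q" "\<And>i j. j < i \<Longrightarrow> i < m \<Longrightarrow> b j < b i"
  shows "0 < vandermonde m (\<lambda>k. q ^ b k)"
  unfolding vandermonde_def using assms by (intro prod_pos) (auto intro: power_strict_increasing)

theorem ssyt_gf_product:
  fixes q :: real
  assumes q: "1 < q" and la: "antimono la" and la0: "\<And>i. m \<le> i \<Longrightarrow> la i = 0"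
  shows "ssyt_gf q m la = vandermonde m (\<lambda>k. q ^ beads m la k) / vandermonde m (\<lambda>k. q ^ k)"
proof -
  obtain K where K: "\<And>la. antimono la \<Longrightarrow> \<forall>i\<ge>m. la i = 0 \<Longrightarrow>
    ssyt_gf q m la = K * vandermonde m (\<lambda>k. q ^ beads m la k)"
    using ssyt_gf_proportional[OF q, of m] by blast
  have "1 = ssyt_gf q m (\<lambda>_. 0)" by (simp add: ssyt_gf_def ssyt_fun_0)
  also have "\<dots> = K * vandermonde m (\<lambda>k. q ^ k)" by (subst K) (auto simp: beads_def antimono_def)
  finally have "K = 1 / vandermonde m (\<lambda>k. q ^ k)"
    using vandermonde_power_pos[OF q, of m "\<lambda>k. k"] by (simp add: field_simps)
  then show ?thesis using K[OF la] la0 by simp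
qed

section \<open>Products of quantum integers over bead configurations\<close>

text \<open>
  Up to the factor \<open>t - t\<^sup>-\<^sup>1\<close> these are the quantum integers.
\<close>

definition qint :: "real \<Rightarrow> nat \<Rightarrow> real" where
  "qint t k = t ^ k - inverse t ^ k"

definition qfact :: "real \<Rightarrow> nat \<Rightarrow> real" where
  "qfact t k = (\<Prod>i<k. qint t (Suc i))"

definition qvand :: "real \<Rightarrow> nat set \<Rightarrow> real" where
  "qvand t A = (\<Prod>a\<in>A. \<Prod>b\<in>{b\<in>A. b < a}. qint t (a - b))"

definition qdist :: "real \<Rightarrow> nat \<Rightarrow> nat \<Rightarrow> real" where
  "qdist t a b = qint t (max a b - min a b)"

text \<open>
  For disjoint sets this is the product over all pairs; for \<open>A = B\<close> every pair counts
  twice, see \<open>qcross_self\<close>.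
\<close>

definition qcross :: "real \<Rightarrow> nat set \<Rightarrow> nat set \<Rightarrow> real" where
  "qcross t A B = (\<Prod>a\<in>A. \<Prod>b\<in>B - {a}. qdist t a b)"

lemma qint_pos: assumes "1 < t" "0 < k" shows "0 < qint t k"
proof -
  have "1 < t ^ k" using assms by (simp add: one_less_power)
  moreover from this have "inverse (t ^ k) < 1" by (simp add: inverse_less_1_iff)
  ultimately show ?thesis by (simp add: qint_def power_inverse)
qed

lemma qfact_pos: "1 < t \<Longrightarrow> 0 < qfact t k"
  unfolding qfact_def by (intro prod_pos) (auto intro: qint_pos)

lemma qfact_Suc: "qfact t (Suc k) = qfact t k * qint t (Suc k)"
  by (simp add: qfact_def)

lemma qvand_pos: "1 < t \<Longrightarrow> 0 < qvand t A"
  unfolding qvand_def by (intro prod_pos ballI) (auto intro: qint_pos)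

lemma qdist_commute: "qdist t a b = qdist t b a"
  by (simp add: qdist_def max.commute min.commute)

lemma qdist_less: "b < a \<Longrightarrow> qdist t a b = qint t (a - b)"
  by (simp add: qdist_def)

lemma qdist_pos: "1 < t \<Longrightarrow> a \<noteq> b \<Longrightarrow> 0 < qdist t a b"
  unfolding qdist_def by (intro qint_pos) (auto simp: max_def min_def)

lemma qcross_commute:
  assumes "finite A" "finite B" shows "qcross t A B = qcross t B A"
proof -
  have "qcross t A B = (\<Prod>a\<in>A. \<Prod>b\<in>{b \<in> B. b \<noteq> a}. qdist t a b)"
    unfolding qcross_def by (intro prod.cong refl) auto
  also have "\<dots> = (\<Prod>b\<in>B. \<Prod>a\<in>{a \<in> A. b \<noteq> a}. qdist t a b)"
    by (rule prod.swap_restrict[OF assms])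
  also have "\<dots> = qcross t B A"
    unfolding qcross_def by (intro prod.cong) (auto simp: qdist_commute)
  finally show ?thesis .
qed

lemma qcross_self:
  assumes "finite A" shows "qcross t A A = qvand t A ^ 2"
proof -
  have "qcross t A A = (\<Prod>a\<in>A. (\<Prod>b\<in>{b\<in>A. b < a}. qdist t a b) * (\<Prod>b\<in>{b\<in>A. a < b}. qdist t a b))"
    unfolding qcross_def
  proof (intro prod.cong refl)
    fix a assume "a \<in> A"
    have "A - {a} = {b\<in>A. b < a} \<union> {b\<in>A. a < b}" by auto
    then show "(\<Prod>b\<in>A - {a}. qdist t a b) = (\<Prod>b\<in>{b\<in>A. b < a}. qdist t a b) * (\<Prod>b\<in>{b\<in>A. a < b}. qdist t a b)"
      using assms by (simp add: prod.union_disjoint disjoint_iff)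
  qed
  also have "\<dots> = (\<Prod>a\<in>A. \<Prod>b\<in>{b\<in>A. b < a}. qdist t a b) * (\<Prod>a\<in>A. \<Prod>b\<in>{b\<in>A. a < b}. qdist t a b)"
    by (rule prod.distrib)
  also have "(\<Prod>a\<in>A. \<Prod>b\<in>{b\<in>A. a < b}. qdist t a b) = (\<Prod>b\<in>A. \<Prod>a\<in>{a\<in>A. a < b}. qdist t a b)"
    by (rule prod.swap_restrict[OF assms assms])
  also have "\<dots> = qvand t A"
    unfolding qvand_def by (intro prod.cong refl) (auto simp: qdist_less qdist_commute)
  also have "(\<Prod>a\<in>A. \<Prod>b\<in>{b\<in>A. b < a}. qdist t a b) = qvand t A"
    unfolding qvand_def by (intro prod.cong refl) (auto simp: qdist_less)
  finally show ?thesis by (simp add: power2_eq_square)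
qed

lemma qcross_Un_left: "finite A \<Longrightarrow> finite B \<Longrightarrow> A \<inter> B = {} \<Longrightarrow> qcross t (A \<union> B) C = qcross t A C * qcross t B C"
  unfolding qcross_def by (rule prod.union_disjoint)

lemma qcross_Un_right: "finite A \<Longrightarrow> finite B \<Longrightarrow> finite C \<Longrightarrow> A \<inter> B = {} \<Longrightarrow> qcross t C (A \<union> B) = qcross t C A * qcross t C B"
  using qcross_Un_left[of A B t C] qcross_commute by (metis finite_UnI)

lemma qcross_nonzero: "1 < t \<Longrightarrow> qcross t A B \<noteq> 0"
  unfolding qcross_def using qdist_pos by (intro less_imp_neq[THEN not_sym] prod_pos ballI) auto

lemma qcross_interval:
  assumes "a < L" shows "(\<Prod>b\<in>{..<L} - {a}. qdist t a b) = qfact t a * qfact t (L - 1 - a)"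
proof -
  have "{..<L} - {a} = {..<a} \<union> {Suc a..<L}" using assms by auto
  then have "(\<Prod>b\<in>{..<L} - {a}. qdist t a b) = (\<Prod>b<a. qdist t a b) * (\<Prod>b\<in>{Suc a..<L}. qdist t a b)"
    by (simp add: prod.union_disjoint disjoint_iff)
  also have "(\<Prod>b<a. qdist t a b) = (\<Prod>b<a. qint t (Suc (a - Suc b)))"
    by (intro prod.cong) (auto simp: qdist_less Suc_diff_Suc)
  also have "\<dots> = qfact t a"
    unfolding qfact_def by (rule prod.nat_diff_reindex)
  also have "(\<Prod>b\<in>{Suc a..<L}. qdist t a b) = qfact t (L - 1 - a)"
    unfolding qfact_def
    by (rule prod.reindex_bij_witness[of _ "\<lambda>i. Suc (a + i)" "\<lambda>b. b - Suc a"]) (auto simp: qdist_commute[of t a] qdist_less Suc_diff_Suc)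
  finally show ?thesis .
qed

lemma qcross_above:
  assumes "1 < t" "a < L" shows "(\<Prod>b\<in>{L..<L + z}. qdist t a b) = qfact t (L + z - 1 - a) / qfact t (L - 1 - a)"
proof (induction z)
  case 0
  show ?case using qfact_pos[OF assms(1), of "L - 1 - a"] by simp
next
  case (Suc z)
  have "L + Suc z - 1 - a = Suc (L + z - 1 - a)" "L + z - a = Suc (L + z - 1 - a)" using assms by auto
  then show ?case using Suc assms by (simp add: qdist_commute[of t a] qdist_less qfact_Suc)
qed

lemma qvand_lessThan: "qvand t {..<m} = (\<Prod>k<m. qfact t k)"
  unfolding qvand_def
proof (intro prod.cong refl)
  fix a assume a: "a \<in> {..<m}"
  have "(\<Prod>b\<in>{b \<in> {..<m}. b < a}. qint t (a - b)) = (\<Prod>b<a. qint t (Suc (a - Suc b)))"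
    using a by (intro prod.cong) (auto simp: Suc_diff_Suc)
  also have "\<dots> = qfact t a" unfolding qfact_def by (rule prod.nat_diff_reindex)
  finally show "(\<Prod>b\<in>{b \<in> {..<m}. b < a}. qint t (a - b)) = qfact t a" .
qed

text \<open>
  The contribution of a bead at \<open>a < L\<close> to \<open>qvand_complement\<close>: its distances to all other
  places below \<open>L\<close>, and twice its distances to \<open>z\<close> further beads on top.
\<close>

definition bead_weight :: "real \<Rightarrow> nat \<Rightarrow> nat \<Rightarrow> nat \<Rightarrow> real" where
  "bead_weight t L z a = qfact t a * qfact t (L + z - 1 - a) ^ 2 / qfact t (L - 1 - a)"

lemma bead_weight_pos: "1 < t \<Longrightarrow> 0 < bead_weight t L z a"
  unfolding bead_weight_def by (intro divide_pos_pos mult_pos_pos zero_less_power qfact_pos)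

text \<open>
  The distances of the beads of \<open>A\<close> to each other and to the gaps together make up the
  distances to all places below \<open>L\<close>, and those have a closed form.
\<close>

lemma qvand_complement:
  assumes t: "1 < t" and A: "A \<subseteq> {..<L}"
  shows "qvand t (A \<union> {L..<L + z}) ^ 2 * qcross t A ({..<L} - A)
    = qvand t {L..<L + z} ^ 2 * (\<Prod>a\<in>A. bead_weight t L z a)"
proof -
  let ?Z = "{L..<L + z}" and ?B = "{..<L} - A"
  have fin: "finite A" "finite ?Z" "finite ?B" using A finite_subset by auto
  have disj: "A \<inter> ?Z = {}" "A \<inter> ?B = {}" using A by auto
  have "qvand t (A \<union> ?Z) ^ 2 = qcross t (A \<union> ?Z) (A \<union> ?Z)"
    using fin by (subst qcross_self) auto
  also have "\<dots> = qcross t A A * qcross t A ?Z * (qcross t ?Z A * qcross t ?Z ?Z)"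
    using fin disj by (simp add: qcross_Un_left qcross_Un_right)
  also have "qcross t ?Z A = qcross t A ?Z" using fin by (simp add: qcross_commute)
  finally have "qvand t (A \<union> ?Z) ^ 2 * qcross t A ?B
    = qvand t ?Z ^ 2 * ((qcross t A A * qcross t A ?B) * (qcross t A ?Z)^2)"
    using fin by (simp add: qcross_self power2_eq_square mult_ac)
  also have "qcross t A A * qcross t A ?B = qcross t A (A \<union> ?B)"
    by (rule qcross_Un_right[OF fin(1,3,1) disj(2), symmetric])
  also have "A \<union> ?B = {..<L}" using A by auto
  also have "qcross t A {..<L} = (\<Prod>a\<in>A. qfact t a * qfact t (L - 1 - a))"
    unfolding qcross_def using A by (intro prod.cong refl qcross_interval) auto
  also have "qcross t A ?Z = (\<Prod>a\<in>A. qfact t (L + z - 1 - a) / qfact t (L - 1 - a))"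
    unfolding qcross_def
  proof (intro prod.cong refl)
    fix a assume "a \<in> A"
    then have "a < L" "?Z - {a} = ?Z" using A by auto
    then show "(\<Prod>b\<in>?Z - {a}. qdist t a b) = qfact t (L + z - 1 - a) / qfact t (L - 1 - a)"
      using qcross_above[OF t] by simp
  qed
  also have "(\<Prod>a\<in>A. qfact t a * qfact t (L - 1 - a)) * (\<Prod>a\<in>A. qfact t (L + z - 1 - a) / qfact t (L - 1 - a))^2
    = (\<Prod>a\<in>A. bead_weight t L z a)"
    unfolding prod_power_distrib prod.distrib[symmetric]
  proof (intro prod.cong refl)
    fix a
    show "qfact t a * qfact t (L - 1 - a) * (qfact t (L + z - 1 - a) / qfact t (L - 1 - a))^2 = bead_weight t L z a"
      using qfact_pos[OF t, of "L - 1 - a"] by (simp add: bead_weight_def power2_eq_square)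
  qed
  finally show ?thesis .
qed

lemma qcross_reflect:
  assumes A: "A \<subseteq> {..<L}" and B: "B \<subseteq> {..<L}"
  shows "qcross t ((\<lambda>b. L - 1 - b) ` A) ((\<lambda>b. L - 1 - b) ` B) = qcross t A B"
proof -
  have inj: "inj_on (\<lambda>b. L - 1 - b) {..<L}" by (auto simp: inj_on_def)
  have "qcross t ((\<lambda>b. L - 1 - b) ` A) ((\<lambda>b. L - 1 - b) ` B)
    = (\<Prod>a\<in>A. \<Prod>b\<in>(\<lambda>b. L - 1 - b) ` B - {L - 1 - a}. qdist t (L - 1 - a) b)"
    unfolding qcross_def by (subst prod.reindex, rule inj_on_subset[OF inj A], simp only: o_def)
  also have "\<dots> = qcross t A B"
    unfolding qcross_def
  proof (rule prod.cong[OF refl])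
    fix a assume a: "a \<in> A"
    have inj': "inj_on (\<lambda>b. L - 1 - b) (B - {a})" by (rule inj_on_subset[OF inj]) (use B in blast)
    have eq: "(\<lambda>b. L - 1 - b) ` B - {L - 1 - a} = (\<lambda>b. L - 1 - b) ` (B - {a})"
      using inj_on_image_set_diff[OF inj, of B "{a}"] a A B by auto
    have "(\<Prod>b\<in>(\<lambda>b. L - 1 - b) ` B - {L - 1 - a}. qdist t (L - 1 - a) b) = (\<Prod>b\<in>B - {a}. qdist t (L - 1 - a) (L - 1 - b))"
      unfolding eq prod.reindex[OF inj'] o_def ..
    also have "\<dots> = (\<Prod>b\<in>B - {a}. qdist t a b)"
    proof (intro prod.cong refl)
      fix b assume b: "b \<in> B - {a}"
      then have "b < L" "a < L" using a A B by auto
      then show "qdist t (L - 1 - a) (L - 1 - b) = qdist t a b"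
        unfolding qdist_def by (intro arg_cong[of _ _ "qint t"]) (auto simp: max_def min_def)
    qed
    finally show "(\<Prod>b\<in>(\<lambda>b. L - 1 - b) ` B - {L - 1 - a}. qdist t (L - 1 - a) b) = (\<Prod>b\<in>B - {a}. qdist t a b)" .
  qed
  finally show ?thesis .
qed

lemma qvand_reflect:
  assumes t: "1 < t" and A: "A \<subseteq> {..<L}"
  shows "qvand t ((\<lambda>b. L - 1 - b) ` A) = qvand t A"
proof -
  have "finite A" using A finite_subset by blast
  then have "qvand t ((\<lambda>b. L - 1 - b) ` A) ^ 2 = qvand t A ^ 2"
    using qcross_reflect[OF A A, of t] by (simp add: qcross_self)
  then show ?thesis using qvand_pos[OF t] by (simp add: power2_eq_iff_nonneg less_imp_le)
qed

text \<open>
  Passing to the reflected complement (for partitions: to the conjugate partition) keeps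
  the product over pairs of a bead and a gap, so \<open>qvand_complement\<close> for both configurations can be compared.
\<close>

lemma qvand_reflect_complement:
  assumes t: "1 < t" and A: "A \<subseteq> {..<L}" and A': "A' = (\<lambda>b. L - 1 - b) ` ({..<L} - A)"
  shows "qvand t (A \<union> {L..<L + z}) ^ 2 * (\<Prod>a\<in>A'. bead_weight t L z a)
    = qvand t (A' \<union> {L..<L + z}) ^ 2 * (\<Prod>a\<in>A. bead_weight t L z a)"
proof -
  have inj: "inj_on (\<lambda>b. L - 1 - b) {..<L}" by (auto simp: inj_on_def)
  have A'L: "A' \<subseteq> {..<L}" unfolding A' by auto
  have "(\<lambda>b. L - 1 - b) ` {..<L} = {..<L}"
    by (rule endo_inj_surj[OF _ _ inj]) auto
  then have "{..<L} - A' = (\<lambda>b. L - 1 - b) ` A"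
    unfolding A' using inj_on_image_set_diff[OF inj, of "{..<L}" "{..<L} - A"] A by (simp add: double_diff)
  then have "qcross t A' ({..<L} - A') = qcross t ({..<L} - A) A"
    unfolding A' using qcross_reflect[of "{..<L} - A" L A t] A by auto
  also have "\<dots> = qcross t A ({..<L} - A)" using A finite_subset by (intro qcross_commute) auto
  finally have X: "qcross t A' ({..<L} - A') = qcross t A ({..<L} - A)" .
  have "(qvand t (A \<union> {L..<L + z}) ^ 2 * (\<Prod>a\<in>A'. bead_weight t L z a)) * qcross t A ({..<L} - A) * qvand t {L..<L + z} ^ 2
    = (qvand t (A' \<union> {L..<L + z}) ^ 2 * (\<Prod>a\<in>A. bead_weight t L z a)) * qcross t A ({..<L} - A) * qvand t {L..<L + z} ^ 2"
    using qvand_complement[OF t A, of z] qvand_complement[OF t A'L, of z] unfolding X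
    by (metis (no_types, opaque_lifting) mult.commute mult.left_commute)
  then show ?thesis using qcross_nonzero[OF t] qvand_pos[OF t, of "{L..<L+z}"] by simp
qed

text \<open>
  The interval is symmetric under \<open>a \<mapsto> L - 1 - a\<close>, which pairs the factors.
\<close>

lemma bead_weight_symmetric_interval:
  assumes t: "1 < t" and uv: "u \<le> v"
  shows "(\<Prod>i\<in>{u..<v}. bead_weight t (2 * n + u + v) z (n + i)) = (\<Prod>i\<in>{u..<v}. qfact t (n + i + z)) ^ 2"
proof -
  let ?L = "2 * n + u + v"
  have refl: "(\<Prod>i\<in>{u..<v}. f (n + i)) = (\<Prod>i\<in>{u..<v}. f (?L - 1 - (n + i)))" for f :: "nat \<Rightarrow> real"
    by (rule prod.reindex_bij_witness[of _ "\<lambda>i. u + v - 1 - i" "\<lambda>i. u + v - 1 - i"]) auto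
  have "(\<Prod>i\<in>{u..<v}. bead_weight t ?L z (n + i))
    = (\<Prod>i\<in>{u..<v}. qfact t (n + i)) * (\<Prod>i\<in>{u..<v}. qfact t (?L + z - 1 - (n + i))) ^ 2 / (\<Prod>i\<in>{u..<v}. qfact t (?L - 1 - (n + i)))"
    unfolding bead_weight_def prod_dividef prod.distrib prod_power_distrib ..
  also have "(\<Prod>i\<in>{u..<v}. qfact t (?L - 1 - (n + i))) = (\<Prod>i\<in>{u..<v}. qfact t (n + i))"
    by (rule refl[symmetric])
  also have "(\<Prod>i\<in>{u..<v}. qfact t (?L + z - 1 - (n + i))) = (\<Prod>i\<in>{u..<v}. qfact t (?L - 1 - (n + i) + z))"
    by (intro prod.cong refl arg_cong[of _ _ "qfact t"]) auto
  also have "\<dots> = (\<Prod>i\<in>{u..<v}. qfact t (n + i + z))"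
    by (rule refl[of "\<lambda>k. qfact t (k + z)", symmetric])
  finally have eq: "(\<Prod>i\<in>{u..<v}. bead_weight t ?L z (n + i))
    = (\<Prod>i\<in>{u..<v}. qfact t (n + i)) * (\<Prod>i\<in>{u..<v}. qfact t (n + i + z)) ^ 2 / (\<Prod>i\<in>{u..<v}. qfact t (n + i))" .
  have "(\<Prod>i\<in>{u..<v}. qfact t (n + i)) > 0" by (intro prod_pos ballI qfact_pos[OF t])
  then have "(\<Prod>i\<in>{u..<v}. qfact t (n + i)) \<noteq> 0" by linarith
  then show ?thesis unfolding eq by (rule nonzero_mult_div_cancel_left)
qed

text \<open>
  \<open>B\<close> and \<open>B'\<close> are the beads of the outer words, of length \<open>n\<close> each, and \<open>B'\<close> is the reflected
  complement of \<open>B\<close>. Therefore reflecting the complement of all beads below \<open>L\<close> keeps the outer words and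
  turns \<open>v\<close> beads followed by \<open>u\<close> gaps into \<open>u\<close> beads followed by \<open>v\<close> gaps. The bead weights of the outer
  words cancel, and those of the middle account exactly for the change of the denominator.
\<close>

lemma qvand_middle_swap_le:
  assumes t: "1 < t" and uv: "u \<le> v" and B: "B \<subseteq> {..<n}"
    and L: "L = 2 * n + u + v" and B': "B' = (\<lambda>b. L - 1 - b) ` ({..<n} - B)"
  shows "qvand t (B \<union> {n..<n+v} \<union> B' \<union> {L..<L+z}) / qvand t {..<n+v+z}
    = qvand t (B \<union> {n..<n+u} \<union> B' \<union> {L..<L+z}) / qvand t {..<n+u+z}"
proof -
  let ?A = "B \<union> {n..<n+v} \<union> B'" and ?A' = "B \<union> {n..<n+u} \<union> B'"
  let ?g = "bead_weight t L z"
  have B'L: "b \<in> B' \<Longrightarrow> n + u + v \<le> b \<and> b < L" for b unfolding B' L by auto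
  have A: "?A \<subseteq> {..<L}" using B B'L L by fastforce
  have "(\<lambda>b. L - 1 - b) ` ({..<L} - ?A) = ?A'"
  proof (intro equalityI subsetI)
    fix x assume "x \<in> (\<lambda>b. L - 1 - b) ` ({..<L} - ?A)"
    then obtain b where "b \<in> {..<L} - ?A" "x = L - 1 - b" by blast
    then have b: "b < L" "b \<notin> B" "b \<notin> {n..<n+v}" "b \<notin> B'" "x = L - 1 - b" by auto
    consider "b < n" | "n + v \<le> b" "b < n + v + u" | "n + v + u \<le> b" using b(3) by force
    then show "x \<in> ?A'"
    proof cases
      case 1 then show ?thesis using b unfolding B' by auto
    next
      case 2 then show ?thesis using b(5) L by auto
    next
      case 3
      have "x \<in> B"
      proof (rule ccontr)
        assume "x \<notin> B"
        then have "L - 1 - x \<in> B'" using 3 b(1,5) L unfolding B' by (intro image_eqI[of _ _ x]) auto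
        moreover have "L - 1 - x = b" using b(1,5) by simp
        ultimately show False using b(4) by simp
      qed
      then show ?thesis by blast
    qed
  next
    fix x assume x: "x \<in> ?A'"
    have xL: "x < L" using x B B'L L uv by fastforce
    have "L - 1 - x \<in> {..<L} - ?A"
    proof -
      consider "x \<in> B" | "x \<in> {n..<n+u}" | "x \<in> B'" using x by blast
      then show ?thesis
      proof cases
        case 1
        then have xn: "x < n" using B by auto
        have "L - 1 - x \<notin> B'"
        proof
          assume "L - 1 - x \<in> B'"
          then obtain b where b: "b < n" "b \<notin> B" "L - 1 - x = L - 1 - b" unfolding B' by auto
          then have "x = b" using xn L by simp
          then show False using b(2) 1 by simp
        qed
        then show ?thesis using 1 xn B L by auto
      next
        case 2
        then show ?thesis using B B'L[of "L - 1 - x"] L by fastforce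
      next
        case 3
        then obtain b where "b < n" "b \<notin> B" "x = L - 1 - b" unfolding B' by auto
        then show ?thesis using B'L[of b] L by auto
      qed
    qed
    moreover have "x = L - 1 - (L - 1 - x)" using xL by simp
    ultimately show "x \<in> (\<lambda>b. L - 1 - b) ` ({..<L} - ?A)" by (rule rev_image_eqI)
  qed
  then have main: "qvand t (?A \<union> {L..<L + z}) ^ 2 * (\<Prod>a\<in>?A'. ?g a) = qvand t (?A' \<union> {L..<L + z}) ^ 2 * (\<Prod>a\<in>?A. ?g a)"
    by (intro qvand_reflect_complement[OF t A]) simp
  have "?A = ?A' \<union> {n + u..<n + v}"
    using uv by auto
  moreover have "?A' \<inter> {n + u..<n + v} = {}" using B B'L by fastforce
  moreover have "finite ?A'" unfolding B' using B finite_subset by auto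
  ultimately have "(\<Prod>a\<in>?A. ?g a) = (\<Prod>a\<in>?A'. ?g a) * (\<Prod>a\<in>{n + u..<n + v}. ?g a)"
    by (simp add: prod.union_disjoint)
  also have "(\<Prod>a\<in>{n + u..<n + v}. ?g a) = (\<Prod>i\<in>{u..<v}. ?g (n + i))"
    by (rule prod.reindex_bij_witness[of _ "\<lambda>i. n + i" "\<lambda>a. a - n"]) auto
  also have "(\<Prod>i\<in>{u..<v}. ?g (n + i)) = (\<Prod>i\<in>{u..<v}. qfact t (n + i + z)) ^ 2"
    unfolding L by (rule bead_weight_symmetric_interval[OF t uv])
  finally have "qvand t (?A \<union> {L..<L + z}) ^ 2 * (\<Prod>a\<in>?A'. ?g a)
     = (qvand t (?A' \<union> {L..<L + z}) * (\<Prod>i\<in>{u..<v}. qfact t (n + i + z))) ^ 2 * (\<Prod>a\<in>?A'. ?g a)"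
    using main by (simp add: power_mult_distrib)
  moreover have "(\<Prod>a\<in>?A'. ?g a) > 0" by (intro prod_pos ballI bead_weight_pos[OF t])
  ultimately have "qvand t (?A \<union> {L..<L + z}) ^ 2 = (qvand t (?A' \<union> {L..<L + z}) * (\<Prod>i\<in>{u..<v}. qfact t (n + i + z))) ^ 2"
    by simp
  moreover have pos: "(\<Prod>i\<in>{u..<v}. qfact t (n + i + z)) > 0" by (intro prod_pos ballI qfact_pos[OF t])
  ultimately have eq: "qvand t (?A \<union> {L..<L + z}) = qvand t (?A' \<union> {L..<L + z}) * (\<Prod>i\<in>{u..<v}. qfact t (n + i + z))"
    using qvand_pos[OF t] by (subst (asm) power2_eq_iff_nonneg) (auto simp: less_imp_le)
  have "{..<n+v+z} = {..<n+u+z} \<union> {n+u+z..<n+v+z}" using uv by auto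
  then have "qvand t {..<n+v+z} = qvand t {..<n+u+z} * (\<Prod>a\<in>{n+u+z..<n+v+z}. qfact t a)"
    unfolding qvand_lessThan by (simp add: prod.union_disjoint disjoint_iff)
  also have "(\<Prod>a\<in>{n+u+z..<n+v+z}. qfact t a) = (\<Prod>i\<in>{u..<v}. qfact t (n + i + z))"
    by (rule prod.reindex_bij_witness[of _ "\<lambda>i. n + i + z" "\<lambda>a. a - n - z"]) auto
  finally have eq': "qvand t {..<n+v+z} = qvand t {..<n+u+z} * (\<Prod>i\<in>{u..<v}. qfact t (n + i + z))" .
  have "(\<Prod>i\<in>{u..<v}. qfact t (n + i + z)) \<noteq> 0" using pos by linarith
  then show ?thesis unfolding eq eq' by (rule nonzero_mult_divide_mult_cancel_right)
qed

lemma qvand_middle_swap: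
  assumes t: "1 < t" and B: "B \<subseteq> {..<n}"
    and L: "L = 2 * n + u + v" and B': "B' = (\<lambda>b. L - 1 - b) ` ({..<n} - B)"
  shows "qvand t (B \<union> {n..<n+v} \<union> B' \<union> {L..<L+z}) / qvand t {..<n+v+z}
    = qvand t (B \<union> {n..<n+u} \<union> B' \<union> {L..<L+z}) / qvand t {..<n+u+z}"
proof (cases "u \<le> v")
  case True
  show ?thesis by (rule qvand_middle_swap_le[OF t True B L B'])
next
  case False
  have L2: "L = 2 * n + v + u" using L by simp
  show ?thesis using False by (intro qvand_middle_swap_le[OF t _ B L2 B', symmetric]) simp
qed

section \<open>Bead configurations as words\<close>

definition bead_set :: "bool list \<Rightarrow> nat set" where
  "bead_set w = {i. i < length w \<and> w ! i}"

lemma bead_set_append: "bead_set (w @ w') = bead_set w \<union> (+) (length w) ` bead_set w'"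
proof (intro equalityI subsetI)
  fix i assume "i \<in> bead_set (w @ w')"
  then show "i \<in> bead_set w \<union> (+) (length w) ` bead_set w'"
    by (cases "i < length w") (auto simp: bead_set_def nth_append intro!: image_eqI[of _ _ "i - length w"])
qed (auto simp: bead_set_def nth_append)

lemma bead_set_Cons: "bead_set (b # w) = (if b then {0} else {}) \<union> Suc ` bead_set w"
proof -
  have "bead_set [b] = (if b then {0} else {})" by (auto simp: bead_set_def)
  then show ?thesis using bead_set_append[of "[b]" w] by simp
qed

lemma bead_set_replicate: "bead_set (replicate k True) = {..<k}" "bead_set (replicate k False) = {}"
  by (auto simp: bead_set_def)

lemma bead_set_subset: "bead_set w \<subseteq> {..<length w}"
  by (auto simp: bead_set_def)

lemma bead_set_rev: "bead_set (rev w) = (\<lambda>i. length w - 1 - i) ` bead_set w"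
proof (intro equalityI subsetI)
  fix i assume "i \<in> bead_set (rev w)"
  then show "i \<in> (\<lambda>i. length w - 1 - i) ` bead_set w"
    by (intro image_eqI[of _ _ "length w - 1 - i"]) (auto simp: bead_set_def rev_nth)
qed (auto simp: bead_set_def rev_nth)

lemma bead_set_Not: "bead_set (map Not w) = {..<length w} - bead_set w"
  by (auto simp: bead_set_def)

text \<open>
  Beads and gaps in alternation: \<open>v\<^sub>1\<close> beads, \<open>h\<^sub>1\<close> gaps, \<open>v\<^sub>2\<close> beads, and so on. The lists of
  \<open>alternating\<close> have equal length, those of \<open>interleave\<close> have one more block of beads at the end.
\<close>

fun alternating :: "nat list \<Rightarrow> nat list \<Rightarrow> bool list" where
  "alternating (h # hs) (v # vs) = replicate v True @ replicate h False @ alternating hs vs"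
| "alternating _ _ = []"

fun interleave :: "nat list \<Rightarrow> nat list \<Rightarrow> bool list" where
  "interleave (h # hs) (v # vs) = replicate v True @ replicate h False @ interleave hs vs"
| "interleave [] (v # vs) = replicate v True"
| "interleave hs [] = []"

text \<open>
  The boundary path of the partition, read from its last row upwards; therefore the list
  \<open>vs\<close> is reversed.
\<close>

definition bead_word :: "nat list \<Rightarrow> nat list \<Rightarrow> bool list" where
  "bead_word hs vs = interleave hs (rev vs)"

lemma alternating_append:
  "length hs = length vs \<Longrightarrow> alternating (hs @ hs') (vs @ vs') = alternating hs vs @ alternating hs' vs'"
  by (induction hs vs rule: list_induct2) auto

text \<open>
  Reversing the word and exchanging beads and gaps exchanges the roles of the two lists.
\<close>

lemma rev_alternating:
  "length hs = length vs \<Longrightarrow> map Not (rev (alternating hs vs)) = alternating (rev vs) (rev hs)"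
  by (induction hs vs rule: list_induct2) (simp_all add: alternating_append)

lemma interleave_alternating:
  "length hs = length vs \<Longrightarrow> interleave hs (vs @ [z]) = alternating hs vs @ replicate z True"
  by (induction hs vs rule: list_induct2) simp_all

lemma interleave_snoc:
  "length vs = Suc (length hs) \<Longrightarrow>
    interleave (hs @ [h]) (vs @ [v]) = interleave hs vs @ replicate h False @ replicate v True"
proof (induction hs arbitrary: vs)
  case Nil
  then show ?case by (cases vs) auto
next
  case (Cons a hs)
  then show ?case by (cases vs) auto
qed

lemma rev_interleave:
  "length vs = Suc (length hs) \<Longrightarrow> rev (interleave hs vs) = interleave (rev hs) (rev vs)"
proof (induction hs arbitrary: vs)
  case Nil
  then show ?case by (cases vs) auto
next
  case (Cons a hs)
  then show ?case by (cases vs) (auto simp: interleave_snoc)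
qed

text \<open>
  The number of gaps before each bead, counted from \<open>c\<close>. For \<open>c = 0\<close> these are the parts of
  the partition in increasing order, including zero parts.
\<close>

fun parts :: "nat \<Rightarrow> bool list \<Rightarrow> nat list" where
  "parts c [] = []"
| "parts c (True # w) = c # parts c w"
| "parts c (False # w) = parts (Suc c) w"

lemma parts_replicate: "parts c (replicate v True @ w) = replicate v c @ parts c w"
  "parts c (replicate h False @ w) = parts (c + h) w"
  by (induction v, auto) (induction h arbitrary: c, auto)

lemma bead_set_parts: "(\<lambda>k. parts c w ! k + k) ` {..<length (parts c w)} = (+) c ` bead_set w"
proof (induction c w rule: parts.induct)
  case (1 c)
  then show ?case by (simp add: bead_set_def)
next
  case (2 c w)
  have "(\<lambda>k. parts c (True # w) ! k + k) ` {..<length (parts c (True # w))}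
    = insert c (Suc ` (\<lambda>k. parts c w ! k + k) ` {..<length (parts c w)})"
    by (simp add: lessThan_Suc_eq_insert_0 image_image)
  also have "\<dots> = insert c (Suc ` (+) c ` bead_set w)" by (simp only: 2)
  also have "\<dots> = (+) c ` bead_set (True # w)"
    by (simp add: bead_set_Cons image_image)
  finally show ?case .
next
  case (3 c w)
  have "(+) (Suc c) ` bead_set w = (+) c ` bead_set (False # w)"
    by (simp add: bead_set_Cons image_image)
  then show ?case using 3 by simp
qed

lemma sorted_parts: "sorted (parts c w) \<and> (\<forall>p\<in>set (parts c w). c \<le> p)"
  by (induction c w rule: parts.induct) auto


lemma length_parts: "length (parts c w) = count_list w True"
  by (induction c w rule: parts.induct) auto

lemma parts_append: "parts c (w @ w') = parts c w @ parts (c + count_list w False) w'"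
  by (induction c w rule: parts.induct) auto

lemma count_list_replicate: "count_list (replicate k a) b = (if a = b then k else 0)"
  by (induction k) auto

lemma count_interleave:
  "length vs = Suc (length hs) \<Longrightarrow>
    count_list (interleave hs vs) False = sum_list hs \<and> count_list (interleave hs vs) True = sum_list vs"
proof (induction hs arbitrary: vs)
  case Nil
  then show ?case by (cases vs) (auto simp: count_list_replicate)
next
  case (Cons a hs)
  then show ?case by (cases vs) (auto simp: count_list_replicate count_list_append)
qed

text \<open>
  The definition of the partition starts with the largest parts and omits the \<open>last vs\<close>
  parts that are zero.
\<close>

lemma parts_bead_word:
  "length vs = Suc (length hs) \<Longrightarrow> rev (parts 0 (bead_word hs vs))
    = concat (map (\<lambda>i. replicate (vs ! i) (sum_list (take (length hs - i) hs))) [0..<length hs])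
      @ replicate (last vs) 0"
proof (induction hs arbitrary: vs rule: rev_induct)
  case Nil
  then obtain v where "vs = [v]" by (cases vs) auto
  then show ?case using parts_replicate(1)[of 0 v "[]"] by (simp add: bead_word_def)
next
  case (snoc h hs)
  then obtain v vs' where vs: "vs = v # vs'" by (cases vs) auto
  have len: "length vs' = Suc (length hs)" using snoc.prems vs by simp
  then have ne: "vs' \<noteq> []" by auto
  have "bead_word (hs @ [h]) vs = bead_word hs vs' @ replicate h False @ replicate v True"
    using len vs by (simp add: bead_word_def interleave_snoc)
  then have "rev (parts 0 (bead_word (hs @ [h]) vs))
    = replicate v (sum_list hs + h) @ rev (parts 0 (bead_word hs vs'))"
    using parts_replicate(1)[of "sum_list hs + h" v "[]"] parts_replicate(2)[of "sum_list hs" h "replicate v True"]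
      count_interleave[of "rev vs'" hs] len by (simp add: parts_append bead_word_def)
  also have "rev (parts 0 (bead_word hs vs')) = concat (map (\<lambda>i. replicate (vs' ! i) (sum_list (take (length hs - i) hs))) [0..<length hs])
      @ replicate (last vs') 0"
    by (rule snoc.IH[OF len])
  also have "map (\<lambda>i. replicate (vs' ! i) (sum_list (take (length hs - i) hs))) [0..<length hs]
    = map (\<lambda>i. replicate (vs ! i) (sum_list (take (length (hs @ [h]) - i) (hs @ [h])))) (map Suc [0..<length hs])"
    using vs by simp
  also have "map Suc [0..<length hs] = [1..<length (hs @ [h])]" by (simp add: map_Suc_upt)
  finally show ?case
    using vs ne upt_conv_Cons[of 0 "Suc (length hs)"] by simp
qed

text \<open>
  Extending by zero makes partitions that differ by zero parts equal.
\<close>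

definition row_len :: "nat list \<Rightarrow> nat \<Rightarrow> nat" where
  "row_len lam i = (if i < length lam then lam ! i else 0)"

lemma row_len_Cons [simp]: "row_len (p # P) 0 = p" "row_len (p # P) (Suc i) = row_len P i"
  by (simp_all add: row_len_def)

lemma row_len_filter_pos:
  "sorted_wrt (\<ge>) P \<Longrightarrow> row_len (filter (\<lambda>p. 0 < p) P) i = row_len P i"
proof (induction P arbitrary: i)
  case (Cons p P)
  show ?case
  proof (cases "p = 0")
    case True
    then have "\<forall>x\<in>set (p # P). x = 0" using Cons.prems by auto
    then have "filter (\<lambda>p. 0 < p) (p # P) = []" "row_len (p # P) i = 0"
      using nth_mem[of i "p # P"] by (auto simp: filter_empty_conv row_len_def simp del: nth_Cons)
    then show ?thesis by (simp add: row_len_def)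
  next
    case False
    then show ?thesis using Cons by (cases i) simp_all
  qed
qed simp

lemma row_len_append_zeros: "row_len (P @ replicate k 0) i = row_len P i"
  by (auto simp: row_len_def nth_append)

lemma antimono_row_len: "sorted_wrt (\<ge>) P \<Longrightarrow> antimono (row_len P)"
  unfolding antimono_def row_len_def by (auto simp: sorted_wrt_iff_nth_less) (metis le_neq_implies_less le_trans not_le order_refl)

lemma row_len_bracket_partition:
  assumes "length vs = Suc (length hs)"
  shows "row_len (bracket_partition hs vs) = row_len (rev (parts 0 (bead_word hs vs)))"
    and "sorted_wrt (\<ge>) (rev (parts 0 (bead_word hs vs)))"
proof -
  show s: "sorted_wrt (\<ge>) (rev (parts 0 (bead_word hs vs)))"
    using sorted_parts by (simp add: sorted_wrt_rev)
  then have "sorted_wrt (\<ge>) (concat (map (\<lambda>i. replicate (vs ! i) (sum_list (take (length hs - i) hs))) [0..<length hs]))"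
    unfolding parts_bead_word[OF assms] by (simp add: sorted_wrt_append)
  then show "row_len (bracket_partition hs vs) = row_len (rev (parts 0 (bead_word hs vs)))"
    unfolding parts_bead_word[OF assms] bracket_partition_def
    by (intro ext) (simp add: row_len_filter_pos row_len_append_zeros)
qed

lemma beads_bracket_partition:
  assumes "length vs = Suc (length hs)"
  shows "beads (sum_list vs) (row_len (bracket_partition hs vs)) ` {..<sum_list vs} = bead_set (bead_word hs vs)"
proof -
  let ?P = "parts 0 (bead_word hs vs)"
  have len: "length ?P = sum_list vs"
    using count_interleave[of "rev vs" hs] assms by (simp add: length_parts bead_word_def)
  have "beads (sum_list vs) (row_len (bracket_partition hs vs)) k = ?P ! k + k" if "k < sum_list vs" for k
    unfolding beads_def row_len_bracket_partition(1)[OF assms]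
    using that by (simp add: row_len_def len rev_nth)
  then have "beads (sum_list vs) (row_len (bracket_partition hs vs)) ` {..<sum_list vs} = (\<lambda>k. ?P ! k + k) ` {..<length ?P}"
    using len by (auto intro!: image_cong)
  then show ?thesis by (simp add: bead_set_parts)
qed

lemma row_len_bracket_partition_0:
  assumes "length vs = Suc (length hs)" "sum_list vs \<le> i"
  shows "row_len (bracket_partition hs vs) i = 0"
  unfolding row_len_bracket_partition(1)[OF assms(1)]
  using assms count_interleave[of "rev vs" hs] by (simp add: row_len_def length_parts bead_word_def)

section \<open>The character of a bracket module\<close>

lemma qvand_image:
  fixes b :: "nat \<Rightarrow> nat"
  assumes "strict_mono_on {..<m} b"
  shows "qvand t (b ` {..<m}) = (\<Prod>i<m. \<Prod>j<i. qint t (b i - b j))"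
proof -
  have lt: "b j < b i \<longleftrightarrow> j < i" if "i < m" "j < m" for i j
    using strict_mono_on_less[OF assms, of j i] that by simp
  have inj: "inj_on b {..<m}" by (rule strict_mono_on_imp_inj_on[OF assms])
  have "qvand t (b ` {..<m}) = (\<Prod>i<m. \<Prod>x\<in>{x\<in>b ` {..<m}. x < b i}. qint t (b i - x))"
    unfolding qvand_def by (subst prod.reindex[OF inj]) simp
  also have "\<dots> = (\<Prod>i<m. \<Prod>j<i. qint t (b i - b j))"
  proof (rule prod.cong[OF refl])
    fix i assume i: "i \<in> {..<m}"
    have "{x\<in>b ` {..<m}. x < b i} = b ` {..<i}" using lt i by auto
    moreover have "inj_on b {..<i}" using i by (intro inj_on_subset[OF inj]) auto
    ultimately show "(\<Prod>x\<in>{x\<in>b ` {..<m}. x < b i}. qint t (b i - x)) = (\<Prod>j<i. qint t (b i - b j))"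
      by (simp add: prod.reindex)
  qed
  finally show ?thesis .
qed

lemma prod_pairs:
  fixes x :: "nat \<Rightarrow> real"
  shows "(\<Prod>i<m. \<Prod>j<i. x i * x j) = (\<Prod>i<m. x i) ^ (m - 1)"
proof (induction m)
  case (Suc m)
  have "(\<Prod>i<Suc m. \<Prod>j<i. x i * x j) = (\<Prod>i<m. x i) ^ (m - 1) * (x m ^ m * (\<Prod>j<m. x j))"
    using Suc by (simp add: prod.distrib)
  also have "\<dots> = (\<Prod>i<Suc m. x i) ^ m"
    by (cases m) (simp_all add: power_mult_distrib mult_ac)
  finally show ?case by simp
qed simp

text \<open>
  Each difference of powers of \<open>t\<^sup>2\<close> is a power of \<open>t\<close> times a quantum integer; in the product over
  all pairs every index occurs \<open>m - 1\<close> times.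
\<close>

lemma vandermonde_qvand:
  assumes b: "strict_mono_on {..<m} b" and t: "0 < t"
  shows "vandermonde m (\<lambda>k. (t\<^sup>2) ^ b k) = t ^ ((m - 1) * (\<Sum>k<m. b k)) * qvand t (b ` {..<m})"
proof -
  have "vandermonde m (\<lambda>k. (t\<^sup>2) ^ b k) = (\<Prod>i<m. \<Prod>j<i. (t ^ b i * t ^ b j) * qint t (b i - b j))"
    unfolding vandermonde_def
  proof (intro prod.cong refl)
    fix i j assume "i \<in> {..<m}" "j \<in> {..<i}"
    then have "b j < b i" by (intro strict_mono_onD[OF b]) auto
    define d where "d = b i - b j"
    have d: "b i = b j + d" using \<open>b j < b i\<close> by (simp add: d_def)
    have sq: "(t\<^sup>2) ^ k = t ^ k * t ^ k" for k by (simp add: power2_eq_square power_mult_distrib)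
    have "A * D * (A * D) - A * A = (A * D * A) * (D - inverse D)" if "D \<noteq> 0" for A D :: real
    proof -
      have "A * D * A * (D - inverse D) = A * D * (A * D) - A * A * (D * inverse D)"
        by (simp only: algebra_simps)
      then show ?thesis using that by simp
    qed
    from this[of "t ^ d" "t ^ b j"] t
    have "(t\<^sup>2) ^ b i - (t\<^sup>2) ^ b j = (t ^ b i * t ^ b j) * (t ^ d - inverse t ^ d)"
      unfolding sq unfolding d power_add power_inverse by simp
    also note d_def
    finally show "(t\<^sup>2) ^ b i - (t\<^sup>2) ^ b j = (t ^ b i * t ^ b j) * qint t (b i - b j)"
      unfolding qint_def .
  qed
  also have "\<dots> = (\<Prod>i<m. t ^ b i) ^ (m - 1) * qvand t (b ` {..<m})"
    unfolding qvand_image[OF b] prod.distrib prod_pairs[symmetric] ..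
  also have "(\<Prod>i<m. t ^ b i) ^ (m - 1) = t ^ ((m - 1) * (\<Sum>k<m. b k))"
    unfolding power_sum[symmetric] power_mult[symmetric] by (simp only: mult.commute)
  finally show ?thesis .
qed

lemma ssyt_gf_qvand:
  assumes t: "1 < t" and la: "antimono la" and la0: "\<And>i. m \<le> i \<Longrightarrow> la i = 0"
  shows "ssyt_gf (t\<^sup>2) m la = t ^ ((m - 1) * (\<Sum>i<m. la i)) * (qvand t (beads m la ` {..<m}) / qvand t {..<m})"
proof -
  have q: "1 < t\<^sup>2" using t by (simp add: one_less_power)
  have b: "strict_mono_on {..<m} (beads m la)"
  proof (rule strict_mono_onI)
    fix r s assume "r \<in> {..<m}" "s \<in> {..<m}" "r < s"
    moreover from this have "la (m - 1 - r) \<le> la (m - 1 - s)" by (intro antimonoD[OF la]) simp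
    ultimately show "beads m la r < beads m la s" by (simp add: beads_def)
  qed
  have i: "strict_mono_on {..<m} (\<lambda>k::nat. k)" by (simp add: strict_mono_on_def)
  have "(\<Sum>k<m. beads m la k) = (\<Sum>i<m. la i) + (\<Sum>k<m. k)"
    unfolding beads_def sum.distrib using sum.nat_diff_reindex[of la m] by simp
  then have e: "t ^ ((m - 1) * (\<Sum>k<m. beads m la k)) = t ^ ((m - 1) * (\<Sum>i<m. la i)) * t ^ ((m - 1) * (\<Sum>k<m. k))"
    by (simp add: distrib_left power_add)
  have t0: "0 < t" using t by simp
  have "t ^ ((m - 1) * (\<Sum>k<m. k)) \<noteq> 0" using t by simp
  moreover have "ssyt_gf (t\<^sup>2) m la = vandermonde m (\<lambda>k. (t\<^sup>2) ^ beads m la k) / vandermonde m (\<lambda>k. (t\<^sup>2) ^ k)"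
    by (rule ssyt_gf_product[OF q la la0])
  ultimately show ?thesis
    unfolding vandermonde_qvand[OF b t0] vandermonde_qvand[OF i t0] e using t by simp
qed

definition bracket_char :: "real \<Rightarrow> nat list \<Rightarrow> nat list \<Rightarrow> real" where
  "bracket_char t hs vs = qvand t (bead_set (bead_word hs vs)) / qvand t {..<sum_list vs}"

lemma bracket_char_rev:
  assumes "1 < t" "length vs = Suc (length hs)"
  shows "bracket_char t (rev hs) (rev vs) = bracket_char t hs vs"
proof -
  have "bead_word (rev hs) (rev vs) = rev (bead_word hs vs)"
    using rev_interleave[of "rev vs" hs] assms(2) by (simp add: bead_word_def)
  then have "bead_set (bead_word (rev hs) (rev vs)) = (\<lambda>i. length (bead_word hs vs) - 1 - i) ` bead_set (bead_word hs vs)"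
    by (simp only: bead_set_rev)
  then show ?thesis
    using qvand_reflect[OF assms(1) bead_set_subset] by (simp add: bracket_char_def)
qed

text \<open>
  The words of the two brackets are \<open>Y\<close>, middle, \<open>Y*\<close>, and \<open>z\<close> beads, where \<open>Y*\<close> arises
  from \<open>Y\<close> by reversal and exchange of beads and gaps. They differ only in the middle.
\<close>

lemma bracket_char_swap:
  assumes t: "1 < t" and len: "length xs = length ys"
  shows "bracket_char t (xs @ [u] @ ys) ([z] @ xs @ [v] @ ys) = bracket_char t (xs @ [v] @ ys) ([z] @ xs @ [u] @ ys)"
proof -
  define Y where "Y = alternating xs (rev ys)"
  define n where "n = length Y"
  define L where "L = 2 * n + u + v"
  define B' where "B' = (\<lambda>b. L - 1 - b) ` ({..<n} - bead_set Y)"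
  have Y': "alternating ys (rev xs) = map Not (rev Y)"
    using rev_alternating[of xs "rev ys"] len by (simp add: Y_def)
  have word: "bead_word (xs @ [a] @ ys) ([z] @ xs @ [b] @ ys)
    = Y @ replicate b True @ replicate a False @ map Not (rev Y) @ replicate z True" for a b
  proof -
    have "bead_word (xs @ [a] @ ys) ([z] @ xs @ [b] @ ys) = interleave (xs @ [a] @ ys) ((rev ys @ [b] @ rev xs) @ [z])"
      by (simp add: bead_word_def)
    also have "\<dots> = alternating (xs @ [a] @ ys) (rev ys @ [b] @ rev xs) @ replicate z True"
      using len by (intro interleave_alternating) simp
    also have "alternating (xs @ [a] @ ys) (rev ys @ [b] @ rev xs) = Y @ replicate b True @ replicate a False @ alternating ys (rev xs)"
      using len by (simp add: alternating_append Y_def)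
    finally show ?thesis by (simp add: Y')
  qed
  have n: "n = sum_list xs + sum_list ys"
  proof -
    have "length (alternating hs vs) = sum_list hs + sum_list vs" if "length hs = length vs" for hs vs
      using that by (induction hs vs rule: list_induct2) auto
    then show ?thesis using len by (simp add: n_def Y_def)
  qed
  have set: "bead_set (Y @ replicate b True @ replicate a False @ map Not (rev Y) @ replicate z True)
    = bead_set Y \<union> {n..<n+b} \<union> B' \<union> {L..<L+z}" if ab: "a + b = u + v" for a b
  proof -
    have "bead_set (map Not (rev Y)) = {..<n} - (\<lambda>i. n - 1 - i) ` bead_set Y"
      by (simp add: bead_set_Not bead_set_rev n_def)
    also have "\<dots> = (\<lambda>i. n - 1 - i) ` ({..<n} - bead_set Y)"
    proof -
      have inj: "inj_on (\<lambda>i. n - 1 - i) {..<n}" by (auto simp: inj_on_def)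
      have "(\<lambda>i. n - 1 - i) ` {..<n} = {..<n}" by (rule endo_inj_surj[OF _ _ inj]) auto
      then show ?thesis
        using inj_on_image_set_diff[OF inj, of "{..<n}" "bead_set Y"] bead_set_subset[of Y] by (auto simp: n_def)
    qed
    finally have "(\<lambda>i. n + (b + (a + i))) ` bead_set (map Not (rev Y)) = (\<lambda>i. n + (b + (a + (n - 1 - i)))) ` ({..<n} - bead_set Y)"
      by (simp only: image_image)
    also have "\<dots> = B'"
      unfolding B'_def L_def using ab by (intro image_cong) auto
    finally have 1: "(\<lambda>i. n + (b + (a + i))) ` bead_set (map Not (rev Y)) = B'" .
    have 2: "(+) n ` {..<b} = {n..<n+b}" by (auto simp: image_iff Bex_def) presburger
    have 3: "(\<lambda>i. n + (b + (a + (n + i)))) ` {..<z} = {L..<L+z}"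
    proof (intro equalityI subsetI)
      fix x assume "x \<in> {L..<L+z}"
      then show "x \<in> (\<lambda>i. n + (b + (a + (n + i)))) ` {..<z}"
        using ab by (intro image_eqI[of _ _ "x - L"]) (auto simp: L_def)
    qed (use ab in \<open>auto simp: L_def\<close>)
    show ?thesis
      unfolding bead_set_append bead_set_replicate image_Un image_image length_replicate length_map length_rev n_def[symmetric] 1 2 3
      by blast
  qed
  have sums: "sum_list ([z] @ xs @ [b] @ ys) = n + b + z" for b by (simp add: n)
  show ?thesis
    unfolding bracket_char_def word sums set[OF refl] set[OF add.commute[of v u]]
    by (rule qvand_middle_swap[OF t bead_set_subset[of Y, folded n_def] L_def B'_def])
qed


section \<open>Symmetric powers of the standard module\<close>

definition lists_over :: "nat \<Rightarrow> 'a set \<Rightarrow> 'a list set" where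
  "lists_over n J = {l. set l \<subseteq> J \<and> length l = n}"

lemma finite_lists_over: "finite J \<Longrightarrow> finite (lists_over n J)"
  unfolding lists_over_def by (rule finite_lists_length_eq)

lemma tensor_power_supp:
  assumes "\<And>x i. x \<in> V \<Longrightarrow> i \<notin> J \<Longrightarrow> x i = 0" and "t \<in> tensor_power n V" "l \<notin> lists_over n J"
  shows "t l = 0"
  using assms(2)
proof (induction rule: tensor_power_induct)
  case (add_pure c vs t)
  have "pure_tensor vs l = 0"
  proof (cases "length l = n")
    case True
    then have "\<not> set l \<subseteq> J" using assms(3) by (simp add: lists_over_def)
    then obtain x where "x \<in> set l" "x \<notin> J" by blast
    then obtain a where "a < n" "l ! a \<notin> J" using True by (auto simp: in_set_conv_nth)
    moreover from this have "vs ! a \<in> V" using add_pure(1,2) by auto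
    ultimately have "(vs ! a) (l ! a) = 0" using assms(1) by blast
    then have "(\<Prod>i<n. (vs ! i) (l ! i)) = 0" using \<open>a < n\<close> by (intro prod_zero) auto
    then show ?thesis using True add_pure(1) by (simp add: pure_tensor_def)
  qed (use add_pure in \<open>simp add: pure_tensor_def\<close>)
  then show ?case using add_pure by (simp add: fscale_def)
qed simp

text \<open>
  The matrix of a tensor power of \<open>f\<close> is the product of the matrix entries of \<open>f\<close>. Since \<open>V\<close> may
  be a proper subspace, the matrix of \<open>f\<close> describes it only on \<open>V\<close>.
\<close>

lemma tensor_map_matrix:
  assumes V: "fun_vs.subspace V" and f: "linear_on V f" and fV: "\<And>x. x \<in> V \<Longrightarrow> f x \<in> V"
    and J: "finite J" and mat: "\<And>x i. x \<in> V \<Longrightarrow> i \<in> J \<Longrightarrow> f x i = (\<Sum>j\<in>J. A i j * x j)"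
    and t: "t \<in> tensor_power n V" and l: "l \<in> lists_over n J"
  shows "tensor_map n f t l = (\<Sum>l'\<in>lists_over n J. (\<Prod>a<n. A (l ! a) (l' ! a)) * t l')"
  using t
proof (induction rule: tensor_power_induct)
  case zero
  have z: "tensor_map n f 0 = 0" by (rule linear_on_zero[OF tensor_map_linear[OF V f fV] tensor_power_subspace])
  show ?case unfolding z by simp
next
  case (add_pure c vs t)
  note lin = tensor_map_linear[OF V f fV, of n]
  have p: "pure_tensor vs \<in> tensor_power n V" using add_pure pure_tensor_in by blast
  have len: "length l = n" "\<And>a. a < n \<Longrightarrow> l ! a \<in> J" using l by (auto simp: lists_over_def)
  have "tensor_map n f (pure_tensor vs) l = pure_tensor (map f vs) l"
    using tensor_map_pure[OF V f fV add_pure(1,2)] by simp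
  also have "\<dots> = (\<Prod>a<n. \<Sum>j\<in>J. A (l ! a) j * (vs ! a) j)"
    using add_pure(1,2) len mat[of "vs ! _" "l ! _"] by (auto simp: pure_tensor_def subset_iff intro!: prod.cong)
  also have "\<dots> = (\<Sum>l'\<in>lists_over n J. \<Prod>a<n. A (l ! a) (l' ! a) * (vs ! a) (l' ! a))"
    unfolding lists_over_def by (rule prod_sum_lists[OF J])
  also have "\<dots> = (\<Sum>l'\<in>lists_over n J. (\<Prod>a<n. A (l ! a) (l' ! a)) * pure_tensor vs l')"
    using add_pure(1) by (intro sum.cong) (auto simp: pure_tensor_def lists_over_def prod.distrib)
  finally have pure: "tensor_map n f (pure_tensor vs) l = \<dots>" .
  have "tensor_map n f (fscale c (pure_tensor vs) + t) = fscale c (tensor_map n f (pure_tensor vs)) + tensor_map n f t"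
    using linear_onD[OF lin] p add_pure(3) fun_vs.subspace_scale[OF tensor_power_subspace p] by metis
  then have "tensor_map n f (fscale c (pure_tensor vs) + t) l
    = c * (\<Sum>l'\<in>lists_over n J. (\<Prod>a<n. A (l ! a) (l' ! a)) * pure_tensor vs l') + (\<Sum>l'\<in>lists_over n J. (\<Prod>a<n. A (l ! a) (l' ! a)) * t l')"
    using pure add_pure.IH by (simp add: fscale_def)
  moreover have "(\<Sum>l'\<in>lists_over n J. (\<Prod>a<n. A (l ! a) (l' ! a)) * (fscale c (pure_tensor vs) + t) l')
    = c * (\<Sum>l'\<in>lists_over n J. (\<Prod>a<n. A (l ! a) (l' ! a)) * pure_tensor vs l') + (\<Sum>l'\<in>lists_over n J. (\<Prod>a<n. A (l ! a) (l' ! a)) * t l')"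
    by (simp add: fscale_def sum_distrib_left sum.distrib algebra_simps)
  ultimately show ?case by (simp only:)
qed

text \<open>
  The sum of all basis tensors with \<open>j\<close> letters 2 among \<open>w\<close> letters, that is, the monomial
  \<open>x\<^sup>w\<^sup>-\<^sup>j y\<^sup>j\<close> up to a scalar.
\<close>

definition sym_basis :: "nat \<Rightarrow> nat \<Rightarrow> 2 list \<Rightarrow> complex" where
  "sym_basis w j = (\<lambda>l. if length l = w \<and> count_list l 2 = j then 1 else 0)"

definition sym_point :: "nat \<Rightarrow> nat \<Rightarrow> 2 list" where
  "sym_point w j = replicate (w - j) 1 @ replicate j 2"

lemma sym_basis_point: "i \<le> w \<Longrightarrow> j \<le> w \<Longrightarrow> sym_basis w i (sym_point w j) = (if i = j then 1 else 0)"
  by (auto simp: sym_basis_def sym_point_def count_list_append count_list_replicate)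

lemma mset_two_letters: "mset l = replicate_mset (length l - count_list l 2) 1 + replicate_mset (count_list l 2) (2::2)"
proof (induction l)
  case (Cons a l)
  have le: "count_list l 2 \<le> length l" by (rule count_le_length)
  show ?case using Cons le exhaust_2[of a] by (auto simp: Suc_diff_le)
qed simp

lemma boxes_one_row: "k < w \<Longrightarrow> boxes [w] ! k = (0, k)"
  by (simp add: boxes_def)

lemma row_group_one_row: "row_group [w] = {\<sigma>. \<sigma> permutes {..<w}}"
proof -
  have "fst (boxes [w] ! \<sigma> k) = fst (boxes [w] ! k)" if "\<sigma> permutes {..<w}" "k < w" for \<sigma> k
    using that permutes_in_image[OF that(1), of k] by (simp add: boxes_one_row)
  then show ?thesis by (auto simp: row_group_def)
qed

lemma col_group_one_row: "col_group [w] = {id}"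
proof -
  have "\<sigma> = id" if s: "\<sigma> permutes {..<w}" "\<forall>k<w. snd (boxes [w] ! \<sigma> k) = snd (boxes [w] ! k)" for \<sigma>
  proof
    fix k show "\<sigma> k = id k"
    proof (cases "k < w")
      case True
      then have "\<sigma> k < w" using permutes_in_image[OF s(1), of k] by simp
      then show ?thesis using s(2)[rule_format, OF True] True by (simp add: boxes_one_row)
    qed (use permutes_not_in[OF s(1)] in simp)
  qed
  then show ?thesis by (auto simp: col_group_def permutes_id)
qed

lemma young_symmetrizer_one_row:
  assumes l: "length l = w"
  shows "young_symmetrizer [w] t l = (\<Sum>\<sigma> | \<sigma> permutes {..<w}. t (permute_list \<sigma> l))"
proof -
  have "young_symmetrizer [w] t l = row_symmetrizer [w] t l"
    by (simp add: young_symmetrizer_def col_antisymmetrizer_def col_group_one_row place_perm_def sign_id)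
  also have "\<dots> = (\<Sum>\<sigma> | \<sigma> permutes {..<w}. t (permute_list (inv \<sigma>) l))"
    unfolding row_symmetrizer_def row_group_one_row sum_apply_pointwise place_perm_def ..
  also have "\<dots> = (\<Sum>\<sigma> | \<sigma> permutes {..<w}. t (permute_list \<sigma> l))"
    by (rule sum.reindex_bij_witness[of _ inv inv]) (auto simp: permutes_inv permutes_inv_inv)
  finally show ?thesis .
qed

lemma young_symmetrizer_one_row_permute:
  assumes l: "length l = w" and \<rho>: "\<rho> permutes {..<w}"
  shows "young_symmetrizer [w] t (permute_list \<rho> l) = young_symmetrizer [w] t l"
proof -
  have "young_symmetrizer [w] t (permute_list \<rho> l) = (\<Sum>\<sigma> | \<sigma> permutes {..<w}. t (permute_list \<sigma> (permute_list \<rho> l)))"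
    using l by (intro young_symmetrizer_one_row) simp
  also have "\<dots> = (\<Sum>\<sigma> | \<sigma> permutes {..<w}. t (permute_list (\<rho> \<circ> \<sigma>) l))"
    using l by (intro sum.cong refl arg_cong[of _ _ t]) (simp add: permute_list_compose)
  also have "\<dots> = (\<Sum>\<sigma> | \<sigma> permutes {..<w}. t (permute_list \<sigma> l))"
    by (rule sum.reindex_bij_witness[of _ "\<lambda>\<sigma>. inv \<rho> \<circ> \<sigma>" "\<lambda>\<sigma>. \<rho> \<circ> \<sigma>"])
       (auto simp: fun_eq_iff permutes_inverses[OF \<rho>] intro: permutes_compose \<rho> permutes_inv)
  also have "\<dots> = young_symmetrizer [w] t l" by (rule young_symmetrizer_one_row[OF l, symmetric])
  finally show ?thesis .
qed

lemma tensor_power_UNIV: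
  assumes "\<And>l. length l \<noteq> w \<Longrightarrow> t l = 0"
  shows "t \<in> tensor_power w (UNIV :: (2 \<Rightarrow> complex) set)"
proof -
  let ?d = "\<lambda>i j :: 2. if i = j then 1 else 0 :: complex"
  have "t = (\<Sum>l'\<in>lists_over w UNIV. fscale (t l') (pure_tensor (map ?d l')))"
  proof
    fix l :: "2 list"
    have "pure_tensor (map ?d l') l = (if l = l' then 1 else 0)" if "length l' = w" for l'
    proof (cases "length l = w")
      case True
      then have "pure_tensor (map ?d l') l = (\<Prod>i<w. if l' ! i = l ! i then 1 else 0)"
        using that by (simp add: pure_tensor_def)
      also have "\<dots> = (if \<forall>i<w. l' ! i = l ! i then 1 else 0)" by (auto intro!: prod_zero)
      also have "(\<forall>i<w. l' ! i = l ! i) \<longleftrightarrow> l = l'" using True that by (auto intro: nth_equalityI)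
      finally show ?thesis .
    qed (use that in \<open>auto simp: pure_tensor_def\<close>)
    then have "(\<Sum>l'\<in>lists_over w UNIV. fscale (t l') (pure_tensor (map ?d l'))) l
      = (\<Sum>l'\<in>lists_over w UNIV. if l = l' then t l else 0)"
      unfolding sum_apply_pointwise by (intro sum.cong) (auto simp: fscale_def lists_over_def)
    also have "\<dots> = t l" using assms[of l] finite_lists_over[of "UNIV :: 2 set" w] by (auto simp: lists_over_def)
    finally show "t l = (\<Sum>l'\<in>lists_over w UNIV. fscale (t l') (pure_tensor (map ?d l'))) l" by simp
  qed
  also have "\<dots> \<in> tensor_power w UNIV"
    by (intro fun_vs.subspace_sum[OF tensor_power_subspace] fun_vs.subspace_scale[OF tensor_power_subspace] pure_tensor_in)
       (auto simp: lists_over_def)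
  finally show ?thesis .
qed

text \<open>
  A symmetric function of \<open>w = m - 1\<close> letters depends only on the number of letters 2. For
  \<open>m = 0\<close> both sides are zero, which treats the degenerate brackets like the others; here \<open>m - 1 = 0\<close>, while
  the index of \<open>sym_C2\<close> is \<open>-1\<close>.
\<close>

lemma vecs_sym_C2:
  "vecs (sym_C2 (int m - 1)) = fun_vs.span (sym_basis (m - 1) ` {..<m})"
proof (cases m)
  case 0
  then show ?thesis by (simp add: sym_C2_def zero_rep_def)
next
  case (Suc w)
  have vecs: "vecs (sym_C2 (int m - 1)) = young_symmetrizer [w] ` tensor_power w UNIV"
    using Suc by (simp add: sym_C2_def schur_def std_rep_def)
  have wm: "m - 1 = w" "{..<m} = {..w}" using Suc by auto
  show ?thesis
    unfolding vecs wm
  proof (intro equalityI subsetI)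
    fix x assume "x \<in> young_symmetrizer [w] ` tensor_power w (UNIV :: (2 \<Rightarrow> complex) set)"
    then obtain t where t: "t \<in> tensor_power w (UNIV :: (2 \<Rightarrow> complex) set)" "x = young_symmetrizer [w] t" by blast
    have xT: "x \<in> tensor_power w UNIV" unfolding t(2) using young_symmetrizer_closed[of t "[w]" UNIV] t(1) by simp
    have "x = (\<Sum>j\<le>w. fscale (x (sym_point w j)) (sym_basis w j))"
    proof
      fix l
      have "(\<Sum>j\<le>w. fscale (x (sym_point w j)) (sym_basis w j)) l = (\<Sum>j\<le>w. x (sym_point w j) * sym_basis w j l)"
        unfolding sum_apply_pointwise fscale_def ..
      also have "\<dots> = x l"
      proof (cases "length l = w")
        case False
        then have "l \<notin> lists_over w UNIV" by (simp add: lists_over_def)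
        then have "x l = 0" using tensor_power_supp[of UNIV UNIV x w l] xT by simp
        then show ?thesis using False by (simp add: sym_basis_def)
      next
        case True
        let ?j = "count_list l 2"
        have j: "?j \<le> w" using True count_le_length by metis
        have "(\<Sum>j\<le>w. x (sym_point w j) * sym_basis w j l) = (\<Sum>j\<le>w. if j = ?j then x (sym_point w ?j) else 0)"
          using True by (intro sum.cong) (auto simp: sym_basis_def)
        also have "\<dots> = x (sym_point w ?j)" using j by simp
        also have "\<dots> = x l"
        proof -
          have "mset (sym_point w ?j) = mset l" using mset_two_letters[of l] True by (simp add: sym_point_def)
          then obtain \<rho> where \<rho>: "\<rho> permutes {..<length l}" "permute_list \<rho> l = sym_point w ?j" by (rule mset_eq_permutation)
          then show ?thesis using young_symmetrizer_one_row_permute[OF True, of \<rho> t] True unfolding t(2) by simp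
        qed
        finally show ?thesis .
      qed
      finally show "x l = (\<Sum>j\<le>w. fscale (x (sym_point w j)) (sym_basis w j)) l" by simp
    qed
    also have "\<dots> \<in> fun_vs.span (sym_basis w ` {..w})"
      by (intro fun_vs.span_sum fun_vs.span_scale fun_vs.span_base imageI)
    finally show "x \<in> fun_vs.span (sym_basis w ` {..w})" .
  next
    fix x assume x: "x \<in> fun_vs.span (sym_basis w ` {..w})"
    have inv: "x (permute_list \<sigma> l) = x l \<and> (length l \<noteq> w \<longrightarrow> x l = 0)" if "\<sigma> permutes {..<length l}" for \<sigma> l
      using x
    proof (induction rule: fun_vs.span_induct_alt)
      case (step c y z)
      then obtain j where "y = sym_basis w j" by blast
      moreover have "count_list (permute_list \<sigma> l) 2 = count_list l 2"
        using mset_permute_list[OF that] by (metis count_mset)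
      ultimately show ?case using step.IH by (simp add: fscale_def sym_basis_def)
    qed simp
    have x0: "x l = 0" if "length l \<noteq> w" for l using inv[OF permutes_id, of l] that by simp
    \<comment> \<open>on symmetric functions the Young symmetrizer is multiplication by the order of the symmetric group\<close>
    let ?t = "fscale (inverse (fact w)) x"
    have "?t \<in> tensor_power w UNIV" by (rule tensor_power_UNIV) (simp add: fscale_def x0)
    moreover have "x = young_symmetrizer [w] ?t"
    proof
      fix l
      show "x l = young_symmetrizer [w] ?t l"
      proof (cases "length l = w")
        case True
        have "young_symmetrizer [w] ?t l = (\<Sum>\<sigma> | \<sigma> permutes {..<w}. inverse (fact w) * x l)"
          unfolding young_symmetrizer_one_row[OF True] using inv True by (intro sum.cong) (auto simp: fscale_def)
        also have "\<dots> = x l" using card_permutations[of "{..<w}" w] by simp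
        finally show ?thesis by simp
      next
        case False
        have "young_symmetrizer [w] ?t \<in> tensor_power w UNIV"
          using young_symmetrizer_closed[of ?t "[w]" UNIV] \<open>?t \<in> tensor_power w UNIV\<close> by simp
        then have "young_symmetrizer [w] ?t l = 0"
          by (rule tensor_power_supp[rotated]) (use False in \<open>auto simp: lists_over_def\<close>)
        then show ?thesis using x0[OF False] by simp
      qed
    qed
    ultimately show "x \<in> young_symmetrizer [w] ` tensor_power w UNIV" by blast
  qed
qed

definition sym_matrix :: "nat \<Rightarrow> complex^2^2 \<Rightarrow> 2 list \<Rightarrow> 2 list \<Rightarrow> complex" where
  "sym_matrix w g l l' = (\<Prod>b<w. g $ (l ! b) $ (l' ! b))"

lemma sl2_module_sym_C2: "sl2_module (sym_C2 k)"
  by (simp add: sym_C2_def sl2_module_schur sl2_module_std_rep sl2_module_zero_rep)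

lemma sym_C2_supp:
  assumes x: "x \<in> vecs (sym_C2 (int m - 1))" and i: "i \<notin> lists_over (m - 1) UNIV"
  shows "x i = 0"
  using x unfolding vecs_sym_C2
proof (induction rule: fun_vs.span_induct_alt)
  case (step c y z)
  then show ?case using i by (auto simp: fscale_def sym_basis_def lists_over_def)
qed simp

lemma sym_C2_act:
  assumes g: "g \<in> SL2" and x: "x \<in> vecs (sym_C2 (int m - 1))" and l: "l \<in> lists_over (m - 1) UNIV"
  shows "act (sym_C2 (int m - 1)) g x l = (\<Sum>l'\<in>lists_over (m - 1) UNIV. sym_matrix (m - 1) g l l' * x l')"
proof (cases m)
  case 0
  then have "x = 0" using x by (simp add: sym_C2_def zero_rep_def)
  then show ?thesis using 0 by (simp add: sym_C2_def zero_rep_def)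
next
  case (Suc w)
  interpret std: sl2_module std_rep by (rule sl2_module_std_rep)
  have "x \<in> young_symmetrizer [w] ` tensor_power w UNIV"
    using x Suc by (simp add: sym_C2_def schur_def std_rep_def)
  then have xT: "x \<in> tensor_power w (vecs std_rep)"
    using young_symmetrizer_closed[of _ "[w]" UNIV] by (auto simp: std_rep_def)
  have act: "act (sym_C2 (int m - 1)) g = tensor_map w (act std_rep g)"
    using Suc by (simp add: sym_C2_def schur_def)
  have wm: "m - 1 = w" using Suc by simp
  have mat: "act std_rep g y i = (\<Sum>j\<in>UNIV. g $ i $ j * y j)" for y i by (simp add: std_rep_def)
  show ?thesis
    unfolding act wm sym_matrix_def
    by (rule tensor_map_matrix[OF std.subspace std.act_linear[OF g] std.act_closed[OF g] finite_class.finite_UNIV mat xT l[unfolded wm]])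
qed

section \<open>Weights of the bracket modules\<close>

definition tensor_matrix :: "nat \<Rightarrow> nat \<Rightarrow> complex^2^2 \<Rightarrow> 2 list list \<Rightarrow> 2 list list \<Rightarrow> complex" where
  "tensor_matrix n w g L L' = (\<Prod>a<n. sym_matrix w g (L ! a) (L' ! a))"

definition letter_weight :: "2 \<Rightarrow> int" where
  "letter_weight i = (if i = 1 then 1 else - 1)"

definition tensor_weight :: "nat \<Rightarrow> nat \<Rightarrow> 2 list list \<Rightarrow> int" where
  "tensor_weight n w L = (\<Sum>a<n. \<Sum>b<w. letter_weight (L ! a ! b))"

lemma upper_unip_entry: "upper_unip s $ i $ j = (if i = j then 1 else if i = 1 then s else 0)"
  using exhaust_2[of i] exhaust_2[of j] by (auto simp: upper_unip_def)

lemma torus_entry: "torus a $ i $ j = (if i = j then a powi letter_weight i else 0)"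
  using exhaust_2[of i] exhaust_2[of j] by (auto simp: torus_def letter_weight_def)

lemma mult_lower_unip_entry: "(g ** lower_unip t) $ i $ j = (if j = 1 then g $ i $ 1 + g $ i $ 2 * t else g $ i $ 2)"
  using exhaust_2[of j] by (auto simp: lower_unip_def matrix_matrix_mult_def UNIV_2)

lemma index_lists_ext:
  assumes "L \<in> lists_over n (lists_over w UNIV)" "L' \<in> lists_over n (lists_over w UNIV)"
    and "\<And>a b. a < n \<Longrightarrow> b < w \<Longrightarrow> L ! a ! b = L' ! a ! b"
  shows "L = L'"
proof (rule nth_equalityI)
  fix a assume "a < length L"
  then have "a < n" "L ! a \<in> set L" "L' ! a \<in> set L'"
    using assms(1,2) by (simp_all add: lists_over_def)
  moreover have "set L \<subseteq> lists_over w UNIV" "set L' \<subseteq> lists_over w UNIV"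
    using assms(1,2) unfolding lists_over_def[of n] by blast+
  ultimately have "L ! a \<in> lists_over w UNIV" "L' ! a \<in> lists_over w UNIV" "a < n" by blast+
  then show "L ! a = L' ! a" using assms(3) by (auto simp: lists_over_def intro: nth_equalityI)
qed (use assms(1,2) in \<open>auto simp: lists_over_def\<close>)

text \<open>
  All conditions are inherited from the standard module, whose matrix entries are those of
  \<open>g\<close> itself: products of matrix entries have adjoints, diagonal values and continuity factor by factor, and a
  nonzero entry for an upper unipotent matrix means that letters 2 of the column index at most
  become letters 1 of the row index.
\<close>

lemma unitary_module_schur_sym:
  fixes m lam
  defines "w \<equiv> m - 1" and "n \<equiv> sum_list lam"
  shows "unitary_module (schur lam (sym_C2 (int m - 1))) (lists_over n (lists_over w UNIV)) (tensor_matrix n w) (tensor_weight n w)"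
proof -
  let ?B = "sym_C2 (int m - 1)" and ?I = "lists_over n (lists_over w (UNIV :: 2 set))"
  interpret B: sl2_module ?B by (rule sl2_module_sym_C2)
  have inT: "x \<in> tensor_power n (vecs ?B)" if "x \<in> vecs (schur lam ?B)" for x
    using that young_symmetrizer_closed[of _ lam "vecs ?B"] by (auto simp: schur_def n_def)
  have finJ: "finite (lists_over w (UNIV :: 2 set))" by (intro finite_lists_over) simp
  show ?thesis
  proof (rule unitary_module.intro)
    show "sl2_module (schur lam ?B)" by (rule sl2_module_schur[OF sl2_module_sym_C2])
    show "finite ?I" by (rule finite_lists_over[OF finJ])
    show "x L = 0" if "x \<in> vecs (schur lam ?B)" "L \<notin> ?I" for x L
      by (rule tensor_power_supp[OF _ inT[OF that(1)] that(2)]) (use sym_C2_supp in \<open>simp add: w_def\<close>)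
    show "act (schur lam ?B) g x L = (\<Sum>L'\<in>?I. tensor_matrix n w g L L' * x L')"
      if g: "g \<in> SL2" and x: "x \<in> vecs (schur lam ?B)" and L: "L \<in> ?I" for g x L
    proof -
      have mat: "act ?B g y i = (\<Sum>j\<in>lists_over w UNIV. sym_matrix w g i j * y j)"
        if "y \<in> vecs ?B" "i \<in> lists_over w UNIV" for y i
        using that unfolding w_def by (rule sym_C2_act[OF g])
      have "act (schur lam ?B) g x L = tensor_map n (act ?B g) x L" by (simp add: schur_def n_def)
      also have "\<dots> = (\<Sum>L'\<in>?I. tensor_matrix n w g L L' * x L')"
        unfolding tensor_matrix_def
        by (rule tensor_map_matrix[OF B.subspace B.act_linear[OF g] B.act_closed[OF g] finJ mat inT[OF x] L])
      finally show ?thesis .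
    qed
    show "tensor_matrix n w (adj2 g) L L' = cnj (tensor_matrix n w g L' L)" for g L L'
      by (simp add: tensor_matrix_def sym_matrix_def adj2_def)
    show "tensor_matrix n w (torus a) L L' = (if L = L' then a powi tensor_weight n w L else 0)"
      if a: "a \<noteq> 0" and L: "L \<in> ?I" "L' \<in> ?I" for a L L'
    proof (cases "L = L'")
      case True
      have "a powi (\<Sum>k<N. f k) = (\<Prod>k<N. a powi f k)" for f and N :: nat
        using a by (induction N) (simp_all add: power_int_add)
      then show ?thesis using True
        by (simp add: tensor_matrix_def sym_matrix_def torus_entry tensor_weight_def)
    next
      case False
      then obtain a' b where "a' < n" "b < w" "L ! a' ! b \<noteq> L' ! a' ! b" using index_lists_ext[OF L] by blast
      then have "sym_matrix w (torus a) (L ! a') (L' ! a') = 0" "a' < n"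
        by (auto simp: sym_matrix_def torus_entry intro!: prod_zero)
      then have "tensor_matrix n w (torus a) L L' = 0" unfolding tensor_matrix_def by (intro prod_zero) auto
      then show ?thesis using False by simp
    qed
    show "tensor_matrix n w (upper_unip s) L L = 1" for s L
      by (simp add: tensor_matrix_def sym_matrix_def upper_unip_entry)
    show "tensor_weight n w L' < tensor_weight n w L"
      if L: "L \<in> ?I" "L' \<in> ?I" "L \<noteq> L'" and nz: "tensor_matrix n w (upper_unip s) L L' \<noteq> 0" for L L' s
    proof -
      have nz': "upper_unip s $ (L ! a ! b) $ (L' ! a ! b) \<noteq> 0" if "a < n" "b < w" for a b
        using nz that unfolding tensor_matrix_def sym_matrix_def by (auto simp: prod_zero_iff)
      have le: "letter_weight (L' ! a ! b) \<le> letter_weight (L ! a ! b)" if "a < n" "b < w" for a b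
        using nz'[OF that] by (auto simp: upper_unip_entry letter_weight_def split: if_splits)
      obtain a b where ab: "a < n" "b < w" "L ! a ! b \<noteq> L' ! a ! b" using index_lists_ext[OF L(1,2)] L(3) by blast
      have lt: "letter_weight (L' ! a ! b) < letter_weight (L ! a ! b)"
        using nz'[OF ab(1,2)] ab(3) by (auto simp: upper_unip_entry letter_weight_def split: if_splits)
      have "(\<Sum>b<w. letter_weight (L' ! a ! b)) < (\<Sum>b<w. letter_weight (L ! a ! b))"
        using ab lt le[OF ab(1)] by (intro sum_strict_mono_ex1) auto
      then show ?thesis
        unfolding tensor_weight_def using ab le by (intro sum_strict_mono_ex1) (auto intro!: sum_mono)
    qed
    have isCont_if: "isCont (\<lambda>t. if P then f t else c) x" if "isCont f x" for P and f :: "complex \<Rightarrow> complex" and c x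
      using that by (cases P) simp_all
    show "isCont (\<lambda>t. tensor_matrix n w (g ** lower_unip t) L L') 0" for g L L'
      unfolding tensor_matrix_def sym_matrix_def mult_lower_unip_entry
      by (intro continuous_intros isCont_if)
  qed
qed

lemma sum_letter_weight: "(\<Sum>b<length l. letter_weight (l ! b)) = int (length l) - 2 * int (count_list l 2)"
proof (induction l)
  case (Cons a l)
  then show ?case using exhaust_2[of a]
    by (auto simp: sum.lessThan_Suc_shift letter_weight_def simp del: sum.lessThan_Suc)
qed simp

section \<open>Comparison of characters\<close>

text \<open>
  After multiplication by a power of \<open>t\<close> both sides are polynomials that agree at
  infinitely many points.
\<close>

lemma finite_sum_powi_determines_counts:
  fixes f :: "'a \<Rightarrow> int" and g :: "'b \<Rightarrow> int"
  assumes A: "finite A" and B: "finite B"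
    and eq: "\<And>t::real. 1 < t \<Longrightarrow> (\<Sum>a\<in>A. t powi f a) = (\<Sum>b\<in>B. t powi g b)"
  shows "card {a\<in>A. f a = k} = card {b\<in>B. g b = k}"
proof -
  define K where "K = nat (\<Sum>a\<in>A. \<bar>f a\<bar>) + nat (\<Sum>b\<in>B. \<bar>g b\<bar>) + nat \<bar>k\<bar>"
  have K: "int K = (\<Sum>a\<in>A. \<bar>f a\<bar>) + (\<Sum>b\<in>B. \<bar>g b\<bar>) + \<bar>k\<bar>"
    unfolding K_def by (simp add: sum_nonneg)
  have nonneg: "0 \<le> (\<Sum>a\<in>A. \<bar>f a\<bar>)" "0 \<le> (\<Sum>b\<in>B. \<bar>g b\<bar>)" by (simp_all add: sum_nonneg)
  have fK: "0 \<le> f a + int K" if "a \<in> A" for a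
  proof -
    have "\<bar>f a\<bar> \<le> (\<Sum>a\<in>A. \<bar>f a\<bar>)" using that A by (intro member_le_sum) auto
    then show ?thesis using nonneg K abs_ge_minus_self[of "f a"] abs_ge_zero[of k] by linarith
  qed
  have gK: "0 \<le> g b + int K" if "b \<in> B" for b
  proof -
    have "\<bar>g b\<bar> \<le> (\<Sum>b\<in>B. \<bar>g b\<bar>)" using that B by (intro member_le_sum) auto
    then show ?thesis using nonneg K abs_ge_minus_self[of "g b"] abs_ge_zero[of k] by linarith
  qed
  have kK: "0 \<le> k + int K" using nonneg K abs_ge_minus_self[of k] by linarith
  define p q :: "real poly" where "p = (\<Sum>a\<in>A. monom 1 (nat (f a + int K)))" and "q = (\<Sum>b\<in>B. monom 1 (nat (g b + int K)))"
  have pw: "t ^ nat (i + int K) = t ^ K * t powi i" if "1 < t" "0 \<le> i + int K" for t :: real and i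
  proof -
    have "t ^ nat (i + int K) = t powi (i + int K)" using that(2) by (simp add: power_int_def)
    also have "\<dots> = t ^ K * t powi i" using that(1) by (simp add: power_int_add)
    finally show ?thesis .
  qed
  have "poly p t = poly q t" if t: "1 < t" for t
  proof -
    have "poly p t = t ^ K * (\<Sum>a\<in>A. t powi f a)"
      unfolding p_def poly_sum poly_monom sum_distrib_left using pw[OF t] fK by (intro sum.cong) auto
    moreover have "poly q t = t ^ K * (\<Sum>b\<in>B. t powi g b)"
      unfolding q_def poly_sum poly_monom sum_distrib_left using pw[OF t] gK by (intro sum.cong) auto
    ultimately show ?thesis using eq[OF t] by simp
  qed
  then have "{1<..} \<subseteq> {t. poly (p - q) t = 0}" by auto
  then have "infinite {t. poly (p - q) t = 0}" using infinite_Ioi[of "1::real"] finite_subset by blast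
  then have "p - q = 0" using poly_roots_finite by blast
  then have "coeff p (nat (k + int K)) = coeff q (nat (k + int K))" by simp
  moreover have "coeff p (nat (k + int K)) = of_nat (card {a\<in>A. f a = k})"
  proof -
    have "coeff p (nat (k + int K)) = (\<Sum>a\<in>A. if f a = k then 1 else 0)"
      unfolding p_def coeff_sum coeff_monom using fK kK by (intro sum.cong) (auto simp: nat_eq_iff)
    then show ?thesis using A by (simp add: sum.If_cases Int_def)
  qed
  moreover have "coeff q (nat (k + int K)) = of_nat (card {b\<in>B. g b = k})"
  proof -
    have "coeff q (nat (k + int K)) = (\<Sum>b\<in>B. if g b = k then 1 else 0)"
      unfolding q_def coeff_sum coeff_monom using gK kK by (intro sum.cong) (auto simp: nat_eq_iff)
    then show ?thesis using B by (simp add: sum.If_cases Int_def)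
  qed
  ultimately show ?thesis by simp
qed

lemma tableau_basis_sym: "sorted_wrt (\<ge>) lam \<Longrightarrow> tableau_basis lam m (sym_basis (m - 1)) (sym_point (m - 1))"
  by unfold_locales (auto simp: sym_basis_point)

context tableau_basis
begin

lemma sum_permute_list:
  assumes T: "T \<in> fillings" and \<sigma>: "\<sigma> permutes {..<n}"
  shows "(\<Sum>k<n. f (permute_list \<sigma> T ! k)) = (\<Sum>k<n. f (T ! k))"
proof -
  have "(\<Sum>k<n. f (permute_list \<sigma> T ! k)) = (\<Sum>k<n. f (T ! \<sigma> k))"
    using permute_nth[OF T \<sigma>] by (intro sum.cong) auto
  also have "\<dots> = (\<Sum>k<n. f (T ! k))" using sum.permute[OF \<sigma>, of "\<lambda>k. f (T ! k)"] by (simp add: o_def)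
  finally show ?thesis .
qed

lemma D_nonzero_imp_e_nonzero:
  assumes T: "T \<in> fillings" and nz: "D T L \<noteq> 0"
  shows "\<exists>\<rho>. \<rho> permutes {..<n} \<and> e (permute_list \<rho> T) L \<noteq> 0"
proof -
  have "(\<Sum>\<sigma>\<in>fibre_perms n row. col_antisymmetrizer lam (e (permute_list \<sigma> T)) L) \<noteq> 0"
    using nz unfolding D_eq[OF T] sum_apply_pointwise .
  then obtain \<sigma> where \<sigma>: "\<sigma> \<in> fibre_perms n row" and "col_antisymmetrizer lam (e (permute_list \<sigma> T)) L \<noteq> 0"
    by (rule sum.not_neutral_contains_not_neutral)
  then have "(\<Sum>\<tau>\<in>fibre_perms n col. fscale (of_int (sign \<tau>)) (e (permute_list \<tau> (permute_list \<sigma> T))) L) \<noteq> 0"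
    unfolding col_antisymmetrizer_e[OF fillings_permute[OF T fibre_permsD(1)[OF \<sigma>]]] sum_apply_pointwise by simp
  then obtain \<tau> where \<tau>: "\<tau> \<in> fibre_perms n col" and "fscale (of_int (sign \<tau>)) (e (permute_list \<tau> (permute_list \<sigma> T))) L \<noteq> 0"
    by (rule sum.not_neutral_contains_not_neutral)
  then have "e (permute_list (\<sigma> \<circ> \<tau>) T) L \<noteq> 0"
    unfolding permute_comp[OF T fibre_permsD(1)[OF \<tau>]] by (auto simp: fscale_def)
  then show ?thesis using permutes_compose[OF fibre_permsD(1)[OF \<tau>] fibre_permsD(1)[OF \<sigma>]] by blast
qed

lemma inj_on_D: "inj_on D ssyt"
proof (rule inj_onI, rule ccontr)
  fix S T assume S: "S \<in> ssyt" and T: "T \<in> ssyt" and eq: "D S = D T" and ne: "S \<noteq> T"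
  let ?c = "\<lambda>R. if R = S then 1 else if R = T then - 1 else 0 :: complex"
  have "(\<Sum>R\<in>ssyt. fscale (?c R) (D R)) = 0"
  proof
    fix L
    have "(\<Sum>R\<in>ssyt. fscale (?c R) (D R)) L = (\<Sum>R\<in>ssyt. (if R = S then D S L else 0) - (if R = T then D T L else 0))"
      unfolding sum_apply_pointwise using ne by (intro sum.cong) (auto simp: fscale_def)
    also have "\<dots> = 0" using S T finite_ssyt eq by (simp add: sum_subtractf)
    finally show "(\<Sum>R\<in>ssyt. fscale (?c R) (D R)) L = 0 L" by simp
  qed
  from ssyt_independent[OF this S] show False by simp
qed

lemma independent_D: "A \<subseteq> ssyt \<Longrightarrow> fun_vs.independent (D ` A)"
proof -
  assume "A \<subseteq> ssyt"
  moreover have "fun_vs.independent (D ` ssyt)"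
  proof (rule fun_vs.independent_if_scalars_zero)
    show "finite (D ` ssyt)" using finite_ssyt by blast
    fix f x assume z: "(\<Sum>x\<in>D ` ssyt. fscale (f x) x) = 0" and x: "x \<in> D ` ssyt"
    have "(\<Sum>T\<in>ssyt. fscale (f (D T)) (D T)) = 0" using z unfolding sum.reindex[OF inj_on_D] o_def .
    from ssyt_independent[OF this] x show "f x = 0" by blast
  qed
  ultimately show ?thesis using fun_vs.independent_mono[OF _ image_mono] by blast
qed

lemma span_D_expansion:
  assumes "x \<in> fun_vs.span (D ` ssyt)"
  shows "\<exists>c. x = (\<Sum>T\<in>ssyt. fscale (c T) (D T))"
proof -
  obtain u where "x = (\<Sum>v\<in>D ` ssyt. fscale (u v) v)"
    using assms unfolding fun_vs.span_finite[OF finite_imageI[OF finite_ssyt]] by blast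
  then have "x = (\<Sum>T\<in>ssyt. fscale (u (D T)) (D T))" unfolding sum.reindex[OF inj_on_D] o_def .
  then show ?thesis by (rule exI[of _ "\<lambda>T. u (D T)"])
qed

end

text \<open>
  The basis vectors \<open>D T\<close> are weight vectors, so those of the right weight are a basis of
  the weight space.
\<close>

lemma dim_wspace_schur_sym:
  fixes m :: nat and lam :: "nat list"
  defines "w \<equiv> m - 1" and "n \<equiv> sum_list lam"
  assumes lam: "sorted_wrt (\<ge>) lam"
  shows "fun_vs.dim (unitary_module.wspace (lists_over n (lists_over w UNIV)) (tensor_weight n w) k (vecs (schur lam (sym_C2 (int m - 1)))))
    = card {T\<in>tableau_basis.ssyt lam m. (\<Sum>j<n. int w - 2 * int (T ! j)) = k}"
proof -
  let ?M = "schur lam (sym_C2 (int m - 1))" and ?wt = "\<lambda>T. \<Sum>j<n. int w - 2 * int (T ! j)"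
  interpret tb: tableau_basis lam m "sym_basis w" "sym_point w" unfolding w_def by (rule tableau_basis_sym[OF lam])
  interpret um: unitary_module ?M "lists_over n (lists_over w UNIV)" "tensor_matrix n w" "tensor_weight n w"
    unfolding n_def w_def by (rule unitary_module_schur_sym)
  have n: "tb.n = n" by (simp add: tb.n_def n_def)
  have vecs: "vecs ?M = fun_vs.span (tb.D ` tb.ssyt)"
  proof -
    have "vecs ?M = young_symmetrizer lam ` tensor_power n (vecs (sym_C2 (int m - 1)))" by (simp add: schur_def n_def)
    also have "vecs (sym_C2 (int m - 1)) = fun_vs.span (sym_basis w ` {..<m})" unfolding w_def by (rule vecs_sym_C2)
    finally show ?thesis using tb.young_image_span unfolding n by (simp only:)
  qed
  have e_wt: "tensor_weight n w L = ?wt T" if "T \<in> tb.fillings" "tb.e T L \<noteq> 0" for T L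
  proof -
    have T: "length T = n" using that(1) by (simp add: tb.fillings_def n)
    have L: "length L = n" using that(2) T by (auto simp: tb.e_def pure_tensor_def split: if_splits)
    have "(\<Prod>a<n. sym_basis w (T ! a) (L ! a)) \<noteq> 0"
      using that(2) T L by (auto simp: tb.e_def pure_tensor_def split: if_splits)
    then have "length (L ! a) = w \<and> count_list (L ! a) 2 = T ! a" if "a < n" for a
      using that by (auto simp: prod_zero_iff sym_basis_def split: if_splits)
    then show ?thesis unfolding tensor_weight_def using sum_letter_weight by (intro sum.cong) (auto, metis)
  qed
  have D_wt: "tensor_weight n w L = ?wt T" if TF: "T \<in> tb.fillings" and nz: "tb.D T L \<noteq> 0" for T L
  proof -
    obtain \<rho> where \<rho>: "\<rho> permutes {..<n}" "tb.e (permute_list \<rho> T) L \<noteq> 0"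
      using tb.D_nonzero_imp_e_nonzero[OF TF nz] unfolding n by blast
    have "tensor_weight n w L = ?wt (permute_list \<rho> T)"
      using e_wt[OF tb.fillings_permute[OF TF] \<rho>(2)] \<rho>(1) by (simp add: n)
    also have "\<dots> = ?wt T" using tb.sum_permute_list[OF TF, of \<rho> "\<lambda>x. int w - 2 * int x"] \<rho>(1) by (simp add: n)
    finally show ?thesis .
  qed
  let ?A = "{T\<in>tb.ssyt. ?wt T = k}"
  have sub: "tb.D ` ?A \<subseteq> um.wspace k (vecs ?M)"
  proof
    fix x assume "x \<in> tb.D ` ?A"
    then obtain T where T: "T \<in> tb.ssyt" "?wt T = k" "x = tb.D T" by blast
    have "x \<in> vecs ?M" unfolding vecs T(3) using T(1) by (intro fun_vs.span_base imageI)
    then show "x \<in> um.wspace k (vecs ?M)" using D_wt[OF tb.ssyt_fillings[OF T(1)]] T(2,3) by (auto simp: um.wspace_def)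
  qed
  have span: "um.wspace k (vecs ?M) \<subseteq> fun_vs.span (tb.D ` ?A)"
  proof
    fix z assume z: "z \<in> um.wspace k (vecs ?M)"
    then have "z \<in> fun_vs.span (tb.D ` tb.ssyt)" unfolding um.wspace_def vecs by blast
    then obtain c where c: "z = (\<Sum>T\<in>tb.ssyt. fscale (c T) (tb.D T))" using tb.span_D_expansion by blast
    have "z = um.wproj k z" by (rule um.wproj_id[OF z um.submodule_vecs, symmetric])
    also have "\<dots> = (\<Sum>T\<in>?A. fscale (c T) (tb.D T))"
    proof
      fix L
      have "um.wproj k z L = (\<Sum>T\<in>tb.ssyt. if tensor_weight n w L = k then c T * tb.D T L else 0)"
        unfolding um.wproj_def c sum_apply_pointwise fscale_def by simp
      also have "\<dots> = (\<Sum>T\<in>tb.ssyt. if ?wt T = k then c T * tb.D T L else 0)"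
        using D_wt[OF tb.ssyt_fillings, of _ L] by (intro sum.cong refl) (metis mult_zero_right)
      also have "\<dots> = (\<Sum>T\<in>?A. c T * tb.D T L)" using tb.finite_ssyt by (simp add: sum.inter_filter)
      finally show "um.wproj k z L = (\<Sum>T\<in>?A. fscale (c T) (tb.D T)) L" unfolding sum_apply_pointwise fscale_def .
    qed
    also have "\<dots> \<in> fun_vs.span (tb.D ` ?A)" by (intro fun_vs.span_sum fun_vs.span_scale fun_vs.span_base imageI)
    finally show "z \<in> fun_vs.span (tb.D ` ?A)" .
  qed
  have AS: "?A \<subseteq> tb.ssyt" by blast
  have "card (tb.D ` ?A) = fun_vs.dim (um.wspace k (vecs ?M))"
    by (rule fun_vs.basis_card_eq_dim[OF sub span tb.independent_D[OF AS]])
  then show ?thesis using card_image[OF inj_on_subset[OF tb.inj_on_D AS]] by simp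
qed

context tableau_basis
begin

definition filling_of :: "(nat \<Rightarrow> nat \<Rightarrow> nat) \<Rightarrow> nat list" where
  "filling_of F = map (\<lambda>k. F (row k) (col k)) [0..<n]"

lemma box_row_len: "k < n \<Longrightarrow> col k < row_len lam (row k)"
  using box_in[of k] by (simp add: row_len_def)

lemma box_exists_row_len: "j < row_len lam i \<Longrightarrow> \<exists>k<n. row k = i \<and> col k = j"
  by (rule box_exists) (auto simp: row_len_def split: if_splits)

text \<open>
  The two descriptions of tableaux, by reading order and by row and column, agree.
\<close>

lemma bij_filling_of: "bij_betw filling_of (ssyt_fun m (row_len lam)) ssyt"
proof (rule bij_betw_imageI)
  have nth: "filling_of F ! k = F (row k) (col k)" if "k < n" for F k using that by (simp add: filling_of_def)
  show "inj_on filling_of (ssyt_fun m (row_len lam))"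
  proof (rule inj_onI)
    fix F G assume F: "F \<in> ssyt_fun m (row_len lam)" and G: "G \<in> ssyt_fun m (row_len lam)" and eq: "filling_of F = filling_of G"
    show "F = G"
    proof (intro ext)
      fix i j
      show "F i j = G i j"
      proof (cases "j < row_len lam i")
        case True
        then obtain k where "k < n" "row k = i" "col k = j" using box_exists_row_len by blast
        then show ?thesis using nth[of k F] nth[of k G] eq by simp
      next
        case False
        then show ?thesis using ssyt_funD(1)[OF F, of i j] ssyt_funD(1)[OF G, of i j] by simp
      qed
    qed
  qed
  show "filling_of ` ssyt_fun m (row_len lam) = ssyt"
  proof (intro equalityI subsetI)
    fix T assume "T \<in> filling_of ` ssyt_fun m (row_len lam)"
    then obtain F where F: "F \<in> ssyt_fun m (row_len lam)" and T: "T = filling_of F" by blast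
    have len: "length T = n" by (simp add: T filling_of_def)
    have "T ! k < m" if "k < n" for k using ssyt_funD(2)[OF F box_row_len[OF that]] nth[OF that] T by simp
    then have "T \<in> fillings" using len by (auto simp: fillings_def in_set_conv_nth)
    moreover have "T ! k \<le> T ! k'" if "k < n" "k' < n" "row k = row k'" "col k \<le> col k'" for k k'
      using ssyt_funD(3)[OF F that(4) box_row_len[OF that(2)]] that nth T by simp
    moreover have "T ! k < T ! k'" if "k < n" "k' < n" "col k = col k'" "row k' = Suc (row k)" for k k'
      using ssyt_funD(4)[OF F, of "col k'" "row k"] box_row_len[OF that(2)] that nth T by simp
    ultimately show "T \<in> ssyt" by (auto simp: ssyt_def)
  next
    fix T assume T: "T \<in> ssyt"
    define idx where "idx i j = (SOME k. k < n \<and> row k = i \<and> col k = j)" for i j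
    have idx: "idx i j < n \<and> row (idx i j) = i \<and> col (idx i j) = j" if "j < row_len lam i" for i j
      unfolding idx_def by (rule someI_ex) (use box_exists_row_len[OF that] in blast)
    have idx_box: "idx (row k) (col k) = k" if "k < n" for k
      using idx[OF box_row_len[OF that]] box_inject that by blast
    define F where "F i j = (if j < row_len lam i then T ! idx i j else 0)" for i j
    have la: "row_len lam (Suc i) \<le> row_len lam i" for i
      using sorted_wrt_nth_less[OF partition, of i "Suc i"] by (simp add: row_len_def)
    have "F \<in> ssyt_fun m (row_len lam)"
      unfolding ssyt_fun_def
    proof (intro CollectI conjI allI impI)
      fix i j assume "j < row_len lam i"
      then show "F i j < m" using filling_less[OF ssyt_fillings[OF T]] idx by (simp add: F_def)
    next
      fix i j j' assume "j \<le> j'" "j' < row_len lam i"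
      then show "F i j \<le> F i j'" using ssyt_row[OF T, of "idx i j" "idx i j'"] idx[of j i] idx[of j' i] by (simp add: F_def)
    next
      fix i j assume j: "j < row_len lam (Suc i)"
      then have "j < row_len lam i" using la[of i] by simp
      then show "F i j < F (Suc i) j"
        using ssyt_col[OF T, of "idx i j" "idx (Suc i) j" 0] idx[of j i] idx[OF j] j by (simp add: F_def)
    qed (simp add: F_def)
    moreover have "filling_of F = T"
      using ssyt_fillings[OF T] by (intro nth_equalityI) (auto simp: filling_of_def fillings_def F_def box_row_len idx_box)
    ultimately show "T \<in> filling_of ` ssyt_fun m (row_len lam)" by blast
  qed
qed

lemma bij_boxes:
  assumes la0: "\<And>i. m \<le> i \<Longrightarrow> row_len lam i = 0"
  shows "bij_betw (\<lambda>k. (row k, col k)) {..<n} (Sigma {..<m} (\<lambda>i. {..<row_len lam i}))"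
proof (rule bij_betw_imageI)
  show "inj_on (\<lambda>k. (row k, col k)) {..<n}" by (rule inj_onI) (auto intro: box_inject)
  show "(\<lambda>k. (row k, col k)) ` {..<n} = Sigma {..<m} (\<lambda>i. {..<row_len lam i})"
  proof (intro equalityI subsetI)
    fix q assume "q \<in> (\<lambda>k. (row k, col k)) ` {..<n}"
    then obtain k where k: "k < n" "q = (row k, col k)" by blast
    have "row k < m" using la0[of "row k"] box_row_len[OF k(1)] by (cases "m \<le> row k") auto
    then show "q \<in> Sigma {..<m} (\<lambda>i. {..<row_len lam i})" using k box_row_len[OF k(1)] by auto
  next
    fix q assume "q \<in> Sigma {..<m} (\<lambda>i. {..<row_len lam i})"
    then obtain i j where q: "q = (i, j)" "j < row_len lam i" by auto
    obtain k where "k < n" "row k = i" "col k = j" using box_exists_row_len[OF q(2)] by blast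
    then show "q \<in> (\<lambda>k. (row k, col k)) ` {..<n}" using q(1) by auto
  qed
qed

text \<open>
  The weight of a tableau is symmetrized: each entry \<open>x\<close> counts \<open>m - 1 - 2 x\<close>. The resulting
  power of \<open>t\<close> in front of the Schur function cancels against the one from \<open>ssyt_gf_qvand\<close>, and an expression in
  quantum integers remains, in which shapes with different numbers of boxes can be compared.
\<close>

lemma ssyt_character:
  fixes t :: real
  assumes t: "1 < t" and la0: "\<And>i. m \<le> i \<Longrightarrow> row_len lam i = 0"
  shows "(\<Sum>T\<in>ssyt. t powi (\<Sum>j<n. int (m - 1) - 2 * int (T ! j)))
    = qvand t (beads m (row_len lam) ` {..<m}) / qvand t {..<m}"
proof -
  let ?S = "Sigma {..<m} (\<lambda>i. {..<row_len lam i})" and ?w = "m - 1"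
  note bij = bij_boxes[OF la0]
  have t0: "t \<noteq> 0" using t by simp
  have n_eq: "n = (\<Sum>i<m. row_len lam i)" using bij_betw_same_card[OF bij] by simp
  have summand: "t powi (\<Sum>j<n. int ?w - 2 * int (filling_of F ! j)) = (\<Prod>i<m. \<Prod>j<row_len lam i. (t\<^sup>2) ^ (m - 1 - F i j)) / t ^ (?w * n)"
    if F: "F \<in> ssyt_fun m (row_len lam)" for F
  proof -
    have "t powi (\<Sum>k<N. f k) = (\<Prod>k<N. t powi f k)" for f and N :: nat
      using t by (induction N) (simp_all add: power_int_add)
    then have "t powi (\<Sum>j<n. int ?w - 2 * int (filling_of F ! j)) = (\<Prod>k<n. t powi (int ?w - 2 * int (F (row k) (col k))))"
      by (simp add: filling_of_def)
    also have "\<dots> = (\<Prod>k<n. (t\<^sup>2) ^ (?w - F (row k) (col k)) / t ^ ?w)"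
    proof (intro prod.cong refl)
      fix k assume "k \<in> {..<n}"
      then have "F (row k) (col k) < m" using ssyt_funD(2)[OF F box_row_len] by simp
      then have "int ?w - 2 * int (F (row k) (col k)) = int (2 * (?w - F (row k) (col k))) - int ?w" by simp
      then have "t powi (int ?w - 2 * int (F (row k) (col k))) = t ^ (2 * (?w - F (row k) (col k))) / t ^ ?w"
        using t by (simp only: power_int_diff[OF disjI1[OF t0]] power_int_of_nat)
      then show "t powi (int ?w - 2 * int (F (row k) (col k))) = (t\<^sup>2) ^ (?w - F (row k) (col k)) / t ^ ?w"
        by (simp only: power_mult)
    qed
    also have "\<dots> = (\<Prod>k<n. (t\<^sup>2) ^ (?w - F (row k) (col k))) / t ^ (?w * n)"
      by (simp add: prod_dividef power_mult)
    also have "(\<Prod>k<n. (t\<^sup>2) ^ (?w - F (row k) (col k))) = (\<Prod>(i,j)\<in>?S. (t\<^sup>2) ^ (?w - F i j))"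
      using prod.reindex_bij_betw[OF bij, of "\<lambda>(i,j). (t\<^sup>2) ^ (?w - F i j)"] by simp
    also have "\<dots> = (\<Prod>i<m. \<Prod>j<row_len lam i. (t\<^sup>2) ^ (m - 1 - F i j))"
      by (subst prod.Sigma) auto
    finally show ?thesis .
  qed
  have gf: "ssyt_gf (t\<^sup>2) m (row_len lam)
    = t ^ (?w * (\<Sum>i<m. row_len lam i)) * (qvand t (beads m (row_len lam) ` {..<m}) / qvand t {..<m})"
    by (rule ssyt_gf_qvand[OF t antimono_row_len[OF partition] la0])
  have "(\<Sum>T\<in>ssyt. t powi (\<Sum>j<n. int ?w - 2 * int (T ! j))) = (\<Sum>F\<in>ssyt_fun m (row_len lam). t powi (\<Sum>j<n. int ?w - 2 * int (filling_of F ! j)))"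
    by (rule sum.reindex_bij_betw[OF bij_filling_of, symmetric])
  also have "\<dots> = ssyt_gf (t\<^sup>2) m (row_len lam) / t ^ (?w * n)"
    unfolding ssyt_gf_def sum_divide_distrib by (intro sum.cong refl summand)
  also have "\<dots> = qvand t (beads m (row_len lam) ` {..<m}) / qvand t {..<m}"
    unfolding gf n_eq[symmetric] using t by simp
  finally show ?thesis .
qed

end

lemma sorted_bracket_partition:
  assumes "length vs = Suc (length hs)"
  shows "sorted_wrt (\<ge>) (bracket_partition hs vs)"
proof -
  have "sorted_wrt (\<ge>) (concat (map (\<lambda>i. replicate (vs ! i) (sum_list (take (length hs - i) hs))) [0..<length hs]))"
    using row_len_bracket_partition(2)[OF assms] unfolding parts_bead_word[OF assms] by (simp add: sorted_wrt_append)
  then show ?thesis unfolding bracket_partition_def by (rule sorted_wrt_filter)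
qed

theorem bracket_iso_if_char_eq:
  assumes len: "length vs = Suc (length hs)" "length vs' = Suc (length hs')"
    and char: "\<And>t. 1 < t \<Longrightarrow> bracket_char t hs vs = bracket_char t hs' vs'"
  shows "\<langle>hs \<parallel> vs\<rangle> \<simeq>\<^sub>S\<^sub>L \<langle>hs' \<parallel> vs'\<rangle>"
proof -
  let ?lam = "bracket_partition hs vs" and ?m = "sum_list vs"
  let ?lam' = "bracket_partition hs' vs'" and ?m' = "sum_list vs'"
  let ?w = "\<lambda>lam m T. \<Sum>j<sum_list lam. int (m - 1) - 2 * int (T ! j)"
  interpret M: unitary_module "\<langle>hs \<parallel> vs\<rangle>" "lists_over (sum_list ?lam) (lists_over (?m - 1) UNIV)"
      "tensor_matrix (sum_list ?lam) (?m - 1)" "tensor_weight (sum_list ?lam) (?m - 1)"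
    unfolding bracket_def by (rule unitary_module_schur_sym)
  interpret N: unitary_module "\<langle>hs' \<parallel> vs'\<rangle>" "lists_over (sum_list ?lam') (lists_over (?m' - 1) UNIV)"
      "tensor_matrix (sum_list ?lam') (?m' - 1)" "tensor_weight (sum_list ?lam') (?m' - 1)"
    unfolding bracket_def by (rule unitary_module_schur_sym)
  interpret unitary_pair "\<langle>hs \<parallel> vs\<rangle>" "lists_over (sum_list ?lam) (lists_over (?m - 1) UNIV)"
      "tensor_matrix (sum_list ?lam) (?m - 1)" "tensor_weight (sum_list ?lam) (?m - 1)"
      "\<langle>hs' \<parallel> vs'\<rangle>" "lists_over (sum_list ?lam') (lists_over (?m' - 1) UNIV)"
      "tensor_matrix (sum_list ?lam') (?m' - 1)" "tensor_weight (sum_list ?lam') (?m' - 1)" ..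
  interpret tb: tableau_basis ?lam ?m "sym_basis (?m - 1)" "sym_point (?m - 1)"
    by (rule tableau_basis_sym[OF sorted_bracket_partition[OF len(1)]])
  interpret tb': tableau_basis ?lam' ?m' "sym_basis (?m' - 1)" "sym_point (?m' - 1)"
    by (rule tableau_basis_sym[OF sorted_bracket_partition[OF len(2)]])
  have ch: "(\<Sum>T\<in>tb.ssyt. t powi ?w ?lam ?m T) = bracket_char t hs vs" if t: "1 < t" for t :: real
    using tb.ssyt_character[OF t row_len_bracket_partition_0[OF len(1)]]
    by (simp add: bracket_char_def beads_bracket_partition[OF len(1)] tb.n_def)
  have ch': "(\<Sum>T\<in>tb'.ssyt. t powi ?w ?lam' ?m' T) = bracket_char t hs' vs'" if t: "1 < t" for t :: real
    using tb'.ssyt_character[OF t row_len_bracket_partition_0[OF len(2)]]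
    by (simp add: bracket_char_def beads_bracket_partition[OF len(2)] tb'.n_def)
  have "card {T\<in>tb.ssyt. ?w ?lam ?m T = k} = card {T\<in>tb'.ssyt. ?w ?lam' ?m' T = k}" for k
    by (rule finite_sum_powi_determines_counts[OF tb.finite_ssyt tb'.finite_ssyt]) (simp only: ch ch' char)
  then show ?thesis
    using dim_wspace_schur_sym[OF sorted_bracket_partition[OF len(1)], of ?m]
      dim_wspace_schur_sym[OF sorted_bracket_partition[OF len(2)], of ?m']
    by (intro sl2_iso_if_equal_weights) (simp add: bracket_def)
qed

theorem theorem3p10:
  fixes s u v z :: nat and xs ys :: "nat list"
  assumes "length xs = s" and "length ys = s"
  shows "(\<langle>xs @ [u] @ ys \<parallel> [z] @ xs @ [v] @ ys\<rangle>
            \<simeq>\<^sub>S\<^sub>L \<langle>xs @ [v] @ ys \<parallel> [z] @ xs @ [u] @ ys\<rangle>) \<and>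
         (\<langle>rev ys @ [u] @ rev xs \<parallel> rev ys @ [v] @ rev xs @ [z]\<rangle>
            \<simeq>\<^sub>S\<^sub>L \<langle>rev ys @ [v] @ rev xs \<parallel> rev ys @ [u] @ rev xs @ [z]\<rangle>) \<and>
         (\<langle>xs @ [u] @ ys \<parallel> [z] @ xs @ [v] @ ys\<rangle>
            \<simeq>\<^sub>S\<^sub>L \<langle>rev ys @ [u] @ rev xs \<parallel> rev ys @ [v] @ rev xs @ [z]\<rangle>) \<and>
         (\<langle>xs @ [v] @ ys \<parallel> [z] @ xs @ [u] @ ys\<rangle>
            \<simeq>\<^sub>S\<^sub>L \<langle>rev ys @ [v] @ rev xs \<parallel> rev ys @ [u] @ rev xs @ [z]\<rangle>)"
proof -
  have len: "length xs = length ys" using assms by simp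
  have row: "bracket_char t (xs @ [u] @ ys) ([z] @ xs @ [v] @ ys) = bracket_char t (xs @ [v] @ ys) ([z] @ xs @ [u] @ ys)"
    if "1 < t" for t by (rule bracket_char_swap[OF that len])
  have col: "bracket_char t (rev ys @ [a] @ rev xs) (rev ys @ [b] @ rev xs @ [z]) = bracket_char t (xs @ [a] @ ys) ([z] @ xs @ [b] @ ys)"
    if "1 < t" for t a b
    using bracket_char_rev[OF that, of "[z] @ xs @ [b] @ ys" "xs @ [a] @ ys"] len by simp
  show ?thesis
    using len by (intro conjI bracket_iso_if_char_eq) (simp_all only: row col, simp_all)
qed

end
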